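(* Let $(\mathfrak{A},\mathfrak{b})$ be a Blanchfield module with a fixed decomposition $\mathfrak{A}=\bigoplus_{i=1}^q\mathfrak{A}_i$, $\mathfrak{A}_i=\frac{\mathbb{Q}[t^{\pm1}]}{(\delta_i)}\eta_i$, and associated set $\Xi$, as described in the context. For $(\underline{i},\underline{\ell})=((i_1,i_2,i_3),(\ell_1,\ell_2,\ell_3))\in\Xi$, set $$b(\underline{i},\underline{\ell})=\begin{cases}m_{i_2}m_{i_3}&\text{if the }(i_j,\ell_j)\text{ are all distinct and }m_{i_2}+m_{i_3}\leq m_{i_1}+1,\\ m_{i_2}m_{i_3}-\frac12(m_{i_2}+m_{i_3}-m_{i_1})(m_{i_2}+m_{i_3}-m_{i_1}-1)&\text{if the }(i_j,\ell_j)\text{ are all distinct and }m_{i_2}+m_{i_3}>m_{i_1}+1,\\ 1&\text{otherwise,}\end{cases}$$ and $$B(\underline{i},\underline{\ell})=\begin{cases}m_{i_2}m_{i_3}&\text{if the }(i_j,\ell_j)\text{ are all distinct},\\ m_{i_3}(m_{i_1}-1)&\text{if }(i_1,\ell_1)=(i_2,\ell_2)\neq(i_3,\ell_3),\\ \frac12m_{i_2}(m_{i_2}-1)&\text{if }(i_1,\ell_1)\neq(i_2,\ell_2)=(i_3,\ell_3),\\ \frac12(m_{i_1}-1)(m_{i_1}-2)&\text{if }(i_1,\ell_1)=(i_2,\ell_2)=(i_3,\ell_3).\end{cases}$$ Then $$\sum_{(\underline{i},\underline{\ell})\in\Xi}b(\underline{i},\underline{\ell})\leq\dim_{\mathbb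{Q}}(\mathcal{H})\leq\sum_{(\underline{i},\underline{\ell})\in\Xi}B(\underline{i},\underline{\ell}).$$
   Context: Blanchfield modules. A $\mathbb{Q}$SK-pair $(M,K)$ consists of a rational homology 3-sphere $M$ (an oriented compact 3-manifold with the same rational homology as $S^3$) and a knot $K\subset M$ which is trivial in $H_1(M;\mathbb{Z})$. Let $\tilde X$ be the infinite cyclic covering of the exterior $X$ of $K$, associated with the kernel of $\pi_1(X)\to H_1(X;\mathbb{Z})/\mathrm{torsion}\cong\mathbb{Z}$, with generating deck transformation $\tau$. Its Alexander module is $H_1(\tilde X;\mathbb{Q})$, a finitely generated torsion $\mathbb{Q}[t^{\pm1}]$-module with $t$ acting as $\tau_*$. Its Blanchfield form is defined by $\mathfrak{b}([\mu_1],[\mu_2])=\frac1{P(t)}\sum_{k\in\mathbb{Z}}\langle S,\tau^k(\mu_2)\rangle t^k\bmod\mathbb{Q}[t^{\pm1}]$, for knots $\mu_1,\mu_2$ in $\tilde X$ with $\mu_1$ disjoint from all $\tau^k(\mu_2)$, $P\neq0$, $\partial S=P(\tau)\mu_1$; it is hermitian, non degenerate, with values in $\mathbb{Q}(t)/\mathbb{Q}[t^{\pm1}]$. A Blanchfield module $(\mathfrak{A},\mathfrak{b})$ is a module with a pairing isomorphic to the Alexander module of some $\mathbb{Q}$SK-pair with its Blanchfield form. Decomposition. Fix a family $(\eta_i)_{1\leq i\leq q}$ in $\mathfrak{A}$, an involution $d$ of that family, and polynomials $a_i,\delta_i\in\mathbb{Q}[t^{\pm1}]$ such that: $\mathfrak{A}=\bigoplus_{i=1}^q\mathfrak{A}_i$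 with $\mathfrak{A}_i=\frac{\mathbb{Q}[t^{\pm1}]}{(\delta_i)}\eta_i$; $\mathfrak{b}(\eta_i,d(\eta_j))=0$ if $i\neq j$; each $\delta_i$ is a power of a prime polynomial; $\mathfrak{b}(\eta_i,d(\eta_i))=\frac{a_i}{\delta_i}$ with $a_i$ prime to $\delta_i$. Write $m_i$ for the exponent when $\delta_i$ is written as a power of a prime polynomial (so $m_i$ is the multiplicity of any complex root of $\delta_i$); it is required that $m_i\geq m_{i+1}$, and that $\delta_i\in\mathbb{Q}[t]$, $\delta_i(0)\neq0$, $\delta_i(1)=1$. Such a decomposition always exists. $\mathcal{H}$ is the quotient of the $\mathbb{Q}$-vector space $\Lambda^3_{\mathbb{Q}}\mathfrak{A}$ by the $\mathbb{Q}$-subspace generated by all $\beta_1\wedge\beta_2\wedge\beta_3-t\beta_1\wedge t\beta_2\wedge t\beta_3$. The set $\Xi$. For $1\leq i\leq q$, let $z_{i1},\dots,z_{iq_i}$ be the distinct complex roots of $\delta_i$, so that $\mathbb{C}\otimes\mathfrak{A}_i=\bigoplus_{\ell=1}^{q_i}\frac{\mathbb{C}[t^{\pm1}]}{((t-z_{i\ell})^{m_i})}\eta_{i\ell}$. For $\underline{i}=(i_1,i_2,i_3)$ with $i_1\leq i_2\leq i_3$ let $J_{\underline{i}}=\{1,\dots,q_{i_1}\}\times\{1,\dots,q_{i_2}\}\times\{1,\dots,q_{i_3}\}$ and let $J^o_{\underline{i}}$ be the set of $\underline{\ell}=(\ell_1,\ell_2,\ell_3)\in J_{\underline{i}}$ such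 that, for $j=1,2$, if $i_j=i_{j+1}$ then $\ell_j\leq\ell_{j+1}$. Then $\Xi$ is the set of all $(\underline{i},\underline{\ell})$ such that $1\leq i_1\leq i_2\leq i_3\leq q$, $\underline{\ell}\in J^o_{\underline{i}}$, $z_{i_1\ell_1}z_{i_2\ell_2}z_{i_3\ell_3}=1$, and for $j=1,2,3$ the multiplicity $m_{i_j}$ is at least the number of occurrences of $(i_j,\ell_j)$ in $((i_1,\ell_1),(i_2,\ell_2),(i_3,\ell_3))$. *)

theory Defs
  imports
    "HOL-Analysis.Analysis"
    "HOL-Homology.Homology"
    "HOL-Library.Poly_Mapping"
    "HOL-Computational_Algebra.Fraction_Field"
    "HOL-Computational_Algebra.Polynomial_Factorial"
    "Jordan_Normal_Form.VS_Connect"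
begin

section \<open>Linear algebra\<close>

text \<open>The group algebra of the integers over \<open>\<rat>\<close> is \<open>\<rat>[t\<^sup>\<plusminus>\<^sup>1]\<close>, with \<open>single k q\<close> as \<open>q t\<^sup>k\<close>.\<close>

type_synonym laurent = "int \<Rightarrow>\<^sub>0 rat"

definition tvar :: laurent where
  "tvar = Poly_Mapping.single 1 1"

definition laurent_of_poly :: "rat poly \<Rightarrow> laurent" where
  "laurent_of_poly p = (\<Sum>n\<le>Polynomial.degree p. Poly_Mapping.single (int n) (Polynomial.coeff p n))"

text \<open>The involution \<open>P(t) \<mapsto> P(t\<^sup>-\<^sup>1)\<close>.\<close>

definition laurent_bar :: "laurent \<Rightarrow> laurent" where
  "laurent_bar P = Poly_Mapping.map_key uminus P"

text \<open>The library's \<open>coprime\<close> needs a class with a division operation, which \<open>laurent\<close> lacks.\<close>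

definition laurent_coprime :: "laurent \<Rightarrow> laurent \<Rightarrow> bool" where
  "laurent_coprime a d \<longleftrightarrow> (\<forall>c. c dvd a \<longrightarrow> c dvd d \<longrightarrow> c dvd 1)"

definition rat_scale :: "rat \<Rightarrow> ('x \<Rightarrow>\<^sub>0 rat) \<Rightarrow> ('x \<Rightarrow>\<^sub>0 rat)" where
  "rat_scale q c = Poly_Mapping.map ((*) q) c"

definition lin_extend :: "('x \<Rightarrow> ('y \<Rightarrow>\<^sub>0 rat)) \<Rightarrow> ('x \<Rightarrow>\<^sub>0 rat) \<Rightarrow> ('y \<Rightarrow>\<^sub>0 rat)" where
  "lin_extend f c = (\<Sum>x\<in>Poly_Mapping.keys c. rat_scale (Poly_Mapping.lookup c x) (f x))"

text \<open>Modules are records of \<open>HOL-Algebra\<close>. The fields \<open>mult\<close> and \<open>one\<close>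
  of such a record play no role in the module axioms.\<close>

definition free_qspace :: "'x set \<Rightarrow> (rat, 'x \<Rightarrow>\<^sub>0 rat) module" where
  "free_qspace S = \<lparr>carrier = {c. Poly_Mapping.keys c \<subseteq> S}, mult = (\<lambda>_ _. 0), one = 0,
     zero = 0, add = (+), smult = rat_scale\<rparr>"

definition quot_module :: "('r, 'v) module \<Rightarrow> 'v set \<Rightarrow> ('r, 'v set) module" where
  "quot_module V W = \<lparr>carrier = a_rcosets\<^bsub>V\<^esub> W, mult = (\<lambda>_ _. W), one = W, zero = W,
     add = set_add V, smult = (\<lambda>q C. \<Union>v\<in>C. W +>\<^bsub>V\<^esub> (q \<odot>\<^bsub>V\<^esub> v))\<rparr>"

abbreviation lin_span :: "('r::{times,plus,one,zero}, 'v) module \<Rightarrow> 'v set \<Rightarrow> 'v set" where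
  "lin_span V \<equiv> LinearCombinations.module.span class_ring V"

definition module_iso ::
    "('r::{times,plus,one,zero}, 'v) module \<Rightarrow> ('r, 'w) module \<Rightarrow> ('v \<Rightarrow> 'w) set" where
  "module_iso V W = {f \<in> module_hom class_ring V W. bij_betw f (carrier V) (carrier W)}"

section \<open>Rational singular homology\<close>

type_synonym 'a qchain = "((nat \<Rightarrow> real) \<Rightarrow> 'a) \<Rightarrow>\<^sub>0 rat"

definition qboundary :: "nat \<Rightarrow> 'a qchain \<Rightarrow> 'a qchain" where
  "qboundary p c = (if p = 0 then 0 else
     lin_extend (\<lambda>\<sigma>. \<Sum>k\<le>p. Poly_Mapping.single (singular_face p k \<sigma>) ((-1) ^ k)) c)"

definition qchain_map :: "nat \<Rightarrow> ('a \<Rightarrow> 'b) \<Rightarrow> 'a qchain \<Rightarrow> 'b qchain" where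
  "qchain_map p g c = lin_extend (\<lambda>\<sigma>. Poly_Mapping.single (simplex_map p g \<sigma>) 1) c"

definition qchains :: "nat \<Rightarrow> 'a topology \<Rightarrow> 'a qchain set" where
  "qchains p X = carrier (free_qspace (singular_simplex_set p X))"

definition qcycles :: "nat \<Rightarrow> 'a topology \<Rightarrow> 'a qchain set" where
  "qcycles p X = {c \<in> qchains p X. qboundary p c = 0}"

definition qboundaries :: "nat \<Rightarrow> 'a topology \<Rightarrow> 'a qchain set" where
  "qboundaries p X = qboundary (Suc p) ` qchains (Suc p) X"

definition rat_homology :: "nat \<Rightarrow> 'a topology \<Rightarrow> (rat, 'a qchain set) module" where
  "rat_homology p X = quot_module
     (free_qspace (singular_simplex_set p X) \<lparr>carrier := qcycles p X\<rparr>) (qboundaries p X)"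

section \<open>Three-manifolds and orientations\<close>

definition manifold3 :: "'a topology \<Rightarrow> bool" where
  "manifold3 M \<longleftrightarrow> Hausdorff_space M \<and> second_countable M \<and>
     (\<forall>x\<in>topspace M. \<exists>U. openin M U \<and> x \<in> U \<and>
        subtopology M U homeomorphic_space Euclidean_space 3)"

text \<open>An orientation is a locally consistent choice of generators \<open>orn x\<close> of the local homology
  groups \<open>H\<^sub>3(M, M - x)\<close>.\<close>

definition orientation3 :: "'a topology \<Rightarrow> ('a \<Rightarrow> 'a chain set) \<Rightarrow> bool" where
  "orientation3 M orn \<longleftrightarrow> (\<forall>x\<in>topspace M.
     (let G = relative_homology_group 3 M (topspace M - {x}) in
        orn x \<in> carrier G \<and> carrier (subgroup_generated G {orn x}) = carrier G) \<and>
     (\<exists>U c. openin M U \<and> x \<in> U \<and> singular_relcycle 3 M (topspace M - U) c \<and>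
        (\<forall>y\<in>U. orn y = homologous_rel_set 3 M (topspace M - {y}) c)))"

text \<open>A closed manifold is meant (a compact 3-manifold with boundary has no rational homology
  in degree 3).\<close>

definition rational_homology_sphere :: "'a topology \<Rightarrow> bool" where
  "rational_homology_sphere M \<longleftrightarrow> compact_space M \<and> manifold3 M \<and>
     (\<forall>p. module_iso (rat_homology p M) (rat_homology p (nsphere 3)) \<noteq> {})"

definition pt3 :: "real \<Rightarrow> real \<Rightarrow> real \<Rightarrow> nat \<Rightarrow> real" where
  "pt3 x y z = (\<lambda>i. if i = 0 then x else if i = 1 then y else if i = 2 then z else 0)"

text \<open>The map \<open>f\<close>, from \<open>\<real>\<^sup>3\<close> to an oriented 3-manifold and injective near the origin,
  preserves the orientation there. It is tested on the simplex with vertices \<open>(-r,-r,-r)\<close>,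
  \<open>(r,0,0)\<close>, \<open>(0,r,0)\<close>, \<open>(0,0,r)\<close>, which contains the origin in its interior and
  whose vertices are positively ordered.\<close>

definition orientation_preserving_at_0 ::
    "'a topology \<Rightarrow> ('a \<Rightarrow> 'a chain set) \<Rightarrow> ((nat \<Rightarrow> real) \<Rightarrow> 'a) \<Rightarrow> bool" where
  "orientation_preserving_at_0 M orn f \<longleftrightarrow> (\<exists>r>0.
     inj_on f {v \<in> topspace (Euclidean_space 3). \<forall>i<3. \<bar>v i\<bar> \<le> r} \<and>
     orn (f (pt3 0 0 0)) = homologous_rel_set 3 M (topspace M - {f (pt3 0 0 0)})
       (frag_of (\<lambda>x\<in>standard_simplex 3.
          f (pt3 (r * (x 1 - x 0)) (r * (x 2 - x 0)) (r * (x 3 - x 0))))))"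

section \<open>Knots and intersection numbers\<close>

text \<open>Knots are tame and oriented. They are given together with a tubular neighbourhood: an open
  embedding of \<open>\<real>\<^sup>2 \<times> \<real>/\<int>\<close>, written as a map \<open>h\<close> on \<open>\<real>\<^sup>3\<close> with period 1
  in the last coordinate, and the knot is the image of \<open>0 \<times> \<real>/\<int>\<close>. No notion below depends on the
  choice of the neighbourhood of a given oriented knot, up to homeomorphism for the exterior.\<close>

definition knot_tube :: "'a topology \<Rightarrow> ((nat \<Rightarrow> real) \<Rightarrow> 'a) \<Rightarrow> bool" where
  "knot_tube X h \<longleftrightarrow> continuous_map (Euclidean_space 3) X h \<and> open_map (Euclidean_space 3) X h \<and>
     (\<forall>v\<in>topspace (Euclidean_space 3). \<forall>w\<in>topspace (Euclidean_space 3).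
        h v = h w \<longleftrightarrow> v 0 = w 0 \<and> v 1 = w 1 \<and> (\<exists>n::int. w 2 = v 2 + of_int n))"

definition knot_set :: "((nat \<Rightarrow> real) \<Rightarrow> 'a) \<Rightarrow> 'a set" where
  "knot_set h = (\<lambda>s. h (pt3 0 0 s)) ` UNIV"

definition knot_simplex :: "((nat \<Rightarrow> real) \<Rightarrow> 'a) \<Rightarrow> (nat \<Rightarrow> real) \<Rightarrow> 'a" where
  "knot_simplex h = (\<lambda>x\<in>standard_simplex 1. h (pt3 0 0 (x 1)))"

text \<open>The image of the positively oriented triangle with vertices \<open>(-1,-1)\<close>, \<open>(1,0)\<close>,
  \<open>(0,1)\<close> in \<open>\<real>\<^sup>2 \<times> 0\<close>. If \<open>h\<close> preserves the orientation, this disc meets the knot once,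
  positively.\<close>

definition meridian_disc :: "((nat \<Rightarrow> real) \<Rightarrow> 'a) \<Rightarrow> (nat \<Rightarrow> real) \<Rightarrow> 'a" where
  "meridian_disc h = (\<lambda>x\<in>standard_simplex 2. h (pt3 (x 1 - x 0) (x 2 - x 0) 0))"

text \<open>The algebraic intersection number \<open>\<langle>S, \<mu>\<rangle>\<close> of a 2-chain \<open>S\<close> with a knot \<open>\<mu>\<close> disjoint from
  the support of its boundary is \<open>n\<close>. The space \<open>H\<^sub>2(X, X - \<mu>; \<rat>)\<close> is of dimension 1, generated
  by a meridian disc, and the class of \<open>S\<close> is \<open>n\<close> times this generator.\<close>

definition intersection_number ::
    "'a topology \<Rightarrow> 'a qchain \<Rightarrow> ((nat \<Rightarrow> real) \<Rightarrow> 'a) \<Rightarrow> rat \<Rightarrow> bool" where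
  "intersection_number X S h n \<longleftrightarrow>
     (\<exists>d\<in>qchains 3 X. \<exists>e\<in>qchains 2 (subtopology X (topspace X - knot_set h)).
        S = Poly_Mapping.single (meridian_disc h) n + qboundary 3 d + e)"

section \<open>Null-homologous knots and their infinite cyclic coverings\<close>

definition QSK_pair ::
    "'a topology \<Rightarrow> ('a \<Rightarrow> 'a chain set) \<Rightarrow> ((nat \<Rightarrow> real) \<Rightarrow> 'a) \<Rightarrow> bool" where
  "QSK_pair M orn h \<longleftrightarrow> rational_homology_sphere M \<and> orientation3 M orn \<and> knot_tube M h \<and>
     singular_relboundary 1 M {} (frag_of (knot_simplex h))"

definition knot_exterior :: "'a topology \<Rightarrow> ((nat \<Rightarrow> real) \<Rightarrow> 'a) \<Rightarrow> 'a topology" where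
  "knot_exterior M h = subtopology M
     (topspace M - h ` {v \<in> topspace (Euclidean_space 3). (v 0)\<^sup>2 + (v 1)\<^sup>2 < 1})"

definition covering_map :: "'a topology \<Rightarrow> 'b topology \<Rightarrow> ('a \<Rightarrow> 'b) \<Rightarrow> bool" where
  "covering_map Y X p \<longleftrightarrow> continuous_map Y X p \<and> p ` topspace Y = topspace X \<and>
     (\<forall>x\<in>topspace X. \<exists>U. openin X U \<and> x \<in> U \<and>
        (\<exists>\<V>. \<Union>\<V> = topspace Y \<inter> p -` U \<and> pairwise disjnt \<V> \<and>
           (\<forall>V\<in>\<V>. openin Y V \<and> homeomorphic_map (subtopology Y V) (subtopology X U) p)))"

definition homeo_pow :: "'a topology \<Rightarrow> ('a \<Rightarrow> 'a) \<Rightarrow> int \<Rightarrow> 'a \<Rightarrow> 'a" where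
  "homeo_pow Y \<tau> k = (if 0 \<le> k then \<tau> ^^ nat k else inv_into (topspace Y) \<tau> ^^ nat (- k))"

text \<open>The subgroup of \<open>\<pi>\<^sub>1(X)\<close> given by a covering \<open>p : Y \<rightarrow> X\<close> consists of the loops all of whose
  lifts \<open>g\<close> to \<open>Y\<close> are closed. It is required to be the kernel of
  \<open>\<pi>\<^sub>1(X) \<rightarrow> H\<^sub>1(X; \<int>)/torsion\<close>. The last two lines express that \<open>\<tau>\<close> generates the group of
  deck transformations.\<close>

definition inf_cyclic_covering ::
    "'b topology \<Rightarrow> 'a topology \<Rightarrow> ('a \<Rightarrow> 'b) \<Rightarrow> ('a \<Rightarrow> 'a) \<Rightarrow> bool" where
  "inf_cyclic_covering X Y p \<tau> \<longleftrightarrow> path_connected_space Y \<and> covering_map Y X p \<and>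
     (\<forall>g. singular_simplex 1 Y g \<and> p (simplicial_vertex 0 g) = p (simplicial_vertex 1 g) \<longrightarrow>
        (simplicial_vertex 0 g = simplicial_vertex 1 g \<longleftrightarrow>
         (\<exists>n>0. singular_relboundary 1 X {} (frag_cmul n (frag_of (simplex_map 1 p g)))))) \<and>
     homeomorphic_map Y Y \<tau> \<and> (\<forall>y\<in>topspace Y. p (\<tau> y) = p y) \<and>
     (\<forall>x\<in>topspace Y. \<forall>y\<in>topspace Y. p x = p y \<longrightarrow> (\<exists>k. homeo_pow Y \<tau> k x = y))"

section \<open>Blanchfield modules\<close>

text \<open>The chain \<open>P(\<tau>)(c)\<close>.\<close>

definition laurent_act :: "nat \<Rightarrow> 'a topology \<Rightarrow> ('a \<Rightarrow> 'a) \<Rightarrow> laurent \<Rightarrow> 'a qchain \<Rightarrow> 'a qchain" where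
  "laurent_act p Y \<tau> P c = (\<Sum>k\<in>Poly_Mapping.keys P.
     rat_scale (Poly_Mapping.lookup P k) (qchain_map p (homeo_pow Y \<tau> k) c))"

text \<open>The space \<open>H\<^sub>1(Y; \<rat>)\<close> with \<open>t\<close> acting as \<open>\<tau>\<close>.\<close>

definition alexander_module :: "'a topology \<Rightarrow> ('a \<Rightarrow> 'a) \<Rightarrow> (laurent, 'a qchain set) module" where
  "alexander_module Y \<tau> = quot_module
     \<lparr>carrier = qcycles 1 Y, mult = (\<lambda>_ _. 0), one = 0, zero = 0, add = (+),
      smult = laurent_act 1 Y \<tau>\<rparr> (qboundaries 1 Y)"

definition knot_class :: "'a topology \<Rightarrow> ((nat \<Rightarrow> real) \<Rightarrow> 'a) \<Rightarrow> 'a qchain set" where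
  "knot_class Y h = qboundaries 1 Y +>\<^bsub>free_qspace (singular_simplex_set 1 Y)\<^esub>
     Poly_Mapping.single (knot_simplex h) 1"

text \<open>The module \<open>\<rat>(t)/\<rat>[t\<^sup>\<plusminus>\<^sup>1]\<close>.\<close>

definition qt_module :: "(laurent, laurent fract) module" where
  "qt_module = \<lparr>carrier = UNIV, mult = (*), one = 1, zero = 0, add = (+),
     smult = (\<lambda>P f. Fract P 1 * f)\<rparr>"

definition qt_mod :: "(laurent, laurent fract set) module" where
  "qt_mod = quot_module qt_module (range (\<lambda>P. Fract P 1))"

definition qt_class :: "laurent fract \<Rightarrow> laurent fract set" where
  "qt_class f = range (\<lambda>P. Fract P 1) +>\<^bsub>qt_module\<^esub> f"

text \<open>The Blanchfield form is the sesquilinear form whose values on classes of knots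
  \<open>h\<^sub>1\<close>, \<open>h\<^sub>2\<close> are given by intersection numbers; such classes span the Alexander
  module over \<open>\<rat>\<close>. That the form is hermitian and non degenerate is then a theorem. The manifold
  \<open>Y\<close> carries the orientation lifted from \<open>M\<close>, hence the condition on \<open>p \<circ> h\<close>. The Laurent polynomial
  \<open>L\<close> is \<open>\<Sum>\<^sub>k \<langle>S, \<tau>\<^sup>k(h\<^sub>2)\<rangle> t\<^sup>k\<close>.\<close>

definition blanchfield_form ::
    "'b topology \<Rightarrow> ('b \<Rightarrow> 'b chain set) \<Rightarrow> 'a topology \<Rightarrow> ('a \<Rightarrow> 'b) \<Rightarrow> ('a \<Rightarrow> 'a) \<Rightarrow>
     ('a qchain set \<Rightarrow> 'a qchain set \<Rightarrow> laurent fract set) \<Rightarrow> bool" where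
  "blanchfield_form M orn Y p \<tau> \<beta> \<longleftrightarrow> (let A = alexander_module Y \<tau> in
     (\<forall>x\<in>carrier A. \<forall>y\<in>carrier A. \<beta> x y \<in> carrier qt_mod) \<and>
     (\<forall>x\<in>carrier A. \<forall>x'\<in>carrier A. \<forall>y\<in>carrier A.
        \<beta> (x \<oplus>\<^bsub>A\<^esub> x') y = \<beta> x y \<oplus>\<^bsub>qt_mod\<^esub> \<beta> x' y \<and>
        \<beta> y (x \<oplus>\<^bsub>A\<^esub> x') = \<beta> y x \<oplus>\<^bsub>qt_mod\<^esub> \<beta> y x') \<and>
     (\<forall>P. \<forall>x\<in>carrier A. \<forall>y\<in>carrier A.
        \<beta> (P \<odot>\<^bsub>A\<^esub> x) y = P \<odot>\<^bsub>qt_mod\<^esub> \<beta> x y \<and>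
        \<beta> x (P \<odot>\<^bsub>A\<^esub> y) = laurent_bar P \<odot>\<^bsub>qt_mod\<^esub> \<beta> x y) \<and>
     (\<forall>h\<^sub>1 h\<^sub>2 P S L.
        knot_tube Y h\<^sub>1 \<and> orientation_preserving_at_0 M orn (p \<circ> h\<^sub>1) \<and>
        knot_tube Y h\<^sub>2 \<and> orientation_preserving_at_0 M orn (p \<circ> h\<^sub>2) \<and>
        (\<forall>k. knot_set h\<^sub>1 \<inter> homeo_pow Y \<tau> k ` knot_set h\<^sub>2 = {}) \<and>
        P \<noteq> 0 \<and> S \<in> qchains 2 Y \<and>
        qboundary 2 S = laurent_act 1 Y \<tau> P (Poly_Mapping.single (knot_simplex h\<^sub>1) 1) \<and>
        (\<forall>k. intersection_number Y S (homeo_pow Y \<tau> k \<circ> h\<^sub>2) (Poly_Mapping.lookup L k)) \<longrightarrow>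
        \<beta> (knot_class Y h\<^sub>1) (knot_class Y h\<^sub>2) = qt_class (Fract L P)))"

text \<open>Taking all spaces with points in \<open>nat \<Rightarrow> real\<close> (and arbitrary topologies) is no restriction,
  since nonempty connected manifolds of positive dimension have the cardinality of the continuum.\<close>

definition blanchfield_module :: "(laurent, 'v) module \<Rightarrow> ('v \<Rightarrow> 'v \<Rightarrow> laurent fract set) \<Rightarrow> bool" where
  "blanchfield_module A b \<longleftrightarrow> Module.module class_ring A \<and>
     (\<exists>(M :: (nat \<Rightarrow> real) topology) orn h (Y :: (nat \<Rightarrow> real) topology) p \<tau> \<beta> f.
        QSK_pair M orn h \<and> inf_cyclic_covering (knot_exterior M h) Y p \<tau> \<and>
        blanchfield_form M orn Y p \<tau> \<beta> \<and>
        f \<in> module_iso A (alexander_module Y \<tau>) \<and>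
        (\<forall>x\<in>carrier A. \<forall>y\<in>carrier A. b x y = \<beta> (f x) (f y)))"

text \<open>The family is \<open>\<eta> 1, \<dots>, \<eta> q\<close>, its involution is given on indices by \<open>d\<close>, and
  \<open>m i\<close> is the exponent in \<open>\<delta> i\<close>. The third and fourth conditions say that \<open>A\<close> is the direct sum of
  the submodules generated by the \<open>\<eta> i\<close>, with annihilators generated by the \<open>\<delta> i\<close>.\<close>

definition blanchfield_decomposition ::
    "(laurent, 'v) module \<Rightarrow> ('v \<Rightarrow> 'v \<Rightarrow> laurent fract set) \<Rightarrow> nat \<Rightarrow> (nat \<Rightarrow> 'v) \<Rightarrow> (nat \<Rightarrow> nat) \<Rightarrow>
     (nat \<Rightarrow> laurent) \<Rightarrow> (nat \<Rightarrow> rat poly) \<Rightarrow> (nat \<Rightarrow> nat) \<Rightarrow> bool" where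
  "blanchfield_decomposition A b q \<eta> d a \<delta> m \<longleftrightarrow>
     (\<forall>i\<in>{1..q}. \<eta> i \<in> carrier A) \<and>
     (\<forall>i\<in>{1..q}. d i \<in> {1..q} \<and> d (d i) = i) \<and>
     bij_betw (\<lambda>x. \<Oplus>\<^bsub>A\<^esub>i\<in>{1..q}. x i) (\<Pi>\<^sub>E i\<in>{1..q}. range (\<lambda>P. P \<odot>\<^bsub>A\<^esub> \<eta> i)) (carrier A) \<and>
     (\<forall>i\<in>{1..q}. \<forall>P. P \<odot>\<^bsub>A\<^esub> \<eta> i = \<zero>\<^bsub>A\<^esub> \<longleftrightarrow> laurent_of_poly (\<delta> i) dvd P) \<and>
     (\<forall>i\<in>{1..q}. \<forall>j\<in>{1..q}. i \<noteq> j \<longrightarrow> b (\<eta> i) (\<eta> (d j)) = \<zero>\<^bsub>qt_mod\<^esub>) \<and>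
     (\<forall>i\<in>{1..q}. \<exists>\<pi>. prime_elem \<pi> \<and> m i \<ge> 1 \<and> \<delta> i = \<pi> ^ m i) \<and>
     (\<forall>i\<in>{1..q}. laurent_coprime (a i) (laurent_of_poly (\<delta> i)) \<and>
        b (\<eta> i) (\<eta> (d i)) = qt_class (Fract (a i) (laurent_of_poly (\<delta> i)))) \<and>
     (\<forall>i\<in>{1..q}. \<forall>j\<in>{1..q}. i \<le> j \<longrightarrow> m j \<le> m i) \<and>
     (\<forall>i\<in>{1..q}. poly (\<delta> i) 0 \<noteq> 0 \<and> poly (\<delta> i) 1 = 1)"

section \<open>The space \<open>\<H>\<close>\<close>

definition rat_restrict :: "(laurent, 'v) module \<Rightarrow> (rat, 'v) module" where
  "rat_restrict A = \<lparr>carrier = carrier A, mult = mult A, one = one A, zero = zero A, add = add A,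
     smult = (\<lambda>q x. Poly_Mapping.single 0 q \<odot>\<^bsub>A\<^esub> x)\<rparr>"

definition ext_relations :: "(rat, 'v) module \<Rightarrow> ('v \<times> 'v \<times> 'v \<Rightarrow>\<^sub>0 rat) set" where
  "ext_relations V = (let C = carrier V; s = (\<lambda>x y z. Poly_Mapping.single (x, y, z) 1) in
     {s (x \<oplus>\<^bsub>V\<^esub> x') y z - s x y z - s x' y z | x x' y z. x \<in> C \<and> x' \<in> C \<and> y \<in> C \<and> z \<in> C} \<union>
     {s x (y \<oplus>\<^bsub>V\<^esub> y') z - s x y z - s x y' z | x y y' z. x \<in> C \<and> y \<in> C \<and> y' \<in> C \<and> z \<in> C} \<union>
     {s x y (z \<oplus>\<^bsub>V\<^esub> z') - s x y z - s x y z' | x y z z'. x \<in> C \<and> y \<in> C \<and> z \<in> C \<and> z' \<in> C} \<union>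
     {s (q \<odot>\<^bsub>V\<^esub> x) y z - rat_scale q (s x y z) | q x y z. x \<in> C \<and> y \<in> C \<and> z \<in> C} \<union>
     {s x (q \<odot>\<^bsub>V\<^esub> y) z - rat_scale q (s x y z) | q x y z. x \<in> C \<and> y \<in> C \<and> z \<in> C} \<union>
     {s x y (q \<odot>\<^bsub>V\<^esub> z) - rat_scale q (s x y z) | q x y z. x \<in> C \<and> y \<in> C \<and> z \<in> C} \<union>
     {s x x y | x y. x \<in> C \<and> y \<in> C} \<union>
     {s x y x | x y. x \<in> C \<and> y \<in> C} \<union>
     {s y x x | x y. x \<in> C \<and> y \<in> C})"

definition ext_subspace :: "(rat, 'v) module \<Rightarrow> ('v \<times> 'v \<times> 'v \<Rightarrow>\<^sub>0 rat) set" where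
  "ext_subspace V = lin_span (free_qspace (carrier V \<times> carrier V \<times> carrier V)) (ext_relations V)"

text \<open>The exterior cube, as the target of the universal alternating trilinear map \<open>wedge3 V\<close>.\<close>

definition ext_cube :: "(rat, 'v) module \<Rightarrow> (rat, ('v \<times> 'v \<times> 'v \<Rightarrow>\<^sub>0 rat) set) module" where
  "ext_cube V = quot_module (free_qspace (carrier V \<times> carrier V \<times> carrier V)) (ext_subspace V)"

definition wedge3 ::
    "(rat, 'v) module \<Rightarrow> 'v \<Rightarrow> 'v \<Rightarrow> 'v \<Rightarrow> ('v \<times> 'v \<times> 'v \<Rightarrow>\<^sub>0 rat) set" where
  "wedge3 V x y z = ext_subspace V +>\<^bsub>free_qspace (carrier V \<times> carrier V \<times> carrier V)\<^esub>
     Poly_Mapping.single (x, y, z) 1"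

definition H_space ::
    "(laurent, 'v) module \<Rightarrow> (rat, ('v \<times> 'v \<times> 'v \<Rightarrow>\<^sub>0 rat) set set) module" where
  "H_space A = (let V = rat_restrict A in
     quot_module (ext_cube V) (lin_span (ext_cube V)
       {wedge3 V x y z \<ominus>\<^bsub>ext_cube V\<^esub>
          wedge3 V (tvar \<odot>\<^bsub>A\<^esub> x) (tvar \<odot>\<^bsub>A\<^esub> y) (tvar \<odot>\<^bsub>A\<^esub> z) | x y z.
        x \<in> carrier A \<and> y \<in> carrier A \<and> z \<in> carrier A}))"

section \<open>The index set and the bounds\<close>

text \<open>Here \<open>z i 1, \<dots>, z i (r i)\<close> are the distinct complex roots of \<open>\<delta> i\<close>.\<close>

definition Xi ::
    "nat \<Rightarrow> (nat \<Rightarrow> nat) \<Rightarrow> (nat \<Rightarrow> nat) \<Rightarrow> (nat \<Rightarrow> nat \<Rightarrow> complex) \<Rightarrow>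
     ((nat \<times> nat \<times> nat) \<times> (nat \<times> nat \<times> nat)) set" where
  "Xi q m r z = {((i\<^sub>1, i\<^sub>2, i\<^sub>3), (l\<^sub>1, l\<^sub>2, l\<^sub>3)) | i\<^sub>1 i\<^sub>2 i\<^sub>3 l\<^sub>1 l\<^sub>2 l\<^sub>3.
     1 \<le> i\<^sub>1 \<and> i\<^sub>1 \<le> i\<^sub>2 \<and> i\<^sub>2 \<le> i\<^sub>3 \<and> i\<^sub>3 \<le> q \<and>
     l\<^sub>1 \<in> {1..r i\<^sub>1} \<and> l\<^sub>2 \<in> {1..r i\<^sub>2} \<and> l\<^sub>3 \<in> {1..r i\<^sub>3} \<and>
     (i\<^sub>1 = i\<^sub>2 \<longrightarrow> l\<^sub>1 \<le> l\<^sub>2) \<and> (i\<^sub>2 = i\<^sub>3 \<longrightarrow> l\<^sub>2 \<le> l\<^sub>3) \<and>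
     z i\<^sub>1 l\<^sub>1 * z i\<^sub>2 l\<^sub>2 * z i\<^sub>3 l\<^sub>3 = 1 \<and>
     (\<forall>(i, l) \<in> {(i\<^sub>1, l\<^sub>1), (i\<^sub>2, l\<^sub>2), (i\<^sub>3, l\<^sub>3)}.
        count_list [(i\<^sub>1, l\<^sub>1), (i\<^sub>2, l\<^sub>2), (i\<^sub>3, l\<^sub>3)] (i, l) \<le> m i)}"

fun lower_bound :: "(nat \<Rightarrow> nat) \<Rightarrow> (nat \<times> nat \<times> nat) \<times> (nat \<times> nat \<times> nat) \<Rightarrow> real" where
  "lower_bound m ((i\<^sub>1, i\<^sub>2, i\<^sub>3), (l\<^sub>1, l\<^sub>2, l\<^sub>3)) =
     (let m\<^sub>1 = real (m i\<^sub>1); m\<^sub>2 = real (m i\<^sub>2); m\<^sub>3 = real (m i\<^sub>3) in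
      if distinct [(i\<^sub>1, l\<^sub>1), (i\<^sub>2, l\<^sub>2), (i\<^sub>3, l\<^sub>3)]
      then if m\<^sub>2 + m\<^sub>3 \<le> m\<^sub>1 + 1 then m\<^sub>2 * m\<^sub>3
           else m\<^sub>2 * m\<^sub>3 - 1 / 2 * (m\<^sub>2 + m\<^sub>3 - m\<^sub>1) * (m\<^sub>2 + m\<^sub>3 - m\<^sub>1 - 1)
      else 1)"

text \<open>On \<open>Xi\<close>, the last case is the one where all three pairs coincide.\<close>

fun upper_bound :: "(nat \<Rightarrow> nat) \<Rightarrow> (nat \<times> nat \<times> nat) \<times> (nat \<times> nat \<times> nat) \<Rightarrow> real" where
  "upper_bound m ((i\<^sub>1, i\<^sub>2, i\<^sub>3), (l\<^sub>1, l\<^sub>2, l\<^sub>3)) =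
     (let m\<^sub>1 = real (m i\<^sub>1); m\<^sub>2 = real (m i\<^sub>2); m\<^sub>3 = real (m i\<^sub>3) in
      if distinct [(i\<^sub>1, l\<^sub>1), (i\<^sub>2, l\<^sub>2), (i\<^sub>3, l\<^sub>3)] then m\<^sub>2 * m\<^sub>3
      else if (i\<^sub>1, l\<^sub>1) = (i\<^sub>2, l\<^sub>2) \<and> (i\<^sub>2, l\<^sub>2) \<noteq> (i\<^sub>3, l\<^sub>3) then m\<^sub>3 * (m\<^sub>1 - 1)
      else if (i\<^sub>1, l\<^sub>1) \<noteq> (i\<^sub>2, l\<^sub>2) \<and> (i\<^sub>2, l\<^sub>2) = (i\<^sub>3, l\<^sub>3) then 1 / 2 * m\<^sub>2 * (m\<^sub>2 - 1)
      else 1 / 2 * (m\<^sub>1 - 1) * (m\<^sub>1 - 2))"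

end

theory Submission
  imports Defs
    "HOL-Computational_Algebra.Field_as_Ring"
    "HOL-Computational_Algebra.Fundamental_Theorem_Algebra"
begin

text \<open>
  Linear functionals on \<open>\<H>\<close> with complex values are the same as alternating trilinear forms on \<open>A\<close> over
  \<open>\<rat>\<close>, with complex values, that are invariant under \<open>t\<close> (\<open>invariant_form_of_functional\<close>,
  \<open>functional_of_invariant_form\<close>). Using complex-valued forms replaces the extension of scalars to
  \<open>\<complex>\<close>: the complex dimension of the space of these forms is the rational dimension of \<open>\<H>\<close>.

  The functionals \<open>lam ((i, l), k)\<close> that send \<open>\<Sum> P\<^sub>j \<eta>\<^sub>j\<close> to the Taylor coefficient of order
  \<open>k < m i\<close> of \<open>P\<^sub>i\<close> at the root \<open>z i l\<close> are well defined, since \<open>z i l\<close> is a root of \<open>\<delta> i\<close> of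
  multiplicity \<open>m i\<close>. They are independent and as many as \<open>dim A\<close>, because a prime rational
  polynomial has simple roots. Hence they form a basis of the complex-valued functionals on \<open>A\<close>, and a
  form is given by an antisymmetric array \<open>c (\<alpha>, \<beta>, \<gamma>)\<close> of complex coefficients. Since \<open>t\<close> acts on the
  \<open>lam ((i, l), k)\<close> by Jordan blocks, invariance becomes a recursion \<open>shift3 c = c\<close>, which relates only
  entries with the same triple of blocks. Order the blocks \<open>(i, l)\<close> lexicographically, and then the indices.
  It is enough to consider strictly increasing triples of indices. The recursion forces \<open>c\<close> to vanish on
  a triple of blocks whose eigenvalues have a product (the \<open>weight\<close>) different from 1.

  Upper bound: the recursion determines \<open>c\<close> from its values at the increasing triples of weight 1
  with first index of the form \<open>(block, 0)\<close> (\<open>antisymmetric_invariant_eq_0\<close>). There are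
  at most \<open>\<Sum> upper_bound\<close> of them.

  Lower bound: for weight 1 the recursion at a triple of degree \<open>n\<close> (the sum of the three positions)
  involves only entries of degree greater than \<open>n\<close>. If \<open>c\<close> vanishes in degrees above a bound \<open>N\<close>, chosen
  for each triple of blocks, then the number of unknowns minus the number of equations is the number of
  increasing triples of degree \<open>N\<close>. With \<open>N = m i\<^sub>1 - 1\<close> for distinct blocks, these correspond to the
  pairs of positions \<open>(j, k)\<close> in the last two blocks with \<open>j + k < m i\<^sub>1\<close>, and their number is at
  least \<open>lower_bound\<close>. If blocks coincide, \<open>lower_bound\<close> is 1, and \<open>N\<close> is the lowest degree of a strictly
  increasing triple of indices.

  Both bounds are turned into statements on \<open>dim \<H>\<close> by the fact that a homogeneous linear system with more
  unknowns than equations has a nontrivial solution (\<open>card_le_dim_H_space\<close>, \<open>dim_H_space_le_card\<close>).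
\<close>

section \<open>Quotient spaces and functionals\<close>

lemma submodule_abelian_subgroup:
  assumes V: "vectorspace (class_ring :: 'k::field ring) V" and W: "LinearCombinations.submodule class_ring W V"
  shows "abelian_subgroup W V"
proof -
  interpret V: vectorspace class_ring V by fact
  interpret W: LinearCombinations.submodule class_ring W V by fact
  have neg: "\<ominus>\<^bsub>V\<^esub> x \<in> W" if "x \<in> W" for x
  proof -
    have "(\<ominus>\<^bsub>class_ring\<^esub> \<one>\<^bsub>class_ring\<^esub>) \<odot>\<^bsub>V\<^esub> x \<in> W"
      using that by (intro W.smult_closed) (auto simp: class_ring_simps)
    moreover have "x \<in> carrier V" using that W.subset by blast
    ultimately show ?thesis using V.smult_minus_1[of x] by simp
  qed
  show ?thesis
  proof (rule abelian_subgroupI3[OF _ V.abelian_group_axioms])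
    show "additive_subgroup W V"
      by unfold_locales (use W.subset W.m_closed W.zero_closed neg V.minus_unique in \<open>auto simp: a_inv_def\<close>)
  qed
qed

text \<open>A vector space with a subspace; the elements of the quotient are the cosets \<open>W +> x\<close>.\<close>

locale quot_vs = V: vectorspace class_ring V + W: LinearCombinations.submodule class_ring W V
  for V :: "('k::field, 'v) module" and W
begin

interpretation S: abelian_subgroup W V
  by (rule submodule_abelian_subgroup) unfold_locales

lemma quot_carrier: "carrier (quot_module V W) = (\<lambda>v. W +>\<^bsub>V\<^esub> v) ` carrier V"
  by (auto simp: quot_module_def A_RCOSETS_def')

lemma quot_zero: "\<zero>\<^bsub>quot_module V W\<^esub> = W +>\<^bsub>V\<^esub> \<zero>\<^bsub>V\<^esub>"
  using W.subset by (simp add: quot_module_def)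

lemma quot_add: "x \<in> carrier V \<Longrightarrow> y \<in> carrier V \<Longrightarrow>
    (W +>\<^bsub>V\<^esub> x) \<oplus>\<^bsub>quot_module V W\<^esub> (W +>\<^bsub>V\<^esub> y) = W +>\<^bsub>V\<^esub> (x \<oplus>\<^bsub>V\<^esub> y)"
  by (simp add: quot_module_def S.a_rcos_sum)

lemma coset_eq_iff:
  assumes "x \<in> carrier V" "y \<in> carrier V"
  shows "W +>\<^bsub>V\<^esub> x = W +>\<^bsub>V\<^esub> y \<longleftrightarrow> (\<exists>w\<in>W. x = w \<oplus>\<^bsub>V\<^esub> y)"
proof
  assume "W +>\<^bsub>V\<^esub> x = W +>\<^bsub>V\<^esub> y"
  with S.a_rcos_self[OF assms(1)] have "x \<in> W +>\<^bsub>V\<^esub> y" by simp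
  thus "\<exists>w\<in>W. x = w \<oplus>\<^bsub>V\<^esub> y" by (auto simp: a_r_coset_def')
next
  assume "\<exists>w\<in>W. x = w \<oplus>\<^bsub>V\<^esub> y"
  hence "x \<in> W +>\<^bsub>V\<^esub> y" by (auto simp: a_r_coset_def')
  with V.a_repr_independence[OF _ assms(2)] S.a_subgroup show "W +>\<^bsub>V\<^esub> x = W +>\<^bsub>V\<^esub> y" by simp
qed

lemma quot_smult:
  assumes x: "x \<in> carrier V"
  shows "q \<odot>\<^bsub>quot_module V W\<^esub> (W +>\<^bsub>V\<^esub> x) = W +>\<^bsub>V\<^esub> (q \<odot>\<^bsub>V\<^esub> x)"
proof -
  have const: "W +>\<^bsub>V\<^esub> (q \<odot>\<^bsub>V\<^esub> v) = W +>\<^bsub>V\<^esub> (q \<odot>\<^bsub>V\<^esub> x)" if "v \<in> W +>\<^bsub>V\<^esub> x" for v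
  proof -
    from that obtain w where w: "w \<in> W" "v = w \<oplus>\<^bsub>V\<^esub> x" by (auto simp: a_r_coset_def')
    have wc: "w \<in> carrier V" using w W.subset by blast
    have "q \<odot>\<^bsub>V\<^esub> v = (q \<odot>\<^bsub>V\<^esub> w) \<oplus>\<^bsub>V\<^esub> (q \<odot>\<^bsub>V\<^esub> x)"
      using w wc x by (simp add: V.smult_r_distr)
    moreover have "q \<odot>\<^bsub>V\<^esub> w \<in> W" using w by simp
    ultimately show ?thesis using wc w x by (subst coset_eq_iff) auto
  qed
  have "(\<Union>v\<in>W +>\<^bsub>V\<^esub> x. W +>\<^bsub>V\<^esub> (q \<odot>\<^bsub>V\<^esub> v)) = (\<Union>v\<in>W +>\<^bsub>V\<^esub> x. W +>\<^bsub>V\<^esub> (q \<odot>\<^bsub>V\<^esub> x))"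
    by (rule SUP_cong[OF refl const])
  also have "\<dots> = W +>\<^bsub>V\<^esub> (q \<odot>\<^bsub>V\<^esub> x)"
    using S.a_rcos_self[OF x] by (intro cSUP_const) blast
  finally show ?thesis by (simp add: quot_module_def)
qed

lemma quot_vectorspace: "vectorspace class_ring (quot_module V W)"
proof (rule vs_criteria)
  show "field (class_ring :: 'k ring)" by (rule class_field)
  show "\<forall>v\<in>carrier (quot_module V W).
       \<exists>neg_v\<in>carrier (quot_module V W). v \<oplus>\<^bsub>quot_module V W\<^esub> neg_v = \<zero>\<^bsub>quot_module V W\<^esub>"
  proof
    fix v assume "v \<in> carrier (quot_module V W)"
    then obtain x where x: "x \<in> carrier V" "v = W +>\<^bsub>V\<^esub> x" by (auto simp: quot_carrier)
    show "\<exists>neg_v\<in>carrier (quot_module V W). v \<oplus>\<^bsub>quot_module V W\<^esub> neg_v = \<zero>\<^bsub>quot_module V W\<^esub>"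
      by (rule bexI[of _ "W +>\<^bsub>V\<^esub> (\<ominus>\<^bsub>V\<^esub> x)"])
        (use x in \<open>auto simp: quot_carrier quot_add quot_zero V.r_neg\<close>)
  qed
qed (auto simp: quot_carrier quot_add quot_zero quot_smult V.a_ac V.smult_l_distr[simplified]
  V.smult_r_distr V.smult_assoc1[simplified] V.smult_one[simplified])

end

text \<open>Complex-valued functionals that are linear over \<open>\<rat>\<close> on the carrier; their values outside the
  carrier are arbitrary.\<close>

definition rat_functional :: "(rat, 'v) module \<Rightarrow> ('v \<Rightarrow> complex) \<Rightarrow> bool" where
  "rat_functional V g \<longleftrightarrow>
     (\<forall>x\<in>carrier V. \<forall>y\<in>carrier V. g (x \<oplus>\<^bsub>V\<^esub> y) = g x + g y) \<and>
     (\<forall>q. \<forall>x\<in>carrier V. g (q \<odot>\<^bsub>V\<^esub> x) = of_rat q * g x)"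

lemma rat_functionalI:
  assumes "\<And>x y. x \<in> carrier V \<Longrightarrow> y \<in> carrier V \<Longrightarrow> g (x \<oplus>\<^bsub>V\<^esub> y) = g x + g y"
    and "\<And>q x. x \<in> carrier V \<Longrightarrow> g (q \<odot>\<^bsub>V\<^esub> x) = of_rat q * g x"
  shows "rat_functional V g"
  using assms by (simp add: rat_functional_def)

lemma rat_functional_add:
  "rat_functional V g \<Longrightarrow> x \<in> carrier V \<Longrightarrow> y \<in> carrier V \<Longrightarrow> g (x \<oplus>\<^bsub>V\<^esub> y) = g x + g y"
  by (simp add: rat_functional_def)

lemma rat_functional_smult:
  "rat_functional V g \<Longrightarrow> x \<in> carrier V \<Longrightarrow> g (q \<odot>\<^bsub>V\<^esub> x) = of_rat q * g x"
  by (simp add: rat_functional_def)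

lemma rat_functional_zero:
  assumes "vectorspace class_ring V" "rat_functional V g"
  shows "g \<zero>\<^bsub>V\<^esub> = 0"
proof -
  interpret V: vectorspace class_ring V by fact
  have "g (0 \<odot>\<^bsub>V\<^esub> \<zero>\<^bsub>V\<^esub>) = of_rat 0 * g \<zero>\<^bsub>V\<^esub>"
    using assms(2) V.zero_closed by (rule rat_functional_smult)
  thus ?thesis using V.lmult_0[of "\<zero>\<^bsub>V\<^esub>"] by simp
qed

lemma span_induct_class_ring:
  fixes V :: "('k::field, 'v) module"
  assumes V: "vectorspace class_ring V" and S: "S \<subseteq> carrier V"
    and x: "x \<in> lin_span V S"
    and zero: "P \<zero>\<^bsub>V\<^esub>"
    and add: "\<And>x y. x \<in> carrier V \<Longrightarrow> y \<in> carrier V \<Longrightarrow> P x \<Longrightarrow> P y \<Longrightarrow> P (x \<oplus>\<^bsub>V\<^esub> y)"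
    and smult: "\<And>q x. x \<in> carrier V \<Longrightarrow> P x \<Longrightarrow> P (q \<odot>\<^bsub>V\<^esub> x)"
    and base: "\<And>x. x \<in> S \<Longrightarrow> P x"
  shows "P x"
proof -
  interpret V: vectorspace class_ring V by fact
  have "LinearCombinations.submodule class_ring {x \<in> carrier V. P x} V"
    by (rule LinearCombinations.submodule.intro) (use zero add smult V.module_axioms in auto)
  hence "V.span S \<subseteq> {x \<in> carrier V. P x}"
    by (rule V.span_is_subset[rotated]) (use S base in auto)
  thus ?thesis using x by auto
qed

lemma rat_functional_span_eq_0:
  assumes "vectorspace class_ring V" "S \<subseteq> carrier V" "rat_functional V g"
    and "\<And>s. s \<in> S \<Longrightarrow> g s = 0" and x: "x \<in> lin_span V S"
  shows "g x = 0"
  using assms(1,2) x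
  by (rule span_induct_class_ring)
    (use assms rat_functional_zero in \<open>auto simp: rat_functional_add rat_functional_smult\<close>)

lemma rat_functional_quotient:
  fixes V :: "(rat, 'v) module"
  assumes V: "vectorspace class_ring V" and W: "LinearCombinations.submodule class_ring W V"
    and g: "rat_functional V g" and g0: "\<And>w. w \<in> W \<Longrightarrow> g w = 0"
  shows "\<exists>G. rat_functional (quot_module V W) G \<and> (\<forall>v\<in>carrier V. G (W +>\<^bsub>V\<^esub> v) = g v)"
proof -
  interpret quot_vs V W using V W by (simp add: quot_vs_def)
  define G where "G C = (THE c. \<exists>v\<in>carrier V. C = W +>\<^bsub>V\<^esub> v \<and> c = g v)" for C
  have G: "G (W +>\<^bsub>V\<^esub> v) = g v" if v: "v \<in> carrier V" for v
  proof -
    have uniq: "g v' = g v" if "v' \<in> carrier V" "W +>\<^bsub>V\<^esub> v = W +>\<^bsub>V\<^esub> v'" for v'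
    proof -
      have "\<exists>w\<in>W. v = w \<oplus>\<^bsub>V\<^esub> v'" using coset_eq_iff[of v v'] that v by simp
      then obtain w where "w \<in> W" "v = w \<oplus>\<^bsub>V\<^esub> v'" by blast
      thus ?thesis using g0[of w] rat_functional_add[OF g, of w v'] W.subset that by auto
    qed
    show ?thesis unfolding G_def
    proof (rule the_equality)
      show "\<exists>u\<in>carrier V. W +>\<^bsub>V\<^esub> v = W +>\<^bsub>V\<^esub> u \<and> g v = g u" using v by blast
      show "c = g v" if "\<exists>u\<in>carrier V. W +>\<^bsub>V\<^esub> v = W +>\<^bsub>V\<^esub> u \<and> c = g u" for c
        using that uniq by blast
    qed
  qed
  have "rat_functional (quot_module V W) G"
    by (rule rat_functionalI)
      (auto simp: quot_carrier quot_add quot_smult G rat_functional_add[OF g] rat_functional_smult[OF g])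
  with G show ?thesis by blast
qed

lemma quot_span:
  fixes V :: "('k::field, 'v) module"
  assumes V: "vectorspace class_ring V" and W: "LinearCombinations.submodule class_ring W V"
    and S: "S \<subseteq> carrier V" "lin_span V S = carrier V"
  shows "lin_span (quot_module V W) ((\<lambda>v. W +>\<^bsub>V\<^esub> v) ` S) = carrier (quot_module V W)"
proof -
  interpret quot_vs V W using V W by (simp add: quot_vs_def)
  interpret Q: vectorspace class_ring "quot_module V W" by (rule quot_vectorspace)
  let ?T = "(\<lambda>v. W +>\<^bsub>V\<^esub> v) ` S"
  have T: "?T \<subseteq> carrier (quot_module V W)" using S by (auto simp: quot_carrier)
  interpret sp: LinearCombinations.submodule class_ring "Q.span ?T" "quot_module V W"
    by (rule Q.span_is_submodule[OF T])
  have "W +>\<^bsub>V\<^esub> v \<in> Q.span ?T" if "v \<in> carrier V" for v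
  proof (rule span_induct_class_ring[OF V S(1)])
    show "v \<in> lin_span V S" using that S by simp
    show "W +>\<^bsub>V\<^esub> \<zero>\<^bsub>V\<^esub> \<in> Q.span ?T" using sp.zero_closed by (simp add: quot_zero)
    show "W +>\<^bsub>V\<^esub> (x \<oplus>\<^bsub>V\<^esub> y) \<in> Q.span ?T" 
      if "x \<in> carrier V" "y \<in> carrier V" "W +>\<^bsub>V\<^esub> x \<in> Q.span ?T" "W +>\<^bsub>V\<^esub> y \<in> Q.span ?T" for x y
      using sp.m_closed[OF that(3,4)] that by (simp add: quot_add)
    show "W +>\<^bsub>V\<^esub> (q \<odot>\<^bsub>V\<^esub> x) \<in> Q.span ?T" if "x \<in> carrier V" "W +>\<^bsub>V\<^esub> x \<in> Q.span ?T" for q x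
      using sp.smult_closed[of q, OF _ that(2)] that by (simp add: quot_smult)
    show "W +>\<^bsub>V\<^esub> x \<in> Q.span ?T" if "x \<in> S" for x
      using Q.in_own_span[OF T] that by auto
  qed
  thus ?thesis using Q.span_is_subset2[OF T] by (auto simp: quot_carrier)
qed

section \<open>Free spaces\<close>

lemma rat_scale_lookup [simp]: "Poly_Mapping.lookup (rat_scale q c) x = q * Poly_Mapping.lookup c x"
  by (simp add: rat_scale_def Poly_Mapping.map.rep_eq when_def)

lemma keys_rat_scale: "Poly_Mapping.keys (rat_scale q c) \<subseteq> Poly_Mapping.keys c"
  by (auto simp: in_keys_iff)

lemma free_qspace_simps [simp]:
  "carrier (free_qspace S) = {c. Poly_Mapping.keys c \<subseteq> S}"
  "zero (free_qspace S) = 0" "add (free_qspace S) = (+)" "smult (free_qspace S) = rat_scale"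
  by (simp_all add: free_qspace_def)

lemma free_qspace_vectorspace: "vectorspace class_ring (free_qspace S)"
proof (rule vs_criteria)
  show "field (class_ring :: rat ring)" by (rule class_field)
  show "\<forall>v\<in>carrier (free_qspace S). \<exists>w\<in>carrier (free_qspace S). v \<oplus>\<^bsub>free_qspace S\<^esub> w = \<zero>\<^bsub>free_qspace S\<^esub>"
  proof
    fix v assume "v \<in> carrier (free_qspace S)"
    thus "\<exists>w\<in>carrier (free_qspace S). v \<oplus>\<^bsub>free_qspace S\<^esub> w = \<zero>\<^bsub>free_qspace S\<^esub>"
      by (intro bexI[of _ "- v"]) (auto simp: keys_minus)
  qed
  show "\<forall>v w. v \<in> carrier (free_qspace S) \<and> w \<in> carrier (free_qspace S) \<longrightarrow>
          v \<oplus>\<^bsub>free_qspace S\<^esub> w \<in> carrier (free_qspace S)"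
    using Poly_Mapping.keys_add by fastforce
  show "\<forall>c v. c \<in> carrier class_ring \<and> v \<in> carrier (free_qspace S) \<longrightarrow>
          c \<odot>\<^bsub>free_qspace S\<^esub> v \<in> carrier (free_qspace S)"
    using keys_rat_scale by fastforce
qed (auto simp: add.commute add.assoc intro!: poly_mapping_eqI simp: lookup_add algebra_simps)

lemma poly_mapping_sum_singles:
  "c = (\<Sum>k\<in>Poly_Mapping.keys c. Poly_Mapping.single k (Poly_Mapping.lookup c k))"
proof (rule poly_mapping_eqI)
  fix k
  have "Poly_Mapping.lookup (\<Sum>j\<in>Poly_Mapping.keys c. Poly_Mapping.single j (Poly_Mapping.lookup c j)) k =
      (\<Sum>j\<in>Poly_Mapping.keys c. if j = k then Poly_Mapping.lookup c k else 0)"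
    unfolding lookup_sum by (intro sum.cong refl) (simp add: lookup_single when_def)
  also have "\<dots> = Poly_Mapping.lookup c k"
    by (subst sum.delta) (auto simp: in_keys_iff)
  finally show "Poly_Mapping.lookup c k =
      Poly_Mapping.lookup (\<Sum>j\<in>Poly_Mapping.keys c. Poly_Mapping.single j (Poly_Mapping.lookup c j)) k" by simp
qed

lemma free_qspace_span: "lin_span (free_qspace S) ((\<lambda>p. Poly_Mapping.single p 1) ` S) = carrier (free_qspace S)"
proof -
  interpret F: vectorspace class_ring "free_qspace S" by (rule free_qspace_vectorspace)
  let ?T = "(\<lambda>p. Poly_Mapping.single p (1::rat)) ` S"
  have T: "?T \<subseteq> carrier (free_qspace S)" by auto
  interpret sp: LinearCombinations.submodule class_ring "F.span ?T" "free_qspace S"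
    by (rule F.span_is_submodule[OF T])
  have single: "Poly_Mapping.single k v \<in> F.span ?T" if "k \<in> S" for k v
  proof -
    have "Poly_Mapping.single k 1 \<in> F.span ?T" using F.in_own_span[OF T] that by auto
    from sp.smult_closed[of v, OF _ this] have "rat_scale v (Poly_Mapping.single k 1) \<in> F.span ?T" by simp
    also have "rat_scale v (Poly_Mapping.single k 1) = Poly_Mapping.single k v"
      by (rule poly_mapping_eqI) (simp add: lookup_single when_def)
    finally show ?thesis .
  qed
  have comb: "(\<Sum>k\<in>K. Poly_Mapping.single k (v k)) \<in> F.span ?T" if "finite K" "K \<subseteq> S" for K v
    using that
  proof (induction K)
    case empty show ?case using sp.zero_closed by simp
  next
    case (insert k K)
    thus ?case using single[of k "v k"] sp.m_closed by auto
  qed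
  have "c \<in> F.span ?T" if "Poly_Mapping.keys c \<subseteq> S" for c
    using comb[OF finite_keys that, of "Poly_Mapping.lookup c"]
    by (simp only: poly_mapping_sum_singles[symmetric])
  hence "carrier (free_qspace S) \<subseteq> F.span ?T" by (intro subsetI) (simp only: free_qspace_simps mem_Collect_eq)
  with F.span_is_subset2[OF T] show ?thesis by (rule equalityI)
qed

text \<open>The functional on the free space that extends a function on the basis.\<close>

definition free_functional :: "('x \<Rightarrow> complex) \<Rightarrow> ('x \<Rightarrow>\<^sub>0 rat) \<Rightarrow> complex" where
  "free_functional \<phi> c = (\<Sum>p\<in>Poly_Mapping.keys c. of_rat (Poly_Mapping.lookup c p) * \<phi> p)"

lemma free_functional_superset:
  assumes "finite K" "Poly_Mapping.keys c \<subseteq> K"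
  shows "free_functional \<phi> c = (\<Sum>p\<in>K. of_rat (Poly_Mapping.lookup c p) * \<phi> p)"
  unfolding free_functional_def using assms by (intro sum.mono_neutral_left) (auto simp: in_keys_iff)

lemma free_functional_add: "free_functional \<phi> (x + y) = free_functional \<phi> x + free_functional \<phi> y"
proof -
  let ?K = "Poly_Mapping.keys x \<union> Poly_Mapping.keys y"
  have "free_functional \<phi> (x + y) = (\<Sum>p\<in>?K. of_rat (Poly_Mapping.lookup (x + y) p) * \<phi> p)"
    by (rule free_functional_superset) (use Poly_Mapping.keys_add[of x y] in auto)
  also have "\<dots> = (\<Sum>p\<in>?K. of_rat (Poly_Mapping.lookup x p) * \<phi> p) +
      (\<Sum>p\<in>?K. of_rat (Poly_Mapping.lookup y p) * \<phi> p)"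
    by (simp add: lookup_add of_rat_add distrib_right sum.distrib)
  also have "(\<Sum>p\<in>?K. of_rat (Poly_Mapping.lookup x p) * \<phi> p) = free_functional \<phi> x"
    by (rule free_functional_superset[symmetric]) auto
  also have "(\<Sum>p\<in>?K. of_rat (Poly_Mapping.lookup y p) * \<phi> p) = free_functional \<phi> y"
    by (rule free_functional_superset[symmetric]) auto
  finally show ?thesis .
qed

lemma free_functional_scale: "free_functional \<phi> (rat_scale q x) = of_rat q * free_functional \<phi> x"
proof -
  have "free_functional \<phi> (rat_scale q x) =
      (\<Sum>p\<in>Poly_Mapping.keys x. of_rat (Poly_Mapping.lookup (rat_scale q x) p) * \<phi> p)"
    using keys_rat_scale by (rule free_functional_superset[OF finite_keys])
  thus ?thesis
    by (simp only: free_functional_def rat_scale_lookup of_rat_mult sum_distrib_left mult.assoc)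
qed

lemma free_functional_single: "free_functional \<phi> (Poly_Mapping.single p q) = of_rat q * \<phi> p"
  by (simp add: free_functional_def)

lemma rat_functional_free: "rat_functional (free_qspace S) (free_functional \<phi>)"
  by (simp add: rat_functional_def free_functional_add free_functional_scale)

section \<open>Invariant forms and the space H\<close>

lemma rat_restrict_simps [simp]:
  "carrier (rat_restrict A) = carrier A" "zero (rat_restrict A) = zero A" "add (rat_restrict A) = add A"
  "smult (rat_restrict A) = (\<lambda>q x. Poly_Mapping.single 0 q \<odot>\<^bsub>A\<^esub> x)"
  by (simp_all add: rat_restrict_def)

lemma rat_restrict_vectorspace:
  assumes "Module.module class_ring A"
  shows "vectorspace class_ring (rat_restrict A)"
proof -
  interpret A: Module.module class_ring A by fact
  show ?thesis
  proof (rule vs_criteria)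
    show "field (class_ring :: rat ring)" by (rule class_field)
    show "\<forall>a b v. a \<in> carrier class_ring \<and> b \<in> carrier class_ring \<and> v \<in> carrier (rat_restrict A) \<longrightarrow>
        (a \<otimes>\<^bsub>class_ring\<^esub> b) \<odot>\<^bsub>rat_restrict A\<^esub> v = a \<odot>\<^bsub>rat_restrict A\<^esub> (b \<odot>\<^bsub>rat_restrict A\<^esub> v)"
      using A.smult_assoc1 by (simp add: mult_single flip: A.smult_assoc1)
    show "\<forall>a b v. a \<in> carrier class_ring \<and> b \<in> carrier class_ring \<and> v \<in> carrier (rat_restrict A) \<longrightarrow>
        (a \<oplus>\<^bsub>class_ring\<^esub> b) \<odot>\<^bsub>rat_restrict A\<^esub> v =
        a \<odot>\<^bsub>rat_restrict A\<^esub> v \<oplus>\<^bsub>rat_restrict A\<^esub> b \<odot>\<^bsub>rat_restrict A\<^esub> v"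
      using A.smult_l_distr by (simp add: single_add)
    show "\<forall>v\<in>carrier (rat_restrict A).
       \<exists>neg_v\<in>carrier (rat_restrict A). v \<oplus>\<^bsub>rat_restrict A\<^esub> neg_v = \<zero>\<^bsub>rat_restrict A\<^esub>"
      using A.r_neg A.a_inv_closed by auto
    show "\<forall>v\<in>carrier (rat_restrict A). \<one>\<^bsub>class_ring\<^esub> \<odot>\<^bsub>rat_restrict A\<^esub> v = v"
      using A.smult_one by simp
  qed (auto simp: A.a_ac A.smult_r_distr)
qed

locale exterior_cube = V: vectorspace class_ring V for V :: "(rat, 'v) module"
begin

abbreviation "free3 \<equiv> free_qspace (carrier V \<times> carrier V \<times> carrier V)"

sublocale F: vectorspace class_ring free3
  by (rule free_qspace_vectorspace)

lemma single_closed: "a \<in> carrier V \<Longrightarrow> b \<in> carrier V \<Longrightarrow> c \<in> carrier V \<Longrightarrow>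
    Poly_Mapping.single (a, b, c) (q::rat) \<in> carrier free3"
  by simp

lemma diff_closed: "u \<in> carrier free3 \<Longrightarrow> v \<in> carrier free3 \<Longrightarrow> u - v \<in> carrier free3"
  using keys_diff[of u v] by auto

lemma add_closed: "u \<in> carrier free3 \<Longrightarrow> v \<in> carrier free3 \<Longrightarrow> u + v \<in> carrier free3"
  using F.a_closed by simp

lemma scale_closed: "u \<in> carrier free3 \<Longrightarrow> rat_scale q u \<in> carrier free3"
  using F.smult_closed[of q u] by simp

lemma ext_relations_closed: "ext_relations V \<subseteq> carrier free3"
proof
  fix w assume "w \<in> ext_relations V"
  thus "w \<in> carrier free3" unfolding ext_relations_def Let_def
    by (elim UnE CollectE exE conjE; hypsubst; intro diff_closed scale_closed single_closed V.a_closed V.smult_closed;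
        (assumption | simp))
qed


lemma ext_subspace_submodule: "LinearCombinations.submodule class_ring (ext_subspace V) free3"
  unfolding ext_subspace_def by (rule F.span_is_submodule[OF ext_relations_closed])

sublocale Q: quot_vs free3 "ext_subspace V"
  by (rule quot_vs.intro[OF free_qspace_vectorspace ext_subspace_submodule])

lemma ext_cube_eq: "ext_cube V = quot_module free3 (ext_subspace V)"
  by (simp add: ext_cube_def)

lemma wedge3_eq: "wedge3 V x y z = ext_subspace V +>\<^bsub>free3\<^esub> Poly_Mapping.single (x, y, z) 1"
  by (simp add: wedge3_def)

sublocale E: vectorspace class_ring "ext_cube V"
  unfolding ext_cube_eq by (rule Q.quot_vectorspace)

lemma wedge3_closed [simp]:
  "x \<in> carrier V \<Longrightarrow> y \<in> carrier V \<Longrightarrow> z \<in> carrier V \<Longrightarrow> wedge3 V x y z \<in> carrier (ext_cube V)"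
  unfolding ext_cube_eq wedge3_eq Q.quot_carrier by auto

lemma coset_eqI:
  assumes "a - b \<in> ext_relations V" "b \<in> carrier free3"
  shows "ext_subspace V +>\<^bsub>free3\<^esub> a = ext_subspace V +>\<^bsub>free3\<^esub> b"
proof -
  have r: "a - b \<in> ext_subspace V" unfolding ext_subspace_def
    using F.in_own_span[OF ext_relations_closed] assms by blast
  have "a - b \<in> carrier free3" using assms ext_relations_closed by blast
  hence "(a - b) \<oplus>\<^bsub>free3\<^esub> b \<in> carrier free3" using assms by (intro F.a_closed) auto
  hence a: "a \<in> carrier free3" by simp
  show ?thesis by (subst Q.coset_eq_iff[OF a assms(2)]) (use r in \<open>auto intro!: bexI[of _ "a - b"]\<close>)
qed

lemma ext_relationsI:
  fixes s :: "'v \<Rightarrow> 'v \<Rightarrow> 'v \<Rightarrow> 'v \<times> 'v \<times> 'v \<Rightarrow>\<^sub>0 rat"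
  assumes "x \<in> carrier V" "x' \<in> carrier V" "y \<in> carrier V" "z \<in> carrier V"
  defines "s \<equiv> \<lambda>x y z. Poly_Mapping.single (x, y, z) 1"
  shows "s (x \<oplus>\<^bsub>V\<^esub> x') y z - s x y z - s x' y z \<in> ext_relations V"
    "s y (x \<oplus>\<^bsub>V\<^esub> x') z - s y x z - s y x' z \<in> ext_relations V"
    "s y z (x \<oplus>\<^bsub>V\<^esub> x') - s y z x - s y z x' \<in> ext_relations V"
    "s (q \<odot>\<^bsub>V\<^esub> x) y z - rat_scale q (s x y z) \<in> ext_relations V"
    "s y (q \<odot>\<^bsub>V\<^esub> x) z - rat_scale q (s y x z) \<in> ext_relations V"
    "s y z (q \<odot>\<^bsub>V\<^esub> x) - rat_scale q (s y z x) \<in> ext_relations V"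
    "s x x y \<in> ext_relations V"
    "s x y x \<in> ext_relations V"
    "s y x x \<in> ext_relations V"
proof -
  have u: "w \<in> S1 \<union> S2 \<union> S3 \<union> S4 \<union> S5 \<union> S6 \<union> S7 \<union> S8 \<union> S9"
    if "w \<in> S1 \<or> w \<in> S2 \<or> w \<in> S3 \<or> w \<in> S4 \<or> w \<in> S5 \<or> w \<in> S6 \<or> w \<in> S7 \<or> w \<in> S8 \<or> w \<in> S9"
    for w :: "'v \<times> 'v \<times> 'v \<Rightarrow>\<^sub>0 rat" and S1 S2 S3 S4 S5 S6 S7 S8 S9
    using that by blast
  show "s (x \<oplus>\<^bsub>V\<^esub> x') y z - s x y z - s x' y z \<in> ext_relations V"
    unfolding ext_relations_def Let_def s_def by (rule u, rule disjI1, intro CollectI exI conjI, rule refl) (fact assms)+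
  show "s y (x \<oplus>\<^bsub>V\<^esub> x') z - s y x z - s y x' z \<in> ext_relations V"
    unfolding ext_relations_def Let_def s_def by (rule u, rule disjI2, rule disjI1, intro CollectI exI conjI, rule refl) (fact assms)+
  show "s y z (x \<oplus>\<^bsub>V\<^esub> x') - s y z x - s y z x' \<in> ext_relations V"
    unfolding ext_relations_def Let_def s_def by (rule u, rule disjI2, rule disjI2, rule disjI1, intro CollectI exI conjI, rule refl) (fact assms)+
  show "s (q \<odot>\<^bsub>V\<^esub> x) y z - rat_scale q (s x y z) \<in> ext_relations V"
    unfolding ext_relations_def Let_def s_def by (rule u, rule disjI2, rule disjI2, rule disjI2, rule disjI1, intro CollectI exI conjI, rule refl) (fact assms)+
  show "s y (q \<odot>\<^bsub>V\<^esub> x) z - rat_scale q (s y x z) \<in> ext_relations V"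
    unfolding ext_relations_def Let_def s_def by (rule u, rule disjI2, rule disjI2, rule disjI2, rule disjI2, rule disjI1, intro CollectI exI conjI, rule refl) (fact assms)+
  show "s y z (q \<odot>\<^bsub>V\<^esub> x) - rat_scale q (s y z x) \<in> ext_relations V"
    unfolding ext_relations_def Let_def s_def by (rule u, rule disjI2, rule disjI2, rule disjI2, rule disjI2, rule disjI2, rule disjI1, intro CollectI exI conjI, rule refl) (fact assms)+
  show "s x x y \<in> ext_relations V"
    unfolding ext_relations_def Let_def s_def by (rule u, rule disjI2, rule disjI2, rule disjI2, rule disjI2, rule disjI2, rule disjI2, rule disjI1, intro CollectI exI conjI, rule refl) (fact assms)+
  show "s x y x \<in> ext_relations V"
    unfolding ext_relations_def Let_def s_def by (rule u, rule disjI2, rule disjI2, rule disjI2, rule disjI2, rule disjI2, rule disjI2, rule disjI2, rule disjI1, intro CollectI exI conjI, rule refl) (fact assms)+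
  show "s y x x \<in> ext_relations V"
    unfolding ext_relations_def Let_def s_def by (rule u, rule disjI2, rule disjI2, rule disjI2, rule disjI2, rule disjI2, rule disjI2, rule disjI2, rule disjI2, intro CollectI exI conjI, rule refl) (fact assms)+
qed

lemma wedge3_add:
  assumes "x \<in> carrier V" "x' \<in> carrier V" "y \<in> carrier V" "z \<in> carrier V"
  shows "wedge3 V (x \<oplus>\<^bsub>V\<^esub> x') y z = wedge3 V x y z \<oplus>\<^bsub>ext_cube V\<^esub> wedge3 V x' y z"
    "wedge3 V y (x \<oplus>\<^bsub>V\<^esub> x') z = wedge3 V y x z \<oplus>\<^bsub>ext_cube V\<^esub> wedge3 V y x' z"
    "wedge3 V y z (x \<oplus>\<^bsub>V\<^esub> x') = wedge3 V y z x \<oplus>\<^bsub>ext_cube V\<^esub> wedge3 V y z x'"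
proof -
  have add: "(ext_subspace V +>\<^bsub>free3\<^esub> b) \<oplus>\<^bsub>ext_cube V\<^esub> (ext_subspace V +>\<^bsub>free3\<^esub> c) = ext_subspace V +>\<^bsub>free3\<^esub> a"
    if "a - b - c \<in> ext_relations V" "b \<in> carrier free3" "c \<in> carrier free3" for a b c
    unfolding ext_cube_eq Q.quot_add[OF that(2,3)] free_qspace_simps
    by (rule coset_eqI[symmetric, OF _ add_closed[OF that(2,3)]]) (use that(1) in \<open>simp only: diff_diff_eq\<close>)
  show "wedge3 V (x \<oplus>\<^bsub>V\<^esub> x') y z = wedge3 V x y z \<oplus>\<^bsub>ext_cube V\<^esub> wedge3 V x' y z"
    "wedge3 V y (x \<oplus>\<^bsub>V\<^esub> x') z = wedge3 V y x z \<oplus>\<^bsub>ext_cube V\<^esub> wedge3 V y x' z"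
    "wedge3 V y z (x \<oplus>\<^bsub>V\<^esub> x') = wedge3 V y z x \<oplus>\<^bsub>ext_cube V\<^esub> wedge3 V y z x'"
    unfolding wedge3_eq
    by (rule add[symmetric, OF _ single_closed single_closed]; (rule ext_relationsI)?; fact assms)+
qed

lemma wedge3_smult:
  assumes "x \<in> carrier V" "y \<in> carrier V" "z \<in> carrier V"
  shows "wedge3 V (q \<odot>\<^bsub>V\<^esub> x) y z = q \<odot>\<^bsub>ext_cube V\<^esub> wedge3 V x y z"
    "wedge3 V y (q \<odot>\<^bsub>V\<^esub> x) z = q \<odot>\<^bsub>ext_cube V\<^esub> wedge3 V y x z"
    "wedge3 V y z (q \<odot>\<^bsub>V\<^esub> x) = q \<odot>\<^bsub>ext_cube V\<^esub> wedge3 V y z x"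
proof -
  have smult: "q \<odot>\<^bsub>ext_cube V\<^esub> (ext_subspace V +>\<^bsub>free3\<^esub> b) = ext_subspace V +>\<^bsub>free3\<^esub> a"
    if "a - rat_scale q b \<in> ext_relations V" "b \<in> carrier free3" for a b
    unfolding ext_cube_eq Q.quot_smult[OF that(2)] free_qspace_simps
    by (rule coset_eqI[symmetric, OF that(1) scale_closed[OF that(2)]])
  show "wedge3 V (q \<odot>\<^bsub>V\<^esub> x) y z = q \<odot>\<^bsub>ext_cube V\<^esub> wedge3 V x y z"
    "wedge3 V y (q \<odot>\<^bsub>V\<^esub> x) z = q \<odot>\<^bsub>ext_cube V\<^esub> wedge3 V y x z"
    "wedge3 V y z (q \<odot>\<^bsub>V\<^esub> x) = q \<odot>\<^bsub>ext_cube V\<^esub> wedge3 V y z x"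
    unfolding wedge3_eq
    by (rule smult[symmetric, OF _ single_closed]; (rule ext_relationsI)?; fact assms)+
qed

lemma wedge3_alternating:
  assumes "x \<in> carrier V" "y \<in> carrier V"
  shows "wedge3 V x x y = \<zero>\<^bsub>ext_cube V\<^esub>" "wedge3 V x y x = \<zero>\<^bsub>ext_cube V\<^esub>" "wedge3 V y x x = \<zero>\<^bsub>ext_cube V\<^esub>"
  unfolding ext_cube_eq wedge3_eq Q.quot_zero
  using ext_relationsI(7-9)[OF assms(1,1,2,2)] F.zero_closed
  by (auto intro!: coset_eqI simp del: free_qspace_simps(1))

lemma ext_cube_span:
  "lin_span (ext_cube V) {wedge3 V x y z | x y z. x \<in> carrier V \<and> y \<in> carrier V \<and> z \<in> carrier V} = carrier (ext_cube V)"
proof -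
  let ?S = "(\<lambda>p. Poly_Mapping.single p (1::rat)) ` (carrier V \<times> carrier V \<times> carrier V)"
  have "{wedge3 V x y z | x y z. x \<in> carrier V \<and> y \<in> carrier V \<and> z \<in> carrier V} =
      (\<lambda>v. ext_subspace V +>\<^bsub>free3\<^esub> v) ` ?S" by (auto simp: wedge3_eq image_iff)
  thus ?thesis
    using quot_span[OF free_qspace_vectorspace ext_subspace_submodule _ free_qspace_span]
    by (simp add: ext_cube_eq image_subset_iff)
qed

text \<open>Alternating trilinear forms over \<open>\<rat>\<close> with values in \<open>\<complex>\<close>.\<close>

definition alternating_form :: "('v \<Rightarrow> 'v \<Rightarrow> 'v \<Rightarrow> complex) \<Rightarrow> bool" where
  "alternating_form \<phi> \<longleftrightarrow>
     (\<forall>y\<in>carrier V. \<forall>z\<in>carrier V. rat_functional V (\<lambda>x. \<phi> x y z) \<and>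
        rat_functional V (\<lambda>x. \<phi> y x z) \<and> rat_functional V (\<lambda>x. \<phi> y z x)) \<and>
     (\<forall>x\<in>carrier V. \<forall>y\<in>carrier V. \<phi> x x y = 0 \<and> \<phi> x y x = 0 \<and> \<phi> y x x = 0)"

text \<open>The universal property of the exterior cube.\<close>

lemma functional_of_alternating_form:
  assumes "alternating_form \<phi>"
  shows "\<exists>G. rat_functional (ext_cube V) G \<and>
    (\<forall>x\<in>carrier V. \<forall>y\<in>carrier V. \<forall>z\<in>carrier V. G (wedge3 V x y z) = \<phi> x y z)"
proof -
  define g where "g = free_functional (\<lambda>(x, y, z). \<phi> x y z)"
  have g: "rat_functional free3 g" "g (Poly_Mapping.single (x, y, z) 1) = \<phi> x y z" for x y z
    unfolding g_def by (rule rat_functional_free) (simp add: free_functional_single)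
  have minus: "g (u - v) = g u - g v" if "u \<in> carrier free3" "v \<in> carrier free3" for u v
    using rat_functional_add[OF g(1) diff_closed[OF that] that(2)] by simp
  have scale: "g (rat_scale q u) = of_rat q * g u" if "u \<in> carrier free3" for q u
    using rat_functional_smult[OF g(1) that] by simp
  note A = assms[unfolded alternating_form_def]
  note \<phi> = rat_functional_add[of V "\<lambda>x. \<phi> x y z" for y z] rat_functional_add[of V "\<lambda>x. \<phi> y x z" for y z]
    rat_functional_add[of V "\<lambda>x. \<phi> y z x" for y z]
    rat_functional_smult[of V "\<lambda>x. \<phi> x y z" for y z] rat_functional_smult[of V "\<lambda>x. \<phi> y x z" for y z]
    rat_functional_smult[of V "\<lambda>x. \<phi> y z x" for y z]
  have rel: "g w = 0" if "w \<in> ext_relations V" for w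
    using that A unfolding ext_relations_def Let_def
    by (elim UnE CollectE exE conjE; hypsubst)
      (simp_all add: minus scale g(2) single_closed diff_closed scale_closed \<phi> del: free_qspace_simps(1))
  have "g w = 0" if "w \<in> ext_subspace V" for w
    by (rule rat_functional_span_eq_0[OF free_qspace_vectorspace ext_relations_closed g(1) _
          that[unfolded ext_subspace_def]]) (rule rel)
  from rat_functional_quotient[OF free_qspace_vectorspace ext_subspace_submodule g(1) this]
  obtain G where G: "rat_functional (quot_module free3 (ext_subspace V)) G"
    "\<forall>v\<in>carrier free3. G (ext_subspace V +>\<^bsub>free3\<^esub> v) = g v" by blast
  thus ?thesis using g(2) by (intro exI[of _ G]) (simp add: ext_cube_eq wedge3_eq)
qed

end

locale laurent_module = A: Module.module class_ring A for A :: "(laurent, 'v) module"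
begin

abbreviation "V \<equiv> rat_restrict A"

sublocale exterior_cube V
  by (rule exterior_cube.intro[OF rat_restrict_vectorspace[OF A.module_axioms]])

text \<open>The space \<open>\<H>\<close> is the quotient of the exterior cube by the span of these elements.\<close>

definition coinvariant_relations :: "('v \<times> 'v \<times> 'v \<Rightarrow>\<^sub>0 rat) set set" where
  "coinvariant_relations = {wedge3 V x y z \<ominus>\<^bsub>ext_cube V\<^esub>
     wedge3 V (tvar \<odot>\<^bsub>A\<^esub> x) (tvar \<odot>\<^bsub>A\<^esub> y) (tvar \<odot>\<^bsub>A\<^esub> z) | x y z.
       x \<in> carrier A \<and> y \<in> carrier A \<and> z \<in> carrier A}"

abbreviation "coinvariant_kernel \<equiv> lin_span (ext_cube V) coinvariant_relations"

lemma H_space_eq: "H_space A = quot_module (ext_cube V) coinvariant_kernel"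
  by (simp add: H_space_def Let_def coinvariant_relations_def)

lemma wedge3_closed_A [simp]:
  "x \<in> carrier A \<Longrightarrow> y \<in> carrier A \<Longrightarrow> z \<in> carrier A \<Longrightarrow> wedge3 V x y z \<in> carrier (ext_cube V)"
  using wedge3_closed by simp

lemma coinvariant_relations_closed: "coinvariant_relations \<subseteq> carrier (ext_cube V)"
  unfolding coinvariant_relations_def by auto

lemma coinvariant_kernel_submodule:
  "LinearCombinations.submodule class_ring coinvariant_kernel (ext_cube V)"
  by (rule E.span_is_submodule[OF coinvariant_relations_closed])

sublocale HQ: quot_vs "ext_cube V" coinvariant_kernel
  by (rule quot_vs.intro[OF E.vectorspace_axioms coinvariant_kernel_submodule])

sublocale H: vectorspace class_ring "H_space A"
  unfolding H_space_eq by (rule HQ.quot_vectorspace)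

text \<open>The class of \<open>x \<and> y \<and> z\<close> in \<open>\<H>\<close>.\<close>

definition H_gen :: "'v \<Rightarrow> 'v \<Rightarrow> 'v \<Rightarrow> ('v \<times> 'v \<times> 'v \<Rightarrow>\<^sub>0 rat) set set" where
  "H_gen x y z = coinvariant_kernel +>\<^bsub>ext_cube V\<^esub> wedge3 V x y z"

lemma H_gen_closed:
  "x \<in> carrier A \<Longrightarrow> y \<in> carrier A \<Longrightarrow> z \<in> carrier A \<Longrightarrow> H_gen x y z \<in> carrier (H_space A)"
  unfolding H_space_eq HQ.quot_carrier H_gen_def by simp

lemma H_gen_add:
  assumes "x \<in> carrier A" "x' \<in> carrier A" "y \<in> carrier A" "z \<in> carrier A"
  shows "H_gen (x \<oplus>\<^bsub>A\<^esub> x') y z = H_gen x y z \<oplus>\<^bsub>H_space A\<^esub> H_gen x' y z"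
    "H_gen y (x \<oplus>\<^bsub>A\<^esub> x') z = H_gen y x z \<oplus>\<^bsub>H_space A\<^esub> H_gen y x' z"
    "H_gen y z (x \<oplus>\<^bsub>A\<^esub> x') = H_gen y z x \<oplus>\<^bsub>H_space A\<^esub> H_gen y z x'"
  using assms wedge3_add[of x x' y z] by (simp_all add: H_gen_def H_space_eq HQ.quot_add)

lemma H_gen_smult:
  assumes "x \<in> carrier A" "y \<in> carrier A" "z \<in> carrier A"
  shows "H_gen (q \<odot>\<^bsub>V\<^esub> x) y z = q \<odot>\<^bsub>H_space A\<^esub> H_gen x y z"
    "H_gen y (q \<odot>\<^bsub>V\<^esub> x) z = q \<odot>\<^bsub>H_space A\<^esub> H_gen y x z"
    "H_gen y z (q \<odot>\<^bsub>V\<^esub> x) = q \<odot>\<^bsub>H_space A\<^esub> H_gen y z x"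
  using assms wedge3_smult[of x y z q] by (simp_all add: H_gen_def H_space_eq HQ.quot_smult del: rat_restrict_simps(4))

lemma H_gen_zero:
  assumes "y \<in> carrier A" "z \<in> carrier A"
  shows "H_gen \<zero>\<^bsub>A\<^esub> y z = \<zero>\<^bsub>H_space A\<^esub>" "H_gen y \<zero>\<^bsub>A\<^esub> z = \<zero>\<^bsub>H_space A\<^esub>"
    "H_gen y z \<zero>\<^bsub>A\<^esub> = \<zero>\<^bsub>H_space A\<^esub>"
proof -
  have V0: "0 \<odot>\<^bsub>V\<^esub> \<zero>\<^bsub>A\<^esub> = \<zero>\<^bsub>A\<^esub>" using V.lmult_0[of "\<zero>\<^bsub>A\<^esub>"] by simp
  have H0: "0 \<odot>\<^bsub>H_space A\<^esub> h = \<zero>\<^bsub>H_space A\<^esub>" if "h \<in> carrier (H_space A)" for h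
    using H.lmult_0[OF that] by simp
  show "H_gen \<zero>\<^bsub>A\<^esub> y z = \<zero>\<^bsub>H_space A\<^esub>" "H_gen y \<zero>\<^bsub>A\<^esub> z = \<zero>\<^bsub>H_space A\<^esub>"
    "H_gen y z \<zero>\<^bsub>A\<^esub> = \<zero>\<^bsub>H_space A\<^esub>"
    using H_gen_smult[of "\<zero>\<^bsub>A\<^esub>" y z 0] assms
    unfolding V0 by (simp_all add: H0 H_gen_closed)
qed

lemma H_gen_alternating:
  assumes "x \<in> carrier A" "y \<in> carrier A"
  shows "H_gen x x y = \<zero>\<^bsub>H_space A\<^esub>" "H_gen x y x = \<zero>\<^bsub>H_space A\<^esub>" "H_gen y x x = \<zero>\<^bsub>H_space A\<^esub>"
  using assms wedge3_alternating[of x y] by (simp_all add: H_gen_def H_space_eq HQ.quot_zero)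

lemma H_gen_tvar:
  assumes "x \<in> carrier A" "y \<in> carrier A" "z \<in> carrier A"
  shows "H_gen (tvar \<odot>\<^bsub>A\<^esub> x) (tvar \<odot>\<^bsub>A\<^esub> y) (tvar \<odot>\<^bsub>A\<^esub> z) = H_gen x y z"
proof -
  let ?u = "wedge3 V x y z" and ?v = "wedge3 V (tvar \<odot>\<^bsub>A\<^esub> x) (tvar \<odot>\<^bsub>A\<^esub> y) (tvar \<odot>\<^bsub>A\<^esub> z)"
  have uv: "?u \<in> carrier (ext_cube V)" "?v \<in> carrier (ext_cube V)" using assms by simp_all
  have "?u \<ominus>\<^bsub>ext_cube V\<^esub> ?v \<in> coinvariant_relations"
    unfolding coinvariant_relations_def using assms by blast
  hence "?u \<ominus>\<^bsub>ext_cube V\<^esub> ?v \<in> coinvariant_kernel"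
    using E.in_own_span[OF coinvariant_relations_closed] by blast
  moreover have "?u = (?u \<ominus>\<^bsub>ext_cube V\<^esub> ?v) \<oplus>\<^bsub>ext_cube V\<^esub> ?v"
    using uv by (simp add: a_minus_def E.a_assoc E.l_neg)
  ultimately show ?thesis
    unfolding H_gen_def using HQ.coset_eq_iff[OF uv] by metis
qed

lemma H_space_span:
  "lin_span (H_space A) {H_gen x y z | x y z. x \<in> carrier A \<and> y \<in> carrier A \<and> z \<in> carrier A} = carrier (H_space A)"
proof -
  let ?S = "{wedge3 V x y z | x y z. x \<in> carrier V \<and> y \<in> carrier V \<and> z \<in> carrier V}"
  have eq: "{H_gen x y z | x y z. x \<in> carrier A \<and> y \<in> carrier A \<and> z \<in> carrier A} =
      (\<lambda>v. coinvariant_kernel +>\<^bsub>ext_cube V\<^esub> v) ` ?S"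
    unfolding H_gen_def by auto
  have S: "?S \<subseteq> carrier (ext_cube V)" by auto
  show ?thesis
    unfolding eq H_space_eq
    by (rule quot_span[OF E.vectorspace_axioms coinvariant_kernel_submodule S ext_cube_span])
qed

text \<open>The forms that factor through \<open>\<H>\<close>.\<close>

definition invariant_form :: "('v \<Rightarrow> 'v \<Rightarrow> 'v \<Rightarrow> complex) \<Rightarrow> bool" where
  "invariant_form \<phi> \<longleftrightarrow> alternating_form \<phi> \<and>
     (\<forall>x\<in>carrier A. \<forall>y\<in>carrier A. \<forall>z\<in>carrier A.
        \<phi> (tvar \<odot>\<^bsub>A\<^esub> x) (tvar \<odot>\<^bsub>A\<^esub> y) (tvar \<odot>\<^bsub>A\<^esub> z) = \<phi> x y z)"

lemma invariant_form_of_functional: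
  assumes G: "rat_functional (H_space A) G"
  shows "invariant_form (\<lambda>x y z. G (H_gen x y z))"
  unfolding invariant_form_def alternating_form_def
  using H_gen_add H_gen_smult rat_functional_zero[OF H.vectorspace_axioms G]
  by (auto intro!: rat_functionalI simp: H_gen_alternating H_gen_tvar H_gen_closed
      rat_functional_add[OF G] rat_functional_smult[OF G])

lemma functional_of_invariant_form:
  assumes "invariant_form \<phi>"
  shows "\<exists>G. rat_functional (H_space A) G \<and>
    (\<forall>x\<in>carrier A. \<forall>y\<in>carrier A. \<forall>z\<in>carrier A. G (H_gen x y z) = \<phi> x y z)"
proof -
  obtain g where g: "rat_functional (ext_cube V) g"
    "\<And>x y z. x \<in> carrier A \<Longrightarrow> y \<in> carrier A \<Longrightarrow> z \<in> carrier A \<Longrightarrow> g (wedge3 V x y z) = \<phi> x y z"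
    using functional_of_alternating_form[of \<phi>] assms unfolding invariant_form_def by auto
  have minus: "g (u \<ominus>\<^bsub>ext_cube V\<^esub> v) = g u - g v" if uv: "u \<in> carrier (ext_cube V)" "v \<in> carrier (ext_cube V)" for u v
  proof -
    have "g u = g ((u \<ominus>\<^bsub>ext_cube V\<^esub> v) \<oplus>\<^bsub>ext_cube V\<^esub> v)"
      using uv by (simp add: a_minus_def E.a_assoc E.l_neg)
    also have "\<dots> = g (u \<ominus>\<^bsub>ext_cube V\<^esub> v) + g v"
      using uv by (intro rat_functional_add[OF g(1)]) auto
    finally show ?thesis by simp
  qed
  have "g w = 0" if "w \<in> coinvariant_relations" for w
    using that assms by (auto simp: coinvariant_relations_def minus g(2) invariant_form_def)
  hence "g w = 0" if "w \<in> coinvariant_kernel" for w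
    using rat_functional_span_eq_0[OF E.vectorspace_axioms coinvariant_relations_closed g(1) _ that] by blast
  from rat_functional_quotient[OF E.vectorspace_axioms coinvariant_kernel_submodule g(1) this]
  obtain G where G: "rat_functional (H_space A) G"
    "\<forall>v\<in>carrier (ext_cube V). G (coinvariant_kernel +>\<^bsub>ext_cube V\<^esub> v) = g v"
    unfolding H_space_eq by blast
  thus ?thesis using g(2) by (intro exI[of _ G]) (simp add: H_gen_def)
qed

end

section \<open>Homogeneous linear systems and dual bases\<close>

lemma homogeneous_system_nontrivial:
  fixes M :: "'e \<Rightarrow> 'u \<Rightarrow> complex"
  assumes "finite E" "finite U" "card E < card U"
  shows "\<exists>c. (\<exists>u\<in>U. c u \<noteq> 0) \<and> (\<forall>u. u \<notin> U \<longrightarrow> c u = 0) \<and> (\<forall>e\<in>E. (\<Sum>u\<in>U. c u * M e u) = 0)"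
  using assms
proof (induction E arbitrary: U M rule: finite_induct)
  case empty
  then obtain u where "u \<in> U" by fastforce
  thus ?case by (intro exI[of _ "\<lambda>v. if v = u then 1 else 0"]) auto
next
  case (insert e E)
  show ?case
  proof (cases "\<forall>u\<in>U. M e u = 0")
    case True
    have "card E < card U" using insert by simp
    from insert.IH[OF insert.prems(1) this, of M] True show ?thesis by auto
  next
    case False
    then obtain v where v: "v \<in> U" "M e v \<noteq> 0" by blast
    have fin: "finite (U - {v})" and card: "card E < card (U - {v})"
      using insert v by simp_all
    define N where "N e' u = M e' u - M e' v / M e v * M e u" for e' u
    obtain c where c: "\<exists>u\<in>U - {v}. c u \<noteq> 0" "\<forall>u. u \<notin> U - {v} \<longrightarrow> c u = 0"
      "\<forall>e\<in>E. (\<Sum>u\<in>U - {v}. c u * N e u) = 0"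
      using insert.IH[OF fin card, of N] by blast
    define s where "s = (\<Sum>u\<in>U - {v}. c u * M e u)"
    define c' where "c' = c(v := - s / M e v)"
    have sum: "(\<Sum>u\<in>U. c' u * M e' u) = - s / M e v * M e' v + (\<Sum>u\<in>U - {v}. c u * M e' u)" for e'
      using v insert.prems(1) by (subst sum.remove[of _ v]) (auto simp: c'_def intro!: sum.cong)
    have "(\<Sum>u\<in>U. c' u * M e' u) = 0" if "e' \<in> insert e E" for e'
    proof (cases "e' = e")
      case True
      thus ?thesis unfolding sum using v by (simp add: s_def)
    next
      case False
      have "0 = (\<Sum>u\<in>U - {v}. c u * M e' u - M e' v / M e v * (c u * M e u))"
        using c(3) that False by (simp add: N_def algebra_simps)
      also have "\<dots> = (\<Sum>u\<in>U - {v}. c u * M e' u) - M e' v / M e v * s"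
        by (simp only: sum_subtractf sum_distrib_left s_def)
      finally show ?thesis unfolding sum by (simp add: algebra_simps)
    qed
    moreover have "\<exists>u\<in>U. c' u \<noteq> 0" using c(1) by (auto simp: c'_def)
    moreover have "\<forall>u. u \<notin> U \<longrightarrow> c' u = 0" using c(2) v by (auto simp: c'_def)
    ultimately show ?thesis by blast
  qed
qed

text \<open>Linear functionals on a space of complex-valued functions.\<close>

definition complex_linear :: "(('u \<Rightarrow> complex) \<Rightarrow> complex) \<Rightarrow> bool" where
  "complex_linear L \<longleftrightarrow> (\<forall>a b f g. L (\<lambda>u. a * f u + b * g u) = a * L f + b * L g)"

lemma complex_linear_sum:
  assumes "complex_linear L" "finite J"
  shows "L (\<lambda>u. \<Sum>j\<in>J. c j * f j u) = (\<Sum>j\<in>J. c j * L (f j))"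
  using assms(2)
proof (induction J)
  case empty
  show ?case
    using assms(1)[unfolded complex_linear_def, rule_format, of 0 "\<lambda>_. 0" 0 "\<lambda>_. 0"] by simp
next
  case (insert j J)
  show ?case
    using assms(1)[unfolded complex_linear_def, rule_format, of "c j" "f j" 1 "\<lambda>u. \<Sum>j\<in>J. c j * f j u"]
      insert by simp
qed

lemma complex_linear_combination:
  assumes "\<And>j. j \<in> J \<Longrightarrow> complex_linear (L j)"
  shows "complex_linear (\<lambda>c. \<Sum>j\<in>J. k j * L j c)"
  unfolding complex_linear_def
proof (intro allI)
  fix a b f g
  have "(\<Sum>j\<in>J. k j * L j (\<lambda>u. a * f u + b * g u)) = (\<Sum>j\<in>J. a * (k j * L j f) + b * (k j * L j g))"
    using assms unfolding complex_linear_def by (intro sum.cong refl) (simp add: algebra_simps)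
  thus "(\<Sum>j\<in>J. k j * L j (\<lambda>u. a * f u + b * g u)) = a * (\<Sum>j\<in>J. k j * L j f) + b * (\<Sum>j\<in>J. k j * L j g)"
    by (simp only: sum.distrib sum_distrib_left)
qed

lemma linear_system_nontrivial:
  fixes L :: "'e \<Rightarrow> ('u \<Rightarrow> complex) \<Rightarrow> complex"
  assumes "finite E" "finite U" "card E < card U" and L: "\<And>e. e \<in> E \<Longrightarrow> complex_linear (L e)"
  shows "\<exists>c. (\<exists>u\<in>U. c u \<noteq> 0) \<and> (\<forall>u. u \<notin> U \<longrightarrow> c u = 0) \<and> (\<forall>e\<in>E. L e c = 0)"
proof -
  obtain c where c: "\<exists>u\<in>U. c u \<noteq> 0" "\<forall>u. u \<notin> U \<longrightarrow> c u = 0"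
    "\<forall>e\<in>E. (\<Sum>u\<in>U. c u * L e (\<lambda>v. if v = u then 1 else 0)) = 0"
    using homogeneous_system_nontrivial[OF assms(1-3), of "\<lambda>e u. L e (\<lambda>v. if v = u then 1 else 0)"] by blast
  have eq: "c = (\<lambda>v. \<Sum>u\<in>U. c u * (if v = u then 1 else 0))"
    using c(2) assms(2) by (auto simp: fun_eq_iff if_distrib sum.delta cong: if_cong)
  have "L e c = 0" if "e \<in> E" for e
    by (subst eq, subst complex_linear_sum[OF L[OF that] assms(2)]) (use c(3) that in auto)
  with c show ?thesis by blast
qed

lemma dual_basis_exists:
  fixes V :: "(rat, 'v) module"
  assumes V: "vectorspace class_ring V" and fin: "finite \<beta>" and basis: "vectorspace.basis class_ring V \<beta>"
  shows "\<exists>D. \<forall>b\<in>\<beta>. rat_functional V (D b) \<and> (\<forall>b'\<in>\<beta>. D b b' = (if b = b' then 1 else 0))"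
proof -
  interpret V: vectorspace class_ring V by fact
  have \<beta>: "\<beta> \<subseteq> carrier V" using basis by (simp add: V.basis_def)
  have ex1: "\<exists>!a. a \<in> \<beta> \<rightarrow>\<^sub>E UNIV \<and> V.lincomb a \<beta> = v" if "v \<in> carrier V" for v
    using V.basis_criterion[OF fin \<beta>] basis that by simp
  define a where "a v = (THE a. a \<in> \<beta> \<rightarrow>\<^sub>E UNIV \<and> V.lincomb a \<beta> = v)" for v
  have a: "a v \<in> \<beta> \<rightarrow>\<^sub>E UNIV" "V.lincomb (a v) \<beta> = v" if "v \<in> carrier V" for v
    using theI'[OF ex1[OF that]] by (auto simp: a_def)
  have a_eq: "a v b = c b" if "v \<in> carrier V" "V.lincomb c \<beta> = v" "b \<in> \<beta>" for v c b
  proof -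
    have "V.lincomb (restrict c \<beta>) \<beta> = v"
      using that(2) by (subst V.lincomb_cong[OF refl \<beta>, of _ c]) auto
    hence "a v = restrict c \<beta>"
      using ex1[OF that(1)] a[OF that(1)] by (metis restrict_PiE_iff UNIV_I)
    thus ?thesis using that by simp
  qed
  show ?thesis
  proof (intro exI[of _ "\<lambda>b v. of_rat (a v b)"] ballI conjI rat_functionalI)
    fix b x y assume b: "b \<in> \<beta>" and xy: "x \<in> carrier V" "y \<in> carrier V"
    have "V.lincomb (\<lambda>v. a x v \<oplus>\<^bsub>class_ring\<^esub> a y v) \<beta> = x \<oplus>\<^bsub>V\<^esub> y"
      by (subst V.lincomb_sum[OF fin \<beta>]) (use a xy in auto)
    from a_eq[OF _ this b] xy show "of_rat (a (x \<oplus>\<^bsub>V\<^esub> y) b) = (of_rat (a x b) + of_rat (a y b) :: complex)"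
      by (simp add: of_rat_add)
  next
    fix b x q assume b: "b \<in> \<beta>" and x: "x \<in> carrier V"
    have "V.lincomb (\<lambda>v. q \<otimes>\<^bsub>class_ring\<^esub> a x v) \<beta> = q \<odot>\<^bsub>V\<^esub> x"
      by (subst V.lincomb_smult[OF \<beta>]) (use a x in auto)
    from a_eq[OF _ this b] x show "of_rat (a (q \<odot>\<^bsub>V\<^esub> x) b) = (of_rat q * of_rat (a x b) :: complex)"
      by (simp add: of_rat_mult)
  next
    fix b b' assume b: "b \<in> \<beta>" "b' \<in> \<beta>"
    have b'c: "b' \<in> carrier V" using b \<beta> by blast
    define c where "c = (\<lambda>v. if v = b' then 1 else 0 :: rat)"
    have "V.lincomb c \<beta> = c b' \<odot>\<^bsub>V\<^esub> b' \<oplus>\<^bsub>V\<^esub> V.lincomb c (\<beta> - {b'})"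
      by (rule V.lincomb_del2[OF fin \<beta> _ b(2)]) auto
    also have "V.lincomb c (\<beta> - {b'}) = \<zero>\<^bsub>V\<^esub>"
      unfolding V.lincomb_def
      by (rule V.add.finprod_one_eqI[simplified])
        (use \<beta> V.lmult_0 in \<open>auto simp: c_def\<close>)
    also have "c b' \<odot>\<^bsub>V\<^esub> b' = b'" using V.smult_one[OF b'c] by (simp add: c_def)
    finally have "V.lincomb c \<beta> = b'" using b'c by simp
    from a_eq[OF b'c this b(1)] show "of_rat (a b' b) = (if b = b' then 1 else 0 :: complex)"
      by (simp add: c_def)
  qed
qed

lemma rat_functional_sum:
  assumes "\<And>j. j \<in> J \<Longrightarrow> rat_functional V (g j)"
  shows "rat_functional V (\<lambda>x. \<Sum>j\<in>J. c j * g j x)"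
  by (rule rat_functionalI)
    (use assms in \<open>auto simp: rat_functional_def algebra_simps sum.distrib sum_distrib_left intro!: sum.cong\<close>)

section \<open>Bounds on the dimension of H by linear systems\<close>

context laurent_module
begin

abbreviation "triples \<equiv> carrier A \<times> carrier A \<times> carrier A"

lemma functional_eq_0:
  assumes "rat_functional (H_space A) G"
    and "\<And>x y z. x \<in> carrier A \<Longrightarrow> y \<in> carrier A \<Longrightarrow> z \<in> carrier A \<Longrightarrow> G (H_gen x y z) = 0"
    and "h \<in> carrier (H_space A)"
  shows "G h = 0"
proof (rule rat_functional_span_eq_0[OF H.vectorspace_axioms _ assms(1)])
  show "h \<in> lin_span (H_space A) {H_gen x y z | x y z. x \<in> carrier A \<and> y \<in> carrier A \<and> z \<in> carrier A}"
    using assms(3) H_space_span by simp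
qed (use assms(2) H_gen_closed in auto)

lemma H_space_combination:
  assumes "h \<in> carrier (H_space A)"
  shows "\<exists>T \<kappa>. finite T \<and> T \<subseteq> triples \<and>
    (\<forall>G. rat_functional (H_space A) G \<longrightarrow> G h = (\<Sum>(x, y, z)\<in>T. \<kappa> (x, y, z) * G (H_gen x y z)))"
    (is "?P h")
proof -
  let ?S = "{H_gen x y z | x y z. x \<in> carrier A \<and> y \<in> carrier A \<and> z \<in> carrier A}"
  have S: "?S \<subseteq> carrier (H_space A)" using H_gen_closed by auto
  show ?thesis
  proof (rule span_induct_class_ring[where P = ?P, OF H.vectorspace_axioms S])
    show "h \<in> H.span ?S" using assms H_space_span by simp
    show "?P \<zero>\<^bsub>H_space A\<^esub>"
      by (rule exI[of _ "{}"]) (auto simp: rat_functional_zero[OF H.vectorspace_axioms])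
    show "?P (h \<oplus>\<^bsub>H_space A\<^esub> h')" if hh: "h \<in> carrier (H_space A)" "h' \<in> carrier (H_space A)" and P: "?P h" "?P h'" for h h'
    proof -
      obtain T \<kappa> where T: "finite T" "T \<subseteq> triples"
        "\<And>G. rat_functional (H_space A) G \<Longrightarrow> G h = (\<Sum>(x, y, z)\<in>T. \<kappa> (x, y, z) * G (H_gen x y z))"
        using P(1) by blast
      obtain T' \<kappa>' where T': "finite T'" "T' \<subseteq> triples"
        "\<And>G. rat_functional (H_space A) G \<Longrightarrow> G h' = (\<Sum>(x, y, z)\<in>T'. \<kappa>' (x, y, z) * G (H_gen x y z))"
        using P(2) by blast
      define \<nu> where "\<nu> p = (if p \<in> T then \<kappa> p else 0) + (if p \<in> T' then \<kappa>' p else 0)" for p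
      show ?thesis
      proof (intro exI[of _ "T \<union> T'"] exI[of _ \<nu>] conjI allI impI)
        fix G assume G: "rat_functional (H_space A) G"
        let ?g = "\<lambda>(x, y, z). G (H_gen x y z)"
        have "G (h \<oplus>\<^bsub>H_space A\<^esub> h') = (\<Sum>p\<in>T. \<kappa> p * ?g p) + (\<Sum>p\<in>T'. \<kappa>' p * ?g p)"
          unfolding rat_functional_add[OF G hh] T(3)[OF G] T'(3)[OF G] by (simp add: case_prod_beta)
        also have "(\<Sum>p\<in>T. \<kappa> p * ?g p) = (\<Sum>p\<in>T \<union> T'. (if p \<in> T then \<kappa> p else 0) * ?g p)"
          using T(1) T'(1) by (intro sum.mono_neutral_cong_left) auto
        also have "(\<Sum>p\<in>T'. \<kappa>' p * ?g p) = (\<Sum>p\<in>T \<union> T'. (if p \<in> T' then \<kappa>' p else 0) * ?g p)"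
          using T(1) T'(1) by (intro sum.mono_neutral_cong_left) auto
        also have "(\<Sum>p\<in>T \<union> T'. (if p \<in> T then \<kappa> p else 0) * ?g p) +
            (\<Sum>p\<in>T \<union> T'. (if p \<in> T' then \<kappa>' p else 0) * ?g p) = (\<Sum>p\<in>T \<union> T'. \<nu> p * ?g p)"
          by (simp only: \<nu>_def distrib_right sum.distrib)
        finally show "G (h \<oplus>\<^bsub>H_space A\<^esub> h') = (\<Sum>(x, y, z)\<in>T \<union> T'. \<nu> (x, y, z) * G (H_gen x y z))"
          by (simp add: case_prod_beta)
      qed (use T T' in auto)
    qed
    show "?P (q \<odot>\<^bsub>H_space A\<^esub> h)" if hh: "h \<in> carrier (H_space A)" and P: "?P h" for q h
    proof -
      obtain T \<kappa> where T: "finite T" "T \<subseteq> triples"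
        "\<And>G. rat_functional (H_space A) G \<Longrightarrow> G h = (\<Sum>(x, y, z)\<in>T. \<kappa> (x, y, z) * G (H_gen x y z))"
        using P by blast
      show ?thesis
      proof (intro exI[of _ T] exI[of _ "\<lambda>p. of_rat q * \<kappa> p"] conjI allI impI)
        fix G assume G: "rat_functional (H_space A) G"
        show "G (q \<odot>\<^bsub>H_space A\<^esub> h) = (\<Sum>(x, y, z)\<in>T. of_rat q * \<kappa> (x, y, z) * G (H_gen x y z))"
          unfolding rat_functional_smult[OF G hh] T(3)[OF G]
          by (simp add: sum_distrib_left mult.assoc case_prod_beta)
      qed (use T in auto)
    qed
    show "?P h" if "h \<in> ?S" for h
    proof -
      from that obtain x y z where "h = H_gen x y z" "x \<in> carrier A" "y \<in> carrier A" "z \<in> carrier A"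
        by blast
      thus ?thesis by (intro exI[of _ "{(x, y, z)}"] exI[of _ "\<lambda>_. 1"]) auto
    qed
  qed
qed

text \<open>Let the forms \<open>\<Phi> c\<close> depend linearly and injectively on unknowns \<open>c\<close> indexed by \<open>U\<close>, and let the
  equations indexed by \<open>E\<close> suffice for the invariance of \<open>\<Phi> c\<close>. If \<open>U\<close> had more than
  \<open>card E + dim \<H>\<close> elements, the equations could be joined by the vanishing of the induced functional
  on a basis of \<open>\<H>\<close>, and still have a nontrivial solution.\<close>

lemma card_le_dim_H_space:
  fixes L :: "'e \<Rightarrow> ('u \<Rightarrow> complex) \<Rightarrow> complex" and \<Phi> :: "('u \<Rightarrow> complex) \<Rightarrow> 'v \<Rightarrow> 'v \<Rightarrow> 'v \<Rightarrow> complex"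
  assumes fd: "H.fin_dim" and fin: "finite U" "finite E"
    and L: "\<And>e. e \<in> E \<Longrightarrow> complex_linear (L e)"
    and \<Phi>: "\<And>x y z. x \<in> carrier A \<Longrightarrow> y \<in> carrier A \<Longrightarrow> z \<in> carrier A \<Longrightarrow> complex_linear (\<lambda>c. \<Phi> c x y z)"
    and inv: "\<And>c. (\<And>u. u \<notin> U \<Longrightarrow> c u = 0) \<Longrightarrow> (\<And>e. e \<in> E \<Longrightarrow> L e c = 0) \<Longrightarrow> invariant_form (\<Phi> c)"
    and inj: "\<And>c u. (\<And>u. u \<notin> U \<Longrightarrow> c u = 0) \<Longrightarrow>
       (\<And>x y z. x \<in> carrier A \<Longrightarrow> y \<in> carrier A \<Longrightarrow> z \<in> carrier A \<Longrightarrow> \<Phi> c x y z = 0) \<Longrightarrow> c u = 0"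
  shows "card U \<le> card E + H.dim"
proof (rule ccontr)
  assume less: "\<not> card U \<le> card E + H.dim"
  obtain \<beta> where \<beta>: "finite \<beta>" "H.basis \<beta>" using H.finite_basis_exists[OF fd] by blast
  have \<beta>c: "\<beta> \<subseteq> carrier (H_space A)" and gen: "H.span \<beta> = carrier (H_space A)"
    using \<beta> by (auto simp: H.basis_def)
  have "\<forall>h\<in>\<beta>. \<exists>T \<kappa>. finite T \<and> T \<subseteq> triples \<and>
    (\<forall>G. rat_functional (H_space A) G \<longrightarrow> G h = (\<Sum>(x, y, z)\<in>T. \<kappa> (x, y, z) * G (H_gen x y z)))"
    using H_space_combination \<beta>c by blast
  from bchoice[OF this] obtain T where "\<forall>h\<in>\<beta>. \<exists>\<kappa>. finite (T h) \<and> T h \<subseteq> triples \<and>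
    (\<forall>G. rat_functional (H_space A) G \<longrightarrow> G h = (\<Sum>(x, y, z)\<in>T h. \<kappa> (x, y, z) * G (H_gen x y z)))" ..
  from bchoice[OF this] obtain \<kappa> where T\<kappa>: "\<forall>h\<in>\<beta>. finite (T h) \<and> T h \<subseteq> triples \<and>
    (\<forall>G. rat_functional (H_space A) G \<longrightarrow> G h = (\<Sum>(x, y, z)\<in>T h. \<kappa> h (x, y, z) * G (H_gen x y z)))" ..
  have T: "finite (T h)" "T h \<subseteq> triples"
    "rat_functional (H_space A) G \<Longrightarrow> G h = (\<Sum>(x, y, z)\<in>T h. \<kappa> h (x, y, z) * G (H_gen x y z))"
    if "h \<in> \<beta>" for h G
    using T\<kappa>[rule_format, OF that] by blast+
  \<comment> \<open>The second family of equations evaluates the functional on \<open>\<H>\<close> induced by \<open>\<Phi> c\<close> at the basis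
    elements. It is written without that functional, which exists only if \<open>\<Phi> c\<close> is invariant.\<close>
  define K where "K = case_sum L (\<lambda>h c. \<Sum>(x, y, z)\<in>T h. \<kappa> h (x, y, z) * \<Phi> c x y z)"
  have K: "complex_linear (K e)" if "e \<in> E <+> \<beta>" for e
  proof (cases e)
    case (Inl a)
    thus ?thesis using that L by (auto simp: K_def)
  next
    case (Inr h)
    hence "h \<in> \<beta>" using that by auto
    hence "complex_linear (\<lambda>c. \<Phi> c x y z)" if "(x, y, z) \<in> T h" for x y z
      using \<Phi> T(2)[of h] that by auto
    hence "complex_linear (\<lambda>c. \<Phi> c (fst p) (fst (snd p)) (snd (snd p)))" if "p \<in> T h" for p
      using that by (cases p) auto
    hence "complex_linear (\<lambda>c. \<Sum>p\<in>T h. \<kappa> h p * \<Phi> c (fst p) (fst (snd p)) (snd (snd p)))"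
      by (rule complex_linear_combination)
    thus ?thesis unfolding K_def Inr sum.case by (simp add: case_prod_beta)
  qed
  have card: "card (E <+> \<beta>) < card U"
    using less H.dim_basis[OF \<beta>] fin(2) \<beta>(1) by (simp add: card_Plus)
  from linear_system_nontrivial[where L = K, OF finite_Plus[OF fin(2) \<beta>(1)] fin(1) card K]
  obtain c where c': "(\<exists>u\<in>U. c u \<noteq> 0) \<and> (\<forall>u. u \<notin> U \<longrightarrow> c u = 0) \<and> (\<forall>e\<in>E <+> \<beta>. K e c = 0)" ..
  have c: "\<exists>u\<in>U. c u \<noteq> 0" "u \<notin> U \<Longrightarrow> c u = 0" "e \<in> E <+> \<beta> \<Longrightarrow> K e c = 0" for u e
    using c' by simp_all
  have "L e c = 0" if "e \<in> E" for e
    using c(3)[OF InlI[OF that]] by (simp add: K_def)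
  with inv c(2) have "invariant_form (\<Phi> c)" by blast
  then obtain G where G: "rat_functional (H_space A) G"
    "\<And>x y z. x \<in> carrier A \<Longrightarrow> y \<in> carrier A \<Longrightarrow> z \<in> carrier A \<Longrightarrow> G (H_gen x y z) = \<Phi> c x y z"
    using functional_of_invariant_form by blast
  have G\<beta>: "G h = 0" if "h \<in> \<beta>" for h
  proof -
    have "G h = (\<Sum>(x, y, z)\<in>T h. \<kappa> h (x, y, z) * G (H_gen x y z))" using T(3) G(1) that by blast
    also have "\<dots> = K (Inr h) c" unfolding K_def sum.case
      by (rule sum.cong) (use G(2) T(2)[OF that] in auto)
    also have "\<dots> = 0" by (rule c(3)[OF InrI[OF that]])
    finally show ?thesis .
  qed
  have "G h = 0" if "h \<in> carrier (H_space A)" for h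
    by (rule rat_functional_span_eq_0[OF H.vectorspace_axioms \<beta>c G(1) G\<beta>]) (use gen that in auto)
  hence "\<Phi> c x y z = 0" if "x \<in> carrier A" "y \<in> carrier A" "z \<in> carrier A" for x y z
    using G(2)[OF that] H_gen_closed[OF that] by simp
  hence "c u = 0" for u using inj[of c u] c(2) by blast
  thus False using c(1) by blast
qed

text \<open>If no nonzero invariant form satisfies all the linear equations indexed by \<open>E\<close>, these
  equations on the combinations of a dual basis of \<open>\<H>\<close> have no nontrivial solution, and so there are at
  least \<open>dim \<H>\<close> of them.\<close>

lemma dim_H_space_le_card:
  fixes L :: "'e \<Rightarrow> ('v \<times> 'v \<times> 'v \<Rightarrow> complex) \<Rightarrow> complex"
  assumes fd: "H.fin_dim" and fin: "finite E"
    and L: "\<And>e. e \<in> E \<Longrightarrow> complex_linear (L e)"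
    and inj: "\<And>\<phi> x y z. invariant_form \<phi> \<Longrightarrow> (\<And>e. e \<in> E \<Longrightarrow> L e (\<lambda>(x, y, z). \<phi> x y z) = 0) \<Longrightarrow>
        x \<in> carrier A \<Longrightarrow> y \<in> carrier A \<Longrightarrow> z \<in> carrier A \<Longrightarrow> \<phi> x y z = 0"
  shows "H.dim \<le> card E"
proof (rule ccontr)
  assume less: "\<not> H.dim \<le> card E"
  obtain \<beta> where \<beta>: "finite \<beta>" "H.basis \<beta>" using H.finite_basis_exists[OF fd] by blast
  have \<beta>c: "\<beta> \<subseteq> carrier (H_space A)" using \<beta> by (auto simp: H.basis_def)
  obtain D where D: "\<And>b. b \<in> \<beta> \<Longrightarrow> rat_functional (H_space A) (D b)"
     "\<And>b b'. b \<in> \<beta> \<Longrightarrow> b' \<in> \<beta> \<Longrightarrow> D b b' = (if b = b' then 1 else 0)"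
    using dual_basis_exists[OF H.vectorspace_axioms \<beta>] by blast
  let ?w = "\<lambda>b (x, y, z). D b (H_gen x y z)"
  have card: "card E < card \<beta>" using less H.dim_basis[OF \<beta>] by simp
  obtain c where c: "\<exists>b\<in>\<beta>. c b \<noteq> 0" "\<And>e. e \<in> E \<Longrightarrow> (\<Sum>b\<in>\<beta>. c b * L e (?w b)) = 0"
    using homogeneous_system_nontrivial[OF fin \<beta>(1) card, of "\<lambda>e b. L e (?w b)"] by blast
  define G where "G h = (\<Sum>b\<in>\<beta>. c b * D b h)" for h
  have G: "rat_functional (H_space A) G"
    unfolding G_def using D(1) by (rule rat_functional_sum)
  have "L e (\<lambda>(x, y, z). G (H_gen x y z)) = 0" if "e \<in> E" for e
  proof -
    have "(\<lambda>(x, y, z). G (H_gen x y z)) = (\<lambda>p. \<Sum>b\<in>\<beta>. c b * ?w b p)"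
      by (auto simp: G_def)
    thus ?thesis using c(2)[OF that] complex_linear_sum[OF L[OF that] \<beta>(1), of c ?w] by simp
  qed
  hence "G (H_gen x y z) = 0" if "x \<in> carrier A" "y \<in> carrier A" "z \<in> carrier A" for x y z
    using inj[OF invariant_form_of_functional[OF G]] that by blast
  hence 0: "G h = 0" if "h \<in> carrier (H_space A)" for h
    using functional_eq_0[OF G _ that] by blast
  have "c b = 0" if "b \<in> \<beta>" for b
  proof -
    have "0 = (\<Sum>b'\<in>\<beta>. c b' * D b' b)" using 0[of b] that \<beta>c by (auto simp: G_def)
    also have "\<dots> = (\<Sum>b'\<in>\<beta>. if b' = b then c b else 0)"
      by (rule sum.cong) (use D(2) that in auto)
    also have "\<dots> = c b" using that \<beta>(1) by simp
    finally show ?thesis by simp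
  qed
  thus False using c(1) by blast
qed

lemma H_space_fin_dim:
  assumes fin: "finite S" and S: "S \<subseteq> carrier A" and span: "lin_span V S = carrier A"
  shows "H.fin_dim"
proof -
  let ?T = "(\<lambda>(x, y, z). H_gen x y z) ` (S \<times> S \<times> S)"
  have T: "?T \<subseteq> carrier (H_space A)" by (auto intro!: H_gen_closed dest: subsetD[OF S])
  interpret sp: LinearCombinations.submodule class_ring "H.span ?T" "H_space A"
    by (rule H.span_is_submodule[OF T])
  have SV: "S \<subseteq> carrier V" using S by simp
  have ind: "P x" if "x \<in> carrier A" and "P \<zero>\<^bsub>A\<^esub>"
    and "\<And>x y. x \<in> carrier A \<Longrightarrow> y \<in> carrier A \<Longrightarrow> P x \<Longrightarrow> P y \<Longrightarrow> P (x \<oplus>\<^bsub>A\<^esub> y)"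
    and "\<And>q x. x \<in> carrier A \<Longrightarrow> P x \<Longrightarrow> P (q \<odot>\<^bsub>V\<^esub> x)" and "\<And>x. x \<in> S \<Longrightarrow> P x" for P x
    by (rule span_induct_class_ring[OF V.vectorspace_axioms SV]) (use that span in auto)
  have 1: "H_gen x y z \<in> H.span ?T" if "x \<in> carrier A" "y \<in> S" "z \<in> S" for x y z
    by (rule ind[OF that(1)])
      (use that S in \<open>auto simp del: rat_restrict_simps(4) simp: H_gen_zero H_gen_add H_gen_smult subset_iff
         intro!: H.in_own_span[OF T, THEN subsetD]\<close>)
  have 2: "H_gen x y z \<in> H.span ?T" if "x \<in> carrier A" "y \<in> carrier A" "z \<in> S" for x y z
    by (rule ind[OF that(2)])
      (use that S 1 in \<open>auto simp del: rat_restrict_simps(4) simp: H_gen_zero H_gen_add H_gen_smult subset_iff\<close>)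
  have 3: "H_gen x y z \<in> H.span ?T" if "x \<in> carrier A" "y \<in> carrier A" "z \<in> carrier A" for x y z
    by (rule ind[OF that(3)])
      (use that S 2 in \<open>auto simp del: rat_restrict_simps(4) simp: H_gen_zero H_gen_add H_gen_smult subset_iff\<close>)
  let ?S = "{H_gen x y z | x y z. x \<in> carrier A \<and> y \<in> carrier A \<and> z \<in> carrier A}"
  have "?S \<subseteq> H.span ?T" using 3 by auto
  hence "H.span ?S \<subseteq> H.span ?T" by (rule H.span_is_subset[OF _ sp.submodule_axioms])
  hence "H.span ?T = carrier (H_space A)"
    using H_space_span H.span_is_subset2[OF T] by auto
  moreover have "finite ?T" using fin by simp
  ultimately show ?thesis unfolding H.fin_dim_def using T by blast
qed

end

section \<open>Coordinates of invariant forms on a sum of Jordan blocks\<close>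

text \<open>A finite set \<open>Bk\<close> of Jordan blocks with nonzero eigenvalues \<open>ev\<close> and sizes \<open>sz\<close>, linearly ordered by
  \<open>lt\<close>.\<close>

locale jordan_blocks =
  fixes Bk :: "'b set" and lt :: "'b \<Rightarrow> 'b \<Rightarrow> bool" and ev :: "'b \<Rightarrow> complex" and sz :: "'b \<Rightarrow> nat"
  assumes finite_Bk: "finite Bk"
    and lt_irrefl: "\<not> lt a a"
    and lt_trans: "lt a b \<Longrightarrow> lt b c \<Longrightarrow> lt a c"
    and lt_total: "a \<in> Bk \<Longrightarrow> b \<in> Bk \<Longrightarrow> lt a b \<or> a = b \<or> lt b a"
    and ev_nonzero: "a \<in> Bk \<Longrightarrow> ev a \<noteq> 0"
begin

text \<open>An index consists of a block and a position in it.\<close>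

definition Idx :: "('b \<times> nat) set" where
  "Idx = {(b, k). b \<in> Bk \<and> k < sz b}"

lemma finite_Idx: "finite Idx"
proof -
  have "Idx = (SIGMA b:Bk. {..<sz b})" by (auto simp: Idx_def)
  thus ?thesis using finite_Bk by simp
qed

text \<open>The lexicographic order of indices, and the strictly increasing triples of indices.\<close>

definition ilt :: "'b \<times> nat \<Rightarrow> 'b \<times> nat \<Rightarrow> bool" where
  "ilt \<alpha> \<beta> \<longleftrightarrow> lt (fst \<alpha>) (fst \<beta>) \<or> fst \<alpha> = fst \<beta> \<and> snd \<alpha> < snd \<beta>"

lemma ilt_irrefl: "\<not> ilt \<alpha> \<alpha>"
  using lt_irrefl by (auto simp: ilt_def)

lemma ilt_trans: "ilt \<alpha> \<beta> \<Longrightarrow> ilt \<beta> \<gamma> \<Longrightarrow> ilt \<alpha> \<gamma>"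
  using lt_trans by (auto simp: ilt_def)

lemma ilt_asym: "ilt \<alpha> \<beta> \<Longrightarrow> \<not> ilt \<beta> \<alpha>"
  using ilt_trans ilt_irrefl by blast

lemma ilt_total: "\<alpha> \<in> Idx \<Longrightarrow> \<beta> \<in> Idx \<Longrightarrow> ilt \<alpha> \<beta> \<or> \<alpha> = \<beta> \<or> ilt \<beta> \<alpha>"
  using lt_total[of "fst \<alpha>" "fst \<beta>"] by (auto simp: ilt_def Idx_def prod_eq_iff)

definition Inc :: "(('b \<times> nat) \<times> ('b \<times> nat) \<times> ('b \<times> nat)) set" where
  "Inc = {(\<alpha>, \<beta>, \<gamma>). \<alpha> \<in> Idx \<and> \<beta> \<in> Idx \<and> \<gamma> \<in> Idx \<and> ilt \<alpha> \<beta> \<and> ilt \<beta> \<gamma>}"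

lemma finite_Inc: "finite Inc"
  by (rule finite_subset[of _ "Idx \<times> Idx \<times> Idx"]) (auto simp: Inc_def finite_Idx)

text \<open>If \<open>c\<close> is the array of coefficients of a functional with respect to a basis \<open>\<lambda>\<close> on which \<open>t\<close> acts by
  \<open>\<lambda> (b, k) \<mapsto> ev b * \<lambda> (b, k) + \<lambda> (b, k - 1)\<close>, without the second term for \<open>k = 0\<close>, then
  \<open>shift c\<close> is the array of its image. In the same way \<open>shift3\<close> describes the action on trilinear forms. Arrays are meant to vanish outside \<open>Idx\<close>.\<close>

definition shift :: "('b \<times> nat \<Rightarrow> complex) \<Rightarrow> 'b \<times> nat \<Rightarrow> complex" where
  "shift c \<alpha> = ev (fst \<alpha>) * c \<alpha> + c (fst \<alpha>, Suc (snd \<alpha>))"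

definition shift3 ::
    "(('b \<times> nat) \<times> ('b \<times> nat) \<times> ('b \<times> nat) \<Rightarrow> complex) \<Rightarrow> ('b \<times> nat) \<times> ('b \<times> nat) \<times> ('b \<times> nat) \<Rightarrow> complex" where
  "shift3 c = (\<lambda>(\<alpha>, \<beta>, \<gamma>). shift (\<lambda>\<alpha>'. shift (\<lambda>\<beta>'. shift (\<lambda>\<gamma>'. c (\<alpha>', \<beta>', \<gamma>')) \<gamma>) \<beta>) \<alpha>)"

lemma shift3_expand:
  "shift3 c ((a, i), (b, j), (d, k)) =
     ev a * ev b * ev d * c ((a, i), (b, j), (d, k)) +
     ev b * ev d * c ((a, Suc i), (b, j), (d, k)) +
     ev a * ev d * c ((a, i), (b, Suc j), (d, k)) +
     ev a * ev b * c ((a, i), (b, j), (d, Suc k)) +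
     ev a * c ((a, i), (b, Suc j), (d, Suc k)) +
     ev b * c ((a, Suc i), (b, j), (d, Suc k)) +
     ev d * c ((a, Suc i), (b, Suc j), (d, k)) +
     c ((a, Suc i), (b, Suc j), (d, Suc k))"
  by (simp add: shift3_def shift_def algebra_simps)

text \<open>Raising positions by at most one in a strictly increasing triple of indices leaves it weakly
  increasing. So an antisymmetric array, at the triples that occur in the recursion at a strictly
  increasing one, is either at such a triple again, or vanishes because two indices agree or one is
  out of range.\<close>

definition weakly_inc :: "'b \<Rightarrow> 'b \<Rightarrow> 'b \<Rightarrow> nat \<Rightarrow> nat \<Rightarrow> nat \<Rightarrow> bool" where
  "weakly_inc a b d i j k \<longleftrightarrow> (lt a b \<or> a = b \<and> i \<le> j) \<and> (lt b d \<or> b = d \<and> j \<le> k)"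

lemma Inc_iff:
  "((a, i), (b, j), (d, k)) \<in> Inc \<longleftrightarrow> a \<in> Bk \<and> b \<in> Bk \<and> d \<in> Bk \<and> i < sz a \<and> j < sz b \<and> k < sz d \<and>
     (lt a b \<or> a = b \<and> i < j) \<and> (lt b d \<or> b = d \<and> j < k)"
  by (auto simp: Inc_def Idx_def ilt_def)

lemma weakly_inc_if_Inc:
  assumes "((a, i), (b, j), (d, k)) \<in> Inc"
    and "i' \<le> Suc i" "j \<le> j'" "j' \<le> Suc j" "k \<le> k'"
  shows "weakly_inc a b d i' j' k'"
  using assms unfolding Inc_iff weakly_inc_def by auto

text \<open>The product of the eigenvalues of the three blocks.\<close>

definition weight :: "('b \<times> nat) \<times> ('b \<times> nat) \<times> ('b \<times> nat) \<Rightarrow> complex" where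
  "weight = (\<lambda>((a, _), (b, _), (d, _)). ev a * ev b * ev d)"

text \<open>An invariant antisymmetric array is determined by its values at these triples.\<close>

definition Bottom :: "(('b \<times> nat) \<times> ('b \<times> nat) \<times> ('b \<times> nat)) set" where
  "Bottom = {p \<in> Inc. weight p = 1 \<and> snd (fst p) = 0}"

text \<open>For weight different from 1 the recursion expresses an entry by entries of higher degree, and one
  descends from the top degree. For weight 1 the recursion at \<open>(i, j, k)\<close> yields the entry at
  \<open>(i + 1, j, k)\<close> from entries with first position \<open>i\<close>, and from entries with first position \<open>i + 1\<close> and a
  larger sum of the other two positions.\<close>

lemma invariant_zero_if_zero_on_Bottom:
  assumes inv: "\<And>p. p \<in> Inc \<Longrightarrow> shift3 c p = c p"
    and zero: "\<And>a b d i j k. weakly_inc a b d i j k \<Longrightarrow> ((a, i), (b, j), (d, k)) \<notin> Inc \<Longrightarrow>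
          c ((a, i), (b, j), (d, k)) = 0"
    and bot: "\<And>p. p \<in> Bottom \<Longrightarrow> c p = 0"
    and p: "p \<in> Inc"
  shows "c p = 0"
proof -
  obtain a i0 b j0 d k0 where p_eq: "p = ((a, i0), (b, j0), (d, k0))" by (metis prod.collapse)
  define C where "C i j k = c ((a, i), (b, j), (d, k))" for i j k
  have wp: "weakly_inc a b d i0 j0 k0" using p unfolding p_eq by (rule weakly_inc_if_Inc) auto
  have abd: "a \<in> Bk" "b \<in> Bk" "d \<in> Bk" using p unfolding p_eq Inc_iff by auto
  have eq: "ev a * ev b * ev d * C i j k + ev b * ev d * C (Suc i) j k + ev a * ev d * C i (Suc j) k +
      ev a * ev b * C i j (Suc k) + ev a * C i (Suc j) (Suc k) + ev b * C (Suc i) j (Suc k) +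
      ev d * C (Suc i) (Suc j) k + C (Suc i) (Suc j) (Suc k) = C i j k"
    if "((a, i), (b, j), (d, k)) \<in> Inc" for i j k
    using inv[OF that] unfolding shift3_expand C_def .
  show ?thesis
  proof (cases "ev a * ev b * ev d = 1")
    case False
    have "C i j k = 0" if "weakly_inc a b d i j k" for i j k
      using that
    proof (induction "(sz a - i) + (sz b - j) + (sz d - k)" arbitrary: i j k rule: less_induct)
      case less
      show ?case
      proof (cases "((a, i), (b, j), (d, k)) \<in> Inc")
        case out: False
        thus ?thesis using zero less.prems by (simp add: C_def)
      next
        case True
        hence bd: "i < sz a" "j < sz b" "k < sz d" by (auto simp: Inc_iff)
        have "C i' j' k' = 0" if "i' = i \<or> i' = Suc i" "j' = j \<or> j' = Suc j" "k' = k \<or> k' = Suc k"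
          "i + j + k < i' + j' + k'" for i' j' k'
          by (rule less.hyps) (use that bd in \<open>auto intro!: weakly_inc_if_Inc[OF True]\<close>)
        with eq[OF True] have "(ev a * ev b * ev d - 1) * C i j k = 0"
          by (simp add: algebra_simps)
        thus ?thesis using False by simp
      qed
    qed
    thus ?thesis using wp by (simp add: p_eq C_def)
  next
    case True
    have "C i j k = 0" if "weakly_inc a b d i j k" for i j k
      using that
    proof (induction i arbitrary: j k)
      case 0
      thus ?case using zero[of a b d 0 j k] bot True
        by (cases "((a, 0), (b, j), (d, k)) \<in> Inc") (auto simp: C_def Bottom_def weight_def)
    next
      case (Suc i)
      show ?case using Suc.prems
      proof (induction "(sz b - j) + (sz d - k)" arbitrary: j k rule: less_induct)
        case less
        show ?case
        proof (cases "((a, Suc i), (b, j), (d, k)) \<in> Inc")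
          case out: False
          thus ?thesis using zero less.prems by (simp add: C_def)
        next
          case inc: True
          hence inc': "((a, i), (b, j), (d, k)) \<in> Inc" by (auto simp: Inc_iff)
          from inc have bd: "j < sz b" "k < sz d" by (auto simp: Inc_iff)
          have 1: "C i j' k' = 0" if "j' = j \<or> j' = Suc j" "k' = k \<or> k' = Suc k" for j' k'
            by (rule Suc.IH) (use that in \<open>auto intro!: weakly_inc_if_Inc[OF inc]\<close>)
          have 2: "C (Suc i) j' k' = 0" if "j' = j \<or> j' = Suc j" "k' = k \<or> k' = Suc k" "j + k < j' + k'" for j' k'
            by (rule less.hyps) (use that bd in \<open>auto intro!: weakly_inc_if_Inc[OF inc]\<close>)
          from eq[OF inc'] have "ev b * ev d * C (Suc i) j k = 0"
            by (simp add: 1 2)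
          thus ?thesis using ev_nonzero abd by simp
        qed
      qed
    qed
    thus ?thesis using wp by (simp add: p_eq C_def)
  qed
qed

definition antisymmetric :: "('i \<times> 'i \<times> 'i \<Rightarrow> complex) \<Rightarrow> bool" where
  "antisymmetric c \<longleftrightarrow> (\<forall>\<alpha> \<beta> \<gamma>. c (\<beta>, \<alpha>, \<gamma>) = - c (\<alpha>, \<beta>, \<gamma>) \<and> c (\<alpha>, \<gamma>, \<beta>) = - c (\<alpha>, \<beta>, \<gamma>))"

lemma antisymmetricD:
  assumes "antisymmetric c"
  shows "c (\<beta>, \<alpha>, \<gamma>) = - c (\<alpha>, \<beta>, \<gamma>)" "c (\<alpha>, \<gamma>, \<beta>) = - c (\<alpha>, \<beta>, \<gamma>)"
  using assms unfolding antisymmetric_def by blast+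

lemma antisymmetric_equal:
  assumes c: "antisymmetric c"
  shows "c (\<alpha>, \<alpha>, \<gamma>) = 0" "c (\<alpha>, \<gamma>, \<gamma>) = 0" "c (\<alpha>, \<gamma>, \<alpha>) = 0"
proof -
  show 1: "c (\<alpha>, \<alpha>, \<gamma>) = 0" for \<alpha> \<gamma> using antisymmetricD(1)[OF c, of \<alpha> \<alpha> \<gamma>] by simp
  show "c (\<alpha>, \<gamma>, \<gamma>) = 0" using antisymmetricD(2)[OF c, of \<alpha> \<gamma> \<gamma>] by simp
  show "c (\<alpha>, \<gamma>, \<alpha>) = 0" using antisymmetricD(2)[OF c, of \<alpha> \<gamma> \<alpha>] 1[of \<alpha> \<gamma>] by simp
qed

lemma antisymmetric_eq_0:
  assumes c: "antisymmetric c" and inc: "\<And>p. p \<in> Inc \<Longrightarrow> c p = 0"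
    and idx: "\<alpha> \<in> Idx" "\<beta> \<in> Idx" "\<gamma> \<in> Idx"
  shows "c (\<alpha>, \<beta>, \<gamma>) = 0"
proof -
  have sorted: "c (\<alpha>, \<beta>, \<gamma>) = 0" if "\<alpha> \<in> Idx" "\<beta> \<in> Idx" "\<gamma> \<in> Idx" "ilt \<alpha> \<beta>" "ilt \<beta> \<gamma>" for \<alpha> \<beta> \<gamma>
    using that by (intro inc) (auto simp: Inc_def)
  have first: "c (\<alpha>, \<beta>, \<gamma>) = 0" if i: "\<alpha> \<in> Idx" "\<beta> \<in> Idx" "\<gamma> \<in> Idx" and l: "ilt \<alpha> \<beta>" for \<alpha> \<beta> \<gamma>
  proof -
    consider "ilt \<beta> \<gamma>" | "\<beta> = \<gamma>" | "ilt \<gamma> \<beta>" "ilt \<alpha> \<gamma>" | "\<alpha> = \<gamma>" | "ilt \<gamma> \<alpha>"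
      using ilt_total i by blast
    thus ?thesis
    proof cases
      case 1 thus ?thesis using sorted i l by blast
    next
      case 2 thus ?thesis using antisymmetric_equal[OF c] by simp
    next
      case 3 thus ?thesis using antisymmetricD(2)[OF c, of \<alpha> \<beta> \<gamma>] sorted[of \<alpha> \<gamma> \<beta>] i by simp
    next
      case 4 thus ?thesis using antisymmetric_equal[OF c] by simp
    next
      case 5
      have "c (\<alpha>, \<beta>, \<gamma>) = c (\<gamma>, \<alpha>, \<beta>)"
        using antisymmetricD(2)[OF c, of \<alpha> \<gamma> \<beta>] antisymmetricD(1)[OF c, of \<alpha> \<gamma> \<beta>] by simp
      thus ?thesis using sorted[of \<gamma> \<alpha> \<beta>] 5 l i by simp
    qed
  qed
  consider "ilt \<alpha> \<beta>" | "\<alpha> = \<beta>" | "ilt \<beta> \<alpha>" using ilt_total idx by blast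
  thus ?thesis
  proof cases
    case 1 thus ?thesis using first idx by blast
  next
    case 2 thus ?thesis using antisymmetric_equal[OF c] by simp
  next
    case 3 thus ?thesis using antisymmetricD(1)[OF c, of \<alpha> \<beta> \<gamma>] first[of \<beta> \<alpha> \<gamma>] idx by simp
  qed
qed

lemma antisymmetric_shift3:
  assumes "antisymmetric c"
  shows "antisymmetric (shift3 c)"
  unfolding antisymmetric_def
proof (intro allI conjI)
  fix \<alpha> \<beta> \<gamma> :: "'b \<times> nat"
  obtain a i b j d k where eq: "\<alpha> = (a, i)" "\<beta> = (b, j)" "\<gamma> = (d, k)" by (metis prod.collapse)
  have 1: "c ((b, y), (a, x), \<delta>) = - c ((a, x), (b, y), \<delta>)" for x y \<delta>
    by (rule antisymmetricD[OF assms])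
  have 2: "c (\<delta>, (d, y), (b, x)) = - c (\<delta>, (b, x), (d, y))" for x y \<delta>
    by (rule antisymmetricD[OF assms])
  show "shift3 c (\<beta>, \<alpha>, \<gamma>) = - shift3 c (\<alpha>, \<beta>, \<gamma>)"
    unfolding eq shift3_expand 1 by (simp add: algebra_simps)
  show "shift3 c (\<alpha>, \<gamma>, \<beta>) = - shift3 c (\<alpha>, \<beta>, \<gamma>)"
    unfolding eq shift3_expand 2 by (simp add: algebra_simps)
qed

theorem antisymmetric_invariant_eq_0:
  assumes c: "antisymmetric c"
    and supp: "\<And>\<alpha> \<beta> \<gamma>. \<not> (\<alpha> \<in> Idx \<and> \<beta> \<in> Idx \<and> \<gamma> \<in> Idx) \<Longrightarrow> c (\<alpha>, \<beta>, \<gamma>) = 0"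
    and inv: "\<And>\<alpha> \<beta> \<gamma>. \<alpha> \<in> Idx \<Longrightarrow> \<beta> \<in> Idx \<Longrightarrow> \<gamma> \<in> Idx \<Longrightarrow> shift3 c (\<alpha>, \<beta>, \<gamma>) = c (\<alpha>, \<beta>, \<gamma>)"
    and bot: "\<And>p. p \<in> Bottom \<Longrightarrow> c p = 0"
  shows "c p = 0"
proof -
  have "c p = 0" if "p \<in> Inc" for p
  proof (rule invariant_zero_if_zero_on_Bottom[OF _ _ bot that])
    show "shift3 c p = c p" if "p \<in> Inc" for p using that inv by (auto simp: Inc_def)
    show "c ((a, i), (b, j), (d, k)) = 0"
      if w: "weakly_inc a b d i j k" and out: "((a, i), (b, j), (d, k)) \<notin> Inc" for a b d i j k
    proof (cases "(a, i) \<in> Idx \<and> (b, j) \<in> Idx \<and> (d, k) \<in> Idx")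
      case True
      hence "(a, i) = (b, j) \<or> (b, j) = (d, k)"
        using w out by (auto simp: weakly_inc_def Inc_def ilt_def)
      thus ?thesis using antisymmetric_equal[OF c] by auto
    qed (rule supp)
  qed
  thus ?thesis using antisymmetric_eq_0[OF c] supp by (cases p) blast
qed

text \<open>For an array supported on the strictly increasing triples, the antisymmetric array that agrees with
  it there.\<close>

definition alt :: "('i \<times> 'i \<times> 'i \<Rightarrow> complex) \<Rightarrow> 'i \<times> 'i \<times> 'i \<Rightarrow> complex" where
  "alt f = (\<lambda>(\<alpha>, \<beta>, \<gamma>). f (\<alpha>, \<beta>, \<gamma>) - f (\<beta>, \<alpha>, \<gamma>) - f (\<alpha>, \<gamma>, \<beta>) - f (\<gamma>, \<beta>, \<alpha>) + f (\<beta>, \<gamma>, \<alpha>) + f (\<gamma>, \<alpha>, \<beta>))"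

lemma antisymmetric_alt: "antisymmetric (alt f)"
  by (simp add: antisymmetric_def alt_def)

lemma alt_eq_on_Inc:
  assumes "\<And>p. p \<notin> Inc \<Longrightarrow> f p = 0" "(\<alpha>, \<beta>, \<gamma>) \<in> Inc"
  shows "alt f (\<alpha>, \<beta>, \<gamma>) = f (\<alpha>, \<beta>, \<gamma>)"
proof -
  have l: "ilt \<alpha> \<beta>" "ilt \<beta> \<gamma>" using assms(2) by (simp_all add: Inc_def)
  have "(\<beta>, \<alpha>, \<gamma>) \<notin> Inc" "(\<alpha>, \<gamma>, \<beta>) \<notin> Inc" "(\<gamma>, \<beta>, \<alpha>) \<notin> Inc" "(\<beta>, \<gamma>, \<alpha>) \<notin> Inc" "(\<gamma>, \<alpha>, \<beta>) \<notin> Inc"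
    using l ilt_trans[OF l] ilt_asym by (simp_all add: Inc_def)
  thus ?thesis by (simp add: alt_def assms(1))
qed

lemma alt_eq_0_outside:
  assumes "\<And>p. p \<notin> Inc \<Longrightarrow> f p = 0" "\<not> (\<alpha> \<in> Idx \<and> \<beta> \<in> Idx \<and> \<gamma> \<in> Idx)"
  shows "alt f (\<alpha>, \<beta>, \<gamma>) = 0"
proof -
  have "(\<alpha>, \<beta>, \<gamma>) \<notin> Inc" "(\<beta>, \<alpha>, \<gamma>) \<notin> Inc" "(\<alpha>, \<gamma>, \<beta>) \<notin> Inc" "(\<gamma>, \<beta>, \<alpha>) \<notin> Inc" "(\<beta>, \<gamma>, \<alpha>) \<notin> Inc" "(\<gamma>, \<alpha>, \<beta>) \<notin> Inc"
    using assms(2) by (auto simp: Inc_def)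
  thus ?thesis by (simp add: alt_def assms(1))
qed

lemma alt_eq_on_weakly_inc:
  assumes f: "\<And>p. p \<notin> Inc \<Longrightarrow> f p = 0" and w: "weakly_inc a b d i j k"
  shows "alt f ((a, i), (b, j), (d, k)) = f ((a, i), (b, j), (d, k))"
proof (cases "((a, i), (b, j), (d, k)) \<in> Inc")
  case True
  show ?thesis by (rule alt_eq_on_Inc[where f = f, OF f True])
next
  case out: False
  have "alt f ((a, i), (b, j), (d, k)) = 0"
  proof (cases "(a, i) \<in> Idx \<and> (b, j) \<in> Idx \<and> (d, k) \<in> Idx")
    case True
    hence "(a, i) = (b, j) \<or> (b, j) = (d, k)"
      using w out by (auto simp: weakly_inc_def Inc_def ilt_def)
    thus ?thesis using antisymmetric_equal[OF antisymmetric_alt[of f]] by auto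
  next
    case False
    show ?thesis by (rule alt_eq_0_outside[where f = f, OF f False])
  qed
  thus ?thesis using f out by simp
qed

lemma shift3_alt:
  assumes f: "\<And>p. p \<notin> Inc \<Longrightarrow> f p = 0" and inv: "\<And>p. p \<in> Inc \<Longrightarrow> shift3 f p = f p"
  shows "shift3 (alt f) (\<alpha>, \<beta>, \<gamma>) = alt f (\<alpha>, \<beta>, \<gamma>)"
proof (cases "\<alpha> \<in> Idx \<and> \<beta> \<in> Idx \<and> \<gamma> \<in> Idx")
  case True
  define g where "g p = shift3 (alt f) p - alt f p" for p
  have "antisymmetric g"
    unfolding antisymmetric_def
  proof (intro allI conjI)
    fix \<alpha> \<beta> \<gamma>
    show "g (\<beta>, \<alpha>, \<gamma>) = - g (\<alpha>, \<beta>, \<gamma>)"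
      using antisymmetricD(1)[OF antisymmetric_shift3[OF antisymmetric_alt], of f \<beta> \<alpha> \<gamma>]
        antisymmetricD(1)[OF antisymmetric_alt, of f \<beta> \<alpha> \<gamma>] by (simp add: g_def)
    show "g (\<alpha>, \<gamma>, \<beta>) = - g (\<alpha>, \<beta>, \<gamma>)"
      using antisymmetricD(2)[OF antisymmetric_shift3[OF antisymmetric_alt], of f \<alpha> \<gamma> \<beta>]
        antisymmetricD(2)[OF antisymmetric_alt, of f \<alpha> \<gamma> \<beta>] by (simp add: g_def)
  qed
  moreover have "g p = 0" if p: "p \<in> Inc" for p
  proof -
    obtain a i b j d k where p_eq: "p = ((a, i), (b, j), (d, k))" by (metis prod.collapse)
    have "alt f ((a, i'), (b, j'), (d, k')) = f ((a, i'), (b, j'), (d, k'))"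
      if "i' = i \<or> i' = Suc i" "j' = j \<or> j' = Suc j" "k' = k \<or> k' = Suc k" for i' j' k'
      by (rule alt_eq_on_weakly_inc[where f = f, OF f])
        (use that in \<open>auto intro!: weakly_inc_if_Inc[OF p[unfolded p_eq]]\<close>)
    hence "shift3 (alt f) p = shift3 f p" "alt f p = f p"
      unfolding p_eq shift3_expand by simp_all
    thus ?thesis using inv[OF p] by (simp add: g_def)
  qed
  ultimately have "g (\<alpha>, \<beta>, \<gamma>) = 0" using antisymmetric_eq_0 True by blast
  thus ?thesis by (simp add: g_def)
next
  case False
  obtain a i b j d k where eq: "\<alpha> = (a, i)" "\<beta> = (b, j)" "\<gamma> = (d, k)" by (metis prod.collapse)
  have "alt f ((a, i'), (b, j'), (d, k')) = 0" if "i \<le> i'" "j \<le> j'" "k \<le> k'" for i' j' k'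
    by (rule alt_eq_0_outside[where f = f, OF f]) (use False that in \<open>auto simp: eq Idx_def\<close>)
  thus ?thesis unfolding eq shift3_expand by simp
qed

text \<open>The degree of a triple of indices is the sum of the positions.\<close>

definition deg :: "('b \<times> nat) \<times> ('b \<times> nat) \<times> ('b \<times> nat) \<Rightarrow> nat" where
  "deg = (\<lambda>((_, i), (_, j), (_, k)). i + j + k)"

definition blocks :: "('b \<times> nat) \<times> ('b \<times> nat) \<times> ('b \<times> nat) \<Rightarrow> 'b \<times> 'b \<times> 'b" where
  "blocks = (\<lambda>((a, _), (b, _), (d, _)). (a, b, d))"

text \<open>For an array supported in weight 1 and in degrees up to \<open>n\<close>, only the equations in degrees below
  \<open>n\<close> are nontrivial.\<close>

lemma shift3_eq_if_filtered:
  fixes n :: "'b \<times> 'b \<times> 'b \<Rightarrow> nat"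
  assumes f: "\<And>p. \<not> (p \<in> Inc \<and> weight p = 1 \<and> deg p \<le> n (blocks p)) \<Longrightarrow> f p = 0"
    and inv: "\<And>p. p \<in> Inc \<Longrightarrow> weight p = 1 \<Longrightarrow> deg p < n (blocks p) \<Longrightarrow> shift3 f p = f p"
    and p: "p \<in> Inc"
  shows "shift3 f p = f p"
proof -
  obtain a i b j d k where p_eq: "p = ((a, i), (b, j), (d, k))" by (metis prod.collapse)
  show ?thesis
  proof (cases "ev a * ev b * ev d = 1 \<and> deg p < n (blocks p)")
    case True
    thus ?thesis using inv p by (simp add: weight_def p_eq)
  next
    case False
    have "f ((a, i'), (b, j'), (d, k')) = 0" if "i + j + k < i' + j' + k'" for i' j' k'
      by (rule f) (use False that in \<open>auto simp: weight_def deg_def blocks_def p_eq\<close>)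
    moreover have "ev a * ev b * ev d * f p = f p"
    proof (cases "ev a * ev b * ev d = 1")
      case False
      hence "f p = 0" by (intro f) (auto simp: weight_def p_eq)
      thus ?thesis by simp
    qed simp
    ultimately show ?thesis unfolding p_eq shift3_expand by simp
  qed
qed

end

section \<open>Counting triples of indices\<close>

lemma card_pairs_less:
  "finite {(j, k). j < k \<and> k < (n::nat)}" "real (card {(j, k). j < k \<and> k < (n::nat)}) = real n * (real n - 1) / 2"
proof -
  have eq: "{(j, k). j < k \<and> k < n} = (\<lambda>(k, j). (j, k)) ` (SIGMA k:{..<n}. {..<k})" for n :: nat
    by (auto simp: image_iff)
  show "finite {(j, k). j < k \<and> k < (n::nat)}" unfolding eq by simp
  have "card {(j, k). j < k \<and> k < n} = (\<Sum>k<n. k)"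
    unfolding eq by (subst card_image) (auto simp: inj_on_def)
  moreover have "real (\<Sum>k<n. k) = real n * (real n - 1) / 2"
    by (induction n) (auto simp: field_simps)
  ultimately show "real (card {(j, k). j < k \<and> k < (n::nat)}) = real n * (real n - 1) / 2" by simp
qed

lemma card_pairs_positive_less:
  assumes "n \<ge> 1"
  shows "finite {(j, k). 0 < j \<and> j < k \<and> k < (n::nat)}"
    "real (card {(j, k). 0 < j \<and> j < k \<and> k < (n::nat)}) = (real n - 1) * (real n - 2) / 2"
proof -
  have eq: "{(j, k). 0 < j \<and> j < k \<and> k < n} = (\<lambda>(j, k). (Suc j, Suc k)) ` {(j, k). j < k \<and> k < n - 1}"
    (is "?A = ?f ` ?B")
  proof
    show "?f ` ?B \<subseteq> ?A" by auto
    show "?A \<subseteq> ?f ` ?B"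
    proof
      fix p assume "p \<in> ?A"
      then obtain j k where "p = (j, k)" "0 < j" "j < k" "k < n" by auto
      thus "p \<in> ?f ` ?B" by (intro image_eqI[of _ _ "(j - 1, k - 1)"]) auto
    qed
  qed
  show "finite ?A" unfolding eq using card_pairs_less by simp
  have "card ?A = card ?B" unfolding eq by (rule card_image) (auto simp: inj_on_def)
  thus "real (card ?A) = (real n - 1) * (real n - 2) / 2"
    using card_pairs_less(2)[of "n - 1"] assms by (simp add: of_nat_diff)
qed

text \<open>The left-hand side is the lower bound for distinct blocks. In the second case it is a lower bound
  because the pairs with \<open>m1 \<le> j + k\<close> become, after reflection of both coordinates, pairs of
  natural numbers with sum less than \<open>s = m2 + m3 - m1 - 1\<close>. Writing
  \<open>(x, x + y + 1)\<close> for such a pair \<open>(x, y)\<close> turns them into the pairs with \<open>j < k < s + 1\<close>.\<close>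

lemma card_truncated_rectangle:
  fixes m1 m2 m3 :: nat
  assumes "m2 \<le> m1" "m3 \<le> m2" "1 \<le> m3"
  shows "(if real m2 + real m3 \<le> real m1 + 1 then real m2 * real m3
           else real m2 * real m3 - 1 / 2 * (real m2 + real m3 - real m1) * (real m2 + real m3 - real m1 - 1))
     \<le> real (card {(j, k). j < m2 \<and> k < m3 \<and> j + k < m1})" (is "_ \<le> real (card ?S)")
proof (cases "m2 + m3 \<le> m1 + 1")
  case True
  have "?S = {..<m2} \<times> {..<m3}" using True by auto
  moreover have "real m2 + real m3 \<le> real m1 + 1" using True by linarith
  ultimately show ?thesis by simp
next
  case False
  define s where "s = m2 + m3 - m1 - 1"
  have s: "real s = real m2 + real m3 - real m1 - 1" using False by (simp add: s_def)
  let ?T = "{(j, k). j < m2 \<and> k < m3 \<and> m1 \<le> j + k}"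
  let ?f = "\<lambda>(j, k). (m2 - 1 - j, m2 + m3 - 1 - j - k)"
  have inj: "inj_on ?f ?T" by (auto simp: inj_on_def)
  have "?f ` ?T \<subseteq> {(j, k). j < k \<and> k < s + 1}" by (auto simp: s_def)
  with inj have T: "card ?T \<le> card {(j, k). j < k \<and> k < s + 1}"
    by (rule card_inj_on_le) (rule card_pairs_less)
  have fin: "finite ?S" "finite ?T" by (rule finite_subset[of _ "{..<m2} \<times> {..<m3}"]; auto)+
  have "?S \<union> ?T = {..<m2} \<times> {..<m3}" "?S \<inter> ?T = {}" by auto
  hence "card ?S + card ?T = m2 * m3"
    using card_Un_disjoint[OF fin] by simp
  hence "real (card ?S) + real (card ?T) = real m2 * real m3"
    by (simp only: of_nat_add[symmetric] of_nat_mult[symmetric])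
  moreover have "real (card ?T) \<le> 1 / 2 * (real m2 + real m3 - real m1) * (real m2 + real m3 - real m1 - 1)"
  proof -
    have "real (card ?T) \<le> real (s + 1) * (real (s + 1) - 1) / 2"
      using T card_pairs_less(2)[of "s + 1"] by linarith
    also have "real (s + 1) = real m2 + real m3 - real m1" using s by simp
    finally show ?thesis by simp
  qed
  moreover have "\<not> real m2 + real m3 \<le> real m1 + 1" using False by linarith
  ultimately show ?thesis by (simp only: if_False)
qed

lemma count_list_triple_le:
  fixes f :: "'x \<Rightarrow> nat"
  assumes "x = y \<longrightarrow> 2 \<le> f y" "y = w \<longrightarrow> 2 \<le> f w" "x = y \<and> y = w \<longrightarrow> 3 \<le> f w"
    and "1 \<le> f x" "1 \<le> f y" "1 \<le> f w" "x = w \<longrightarrow> x = y"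
  shows "\<forall>u\<in>{x, y, w}. count_list [x, y, w] u \<le> f u"
proof -
  consider "x = y" "y = w" | "x = y" "y \<noteq> w" | "x \<noteq> y" "y = w" | "x \<noteq> y" "y \<noteq> w" "x \<noteq> w"
    using assms(7) by blast
  thus ?thesis
  proof cases
    case 1
    with assms(3) show ?thesis by simp
  next
    case 2
    with assms(1,6) show ?thesis by simp
  next
    case 3
    with assms(2,4) show ?thesis by auto
  next
    case 4
    with assms(4-6) show ?thesis by auto
  qed
qed

text \<open>Indices in the case of the blocks \<open>(i, l)\<close>, and the lexicographic order of these blocks.\<close>

type_synonym index = "(nat \<times> nat) \<times> nat"

fun block_less :: "nat \<times> nat \<Rightarrow> nat \<times> nat \<Rightarrow> bool" where
  "block_less (i, l) (i', l') \<longleftrightarrow> i < i' \<or> i = i' \<and> l < l'"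

text \<open>The Jordan blocks of \<open>t\<close> on \<open>\<complex> \<otimes> A\<close>.\<close>

locale blocks_of_decomposition =
  fixes q :: nat and m r :: "nat \<Rightarrow> nat" and z :: "nat \<Rightarrow> nat \<Rightarrow> complex"
  assumes m_pos: "i \<in> {1..q} \<Longrightarrow> 1 \<le> m i"
    and m_antimono: "i \<in> {1..q} \<Longrightarrow> j \<in> {1..q} \<Longrightarrow> i \<le> j \<Longrightarrow> m j \<le> m i"
    and z_nonzero: "i \<in> {1..q} \<Longrightarrow> l \<in> {1..r i} \<Longrightarrow> z i l \<noteq> 0"
begin

definition "block_set = (SIGMA i:{1..q}. {1..r i})"

lemma mem_block_set: "(i, l) \<in> block_set \<longleftrightarrow> i \<in> {1..q} \<and> l \<in> {1..r i}"
  by (simp add: block_set_def)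

sublocale jordan_blocks block_set block_less "\<lambda>(i, l). z i l" "\<lambda>(i, l). m i"
  by unfold_locales (auto simp: block_set_def z_nonzero)

text \<open>The blocks of a triple of indices, in the format of \<open>Xi\<close>.\<close>

definition xi :: "index \<times> index \<times> index \<Rightarrow>
    (nat \<times> nat \<times> nat) \<times> (nat \<times> nat \<times> nat)" where
  "xi = (\<lambda>(((i1, l1), _), ((i2, l2), _), ((i3, l3), _)). ((i1, i2, i3), (l1, l2, l3)))"

lemma finite_Xi: "finite (Xi q m r z)"
proof -
  define R where "R = Max (insert 0 (r ` {1..q}))"
  have R: "l \<le> R" if "1 \<le> i" "i \<le> q" "l \<le> r i" for i l
    using that by (intro order_trans[OF that(3)]) (auto simp: R_def intro!: Max_ge)
  have "Xi q m r z \<subseteq> ({..q} \<times> {..q} \<times> {..q}) \<times> ({..R} \<times> {..R} \<times> {..R})"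
  proof
    fix \<xi> assume "\<xi> \<in> Xi q m r z"
    then obtain i1 i2 i3 l1 l2 l3 where "\<xi> = ((i1, i2, i3), (l1, l2, l3))" "1 \<le> i1" "i1 \<le> i2" "i2 \<le> i3" "i3 \<le> q"
      "l1 \<le> r i1" "l2 \<le> r i2" "l3 \<le> r i3" unfolding Xi_def by auto
    thus "\<xi> \<in> ({..q} \<times> {..q} \<times> {..q}) \<times> ({..R} \<times> {..R} \<times> {..R})"
      using R[of i1 l1] R[of i2 l2] R[of i3 l3] by auto
  qed
  thus ?thesis by (rule finite_subset) simp
qed

lemma xi_in_Xi:
  assumes "p \<in> Inc" "weight p = 1"
  shows "xi p \<in> Xi q m r z"
proof -
  obtain i1 l1 k1 i2 l2 k2 i3 l3 k3 where p: "p = (((i1, l1), k1), ((i2, l2), k2), ((i3, l3), k3))"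
  proof (rule that)
    show "p = (((fst (fst (fst p)), snd (fst (fst p))), snd (fst p)),
        ((fst (fst (fst (snd p))), snd (fst (fst (snd p)))), snd (fst (snd p))),
        ((fst (fst (snd (snd p))), snd (fst (snd (snd p)))), snd (snd (snd p))))" by simp
  qed
  have inc: "1 \<le> i1" "i1 \<le> q" "1 \<le> i2" "i2 \<le> q" "1 \<le> i3" "i3 \<le> q"
    "l1 \<in> {1..r i1}" "l2 \<in> {1..r i2}" "l3 \<in> {1..r i3}" "k1 < m i1" "k2 < m i2" "k3 < m i3"
    "i1 < i2 \<or> i1 = i2 \<and> l1 < l2 \<or> i1 = i2 \<and> l1 = l2 \<and> k1 < k2"
    "i2 < i3 \<or> i2 = i3 \<and> l2 < l3 \<or> i2 = i3 \<and> l2 = l3 \<and> k2 < k3"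
    using assms(1)[unfolded p Inc_iff] by (simp_all add: mem_block_set)
  have order: "i1 \<le> i2" "i2 \<le> i3" "i1 = i2 \<longrightarrow> l1 \<le> l2" "i2 = i3 \<longrightarrow> l2 \<le> l3"
    "i1 = i3 \<and> l1 = l3 \<longrightarrow> i1 = i2 \<and> l1 = l2"
    using inc(13,14) by linarith+
  have mult1: "i1 = i2 \<and> l1 = l2 \<longrightarrow> 2 \<le> m i2"
    using inc(11,13) by (intro impI) linarith
  have mult2: "i2 = i3 \<and> l2 = l3 \<longrightarrow> 2 \<le> m i3"
    using inc(12,14) by (intro impI) linarith
  have mult3: "i1 = i2 \<and> l1 = l2 \<and> i2 = i3 \<and> l2 = l3 \<longrightarrow> 3 \<le> m i3"
    using inc(12,13,14) by (intro impI) linarith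
  have pos: "1 \<le> m i1" "1 \<le> m i2" "1 \<le> m i3"
    using inc(10-12) by linarith+
  have count: "\<forall>(i, l)\<in>{(i1, l1), (i2, l2), (i3, l3)}. count_list [(i1, l1), (i2, l2), (i3, l3)] (i, l) \<le> m i"
  proof (rule ballI)
    fix u assume u: "u \<in> {(i1, l1), (i2, l2), (i3, l3)}"
    have "\<forall>u\<in>{(i1, l1), (i2, l2), (i3, l3)}. count_list [(i1, l1), (i2, l2), (i3, l3)] u \<le> (\<lambda>u. m (fst u)) u"
      by (rule count_list_triple_le; unfold prod.inject fst_conv conj_assoc)
        (fact mult1 mult2 mult3 pos order(5))+
    hence "count_list [(i1, l1), (i2, l2), (i3, l3)] u \<le> m (fst u)" using u by (rule bspec)
    thus "case u of (i, l) \<Rightarrow> count_list [(i1, l1), (i2, l2), (i3, l3)] (i, l) \<le> m i"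
      by (cases u) (simp only: prod.case fst_conv)
  qed
  have "z i1 l1 * z i2 l2 * z i3 l3 = 1" using assms(2) by (simp add: p weight_def)
  thus ?thesis using inc(1,6-9) order(1-4) count unfolding p xi_def Xi_def by simp
qed

lemma XiD:
  assumes "((i1, i2, i3), (l1, l2, l3)) \<in> Xi q m r z"
  shows "(i1, l1) \<in> block_set" "(i2, l2) \<in> block_set" "(i3, l3) \<in> block_set"
    "(i1, l1) = (i2, l2) \<or> block_less (i1, l1) (i2, l2)" "(i2, l2) = (i3, l3) \<or> block_less (i2, l2) (i3, l3)"
    "z i1 l1 * z i2 l2 * z i3 l3 = 1"
    "(i1, l1) = (i2, l2) \<Longrightarrow> 2 \<le> m i1" "(i2, l2) = (i3, l3) \<Longrightarrow> 2 \<le> m i2"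
    "(i1, l1) = (i2, l2) \<Longrightarrow> (i2, l2) = (i3, l3) \<Longrightarrow> 3 \<le> m i1"
    "m i2 \<le> m i1" "m i3 \<le> m i2" "1 \<le> m i3"
proof -
  note * = assms[unfolded Xi_def]
  show "(i1, l1) \<in> block_set" "(i2, l2) \<in> block_set" "(i3, l3) \<in> block_set"
    "(i1, l1) = (i2, l2) \<or> block_less (i1, l1) (i2, l2)" "(i2, l2) = (i3, l3) \<or> block_less (i2, l2) (i3, l3)"
    "z i1 l1 * z i2 l2 * z i3 l3 = 1"
    using * by (auto simp: block_set_def)
  show "(i1, l1) = (i2, l2) \<Longrightarrow> 2 \<le> m i1" "(i2, l2) = (i3, l3) \<Longrightarrow> 2 \<le> m i2"
    "(i1, l1) = (i2, l2) \<Longrightarrow> (i2, l2) = (i3, l3) \<Longrightarrow> 3 \<le> m i1"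
    using * by (auto split: if_splits)
  show "m i2 \<le> m i1" "m i3 \<le> m i2" using * by (auto intro: m_antimono)
  show "1 \<le> m i3" using * by (intro m_pos) auto
qed

lemma card_Bottom_le: "real (card Bottom) \<le> (\<Sum>\<xi>\<in>Xi q m r z. upper_bound m \<xi>)"
proof -
  define bot where "bot \<xi> = {p \<in> Bottom. xi p = \<xi>}" for \<xi>
  have fin: "finite (bot \<xi>)" for \<xi>
    by (rule finite_subset[OF _ finite_Inc]) (auto simp: bot_def Bottom_def)
  have bound: "real (card (bot \<xi>)) \<le> upper_bound m \<xi>" if \<xi>: "\<xi> \<in> Xi q m r z" for \<xi>
  proof -
    obtain i1 i2 i3 l1 l2 l3 where \<xi>_eq: "\<xi> = ((i1, i2, i3), (l1, l2, l3))"
      by (cases \<xi> rule: prod.exhaust) (metis prod_cases3)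
    note X = XiD[OF \<xi>[unfolded \<xi>_eq]]
    let ?b1 = "(i1, l1)" and ?b2 = "(i2, l2)" and ?b3 = "(i3, l3)"
    let ?f = "\<lambda>(j, k). ((?b1, 0::nat), (?b2, j::nat), (?b3, k::nat))"
    have le: "card (bot \<xi>) \<le> card S" if "finite S"
      "\<And>j k. ((?b1, 0), (?b2, j), (?b3, k)) \<in> Inc \<Longrightarrow> (j, k) \<in> S" for S
    proof -
      have "bot \<xi> \<subseteq> ?f ` S"
        using that(2) by (force simp: bot_def Bottom_def \<xi>_eq xi_def)
      hence "card (bot \<xi>) \<le> card (?f ` S)" using that(1) by (intro card_mono) auto
      also have "\<dots> \<le> card S" by (rule card_image_le[OF that(1)])
      finally show ?thesis .
    qed
    have irr: "\<not> block_less b b" for b by (cases b) auto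
    consider (distinct) "?b1 \<noteq> ?b2" "?b2 \<noteq> ?b3" "?b1 \<noteq> ?b3" | (first) "?b1 = ?b2" "?b2 \<noteq> ?b3"
      | (last) "?b1 \<noteq> ?b2" "?b2 = ?b3" | (all) "?b1 = ?b2" "?b2 = ?b3"
      using X(4,5) by auto
    thus ?thesis
    proof cases
      case distinct
      have "card (bot \<xi>) \<le> card ({..<m i2} \<times> {..<m i3})"
        by (rule le) (auto simp: Inc_iff)
      hence "real (card (bot \<xi>)) \<le> real (m i2 * m i3)" by (simp only: of_nat_le_iff card_cartesian_product card_lessThan)
      thus ?thesis using distinct unfolding \<xi>_eq by (auto simp: Let_def)
    next
      case first
      have "card (bot \<xi>) \<le> card ({1..<m i1} \<times> {..<m i3})"
        by (rule le) (use first irr in \<open>auto simp: Inc_iff\<close>)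
      hence "card (bot \<xi>) \<le> m i3 * (m i1 - 1)" by (simp add: mult.commute)
      hence "real (card (bot \<xi>)) \<le> real (m i3 * (m i1 - 1))" by (simp only: of_nat_le_iff)
      thus ?thesis using first X(7)[OF first(1)] unfolding \<xi>_eq by (auto simp: Let_def of_nat_diff)
    next
      case last
      have "card (bot \<xi>) \<le> card {(j, k). j < k \<and> k < m i2}"
        by (rule le[OF card_pairs_less(1)]) (use last irr in \<open>auto simp: Inc_iff\<close>)
      hence "real (card (bot \<xi>)) \<le> real (m i2) * (real (m i2) - 1) / 2"
        by (simp flip: card_pairs_less(2))
      thus ?thesis using last unfolding \<xi>_eq by (auto simp: Let_def)
    next
      case all
      have 1: "1 \<le> m i1" using X(7) all by simp
      have "card (bot \<xi>) \<le> card {(j, k). 0 < j \<and> j < k \<and> k < m i1}"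
        by (rule le[OF card_pairs_positive_less(1)[OF 1]]) (use all irr in \<open>auto simp: Inc_iff\<close>)
      hence "real (card (bot \<xi>)) \<le> (real (m i1) - 1) * (real (m i1) - 2) / 2"
        by (simp flip: card_pairs_positive_less(2)[OF 1])
      thus ?thesis using all unfolding \<xi>_eq by (auto simp: Let_def)
    qed
  qed
  have "Bottom = (\<Union>\<xi>\<in>Xi q m r z. bot \<xi>)"
    using xi_in_Xi by (auto simp: bot_def Bottom_def)
  hence "card Bottom \<le> (\<Sum>\<xi>\<in>Xi q m r z. card (bot \<xi>))"
    using card_UN_le[OF finite_Xi, of bot] by simp
  hence "real (card Bottom) \<le> (\<Sum>\<xi>\<in>Xi q m r z. real (card (bot \<xi>)))"
    by (simp only: of_nat_sum[symmetric] of_nat_le_iff)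
  also have "\<dots> \<le> (\<Sum>\<xi>\<in>Xi q m r z. upper_bound m \<xi>)"
    by (rule sum_mono) (rule bound)
  finally show ?thesis .
qed

text \<open>The degrees up to which invariant arrays are sought. If blocks coincide, this is the lowest degree
  of a strictly increasing triple of indices in these blocks: 1 for two equal blocks, and \<open>0 + 1 + 2\<close> for
  three.\<close>

fun top_degree :: "(nat \<times> nat) \<times> (nat \<times> nat) \<times> (nat \<times> nat) \<Rightarrow> nat" where
  "top_degree (b1, b2, b3) =
     (if distinct [b1, b2, b3] then m (fst b1) - 1 else if b1 = b2 \<and> b2 = b3 then 3 else 1)"

text \<open>Their number is the number of unknowns minus the number of equations for the arrays of weight 1
  supported in degrees up to \<open>top_degree\<close>.\<close>

definition Top :: "(index \<times> index \<times> index) set" where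
  "Top = {p \<in> Inc. weight p = 1 \<and> deg p = top_degree (blocks p)}"

lemma card_Top_ge: "(\<Sum>\<xi>\<in>Xi q m r z. lower_bound m \<xi>) \<le> real (card Top)"
proof -
  define top where "top \<xi> = {p \<in> Top. xi p = \<xi>}" for \<xi>
  have finT: "finite Top" by (rule finite_subset[OF _ finite_Inc]) (auto simp: Top_def)
  have fin: "finite (top \<xi>)" for \<xi> using finT by (simp add: top_def)
  have bound: "lower_bound m \<xi> \<le> real (card (top \<xi>))" if \<xi>: "\<xi> \<in> Xi q m r z" for \<xi>
  proof -
    obtain i1 i2 i3 l1 l2 l3 where \<xi>_eq: "\<xi> = ((i1, i2, i3), (l1, l2, l3))"
      by (cases \<xi> rule: prod.exhaust) (metis prod_cases3)
    note X = XiD[OF \<xi>[unfolded \<xi>_eq]]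
    let ?b1 = "(i1, l1)" and ?b2 = "(i2, l2)" and ?b3 = "(i3, l3)"
    show ?thesis
    proof (cases "distinct [?b1, ?b2, ?b3]")
      case True
      let ?S = "{(j, k). j < m i2 \<and> k < m i3 \<and> j + k < m i1}"
      let ?f = "\<lambda>(j, k). ((?b1, m i1 - 1 - (j + k)), (?b2, j), (?b3, k))"
      have inj: "inj_on ?f ?S" by (auto simp: inj_on_def)
      have "?f ` ?S \<subseteq> top \<xi>"
        using X True
        by (auto simp: top_def Top_def Inc_iff weight_def deg_def blocks_def xi_def \<xi>_eq)
      with inj have "card ?S \<le> card (top \<xi>)" using fin by (rule card_inj_on_le)
      moreover note card_truncated_rectangle[OF X(10,11,12)]
      moreover have "lower_bound m \<xi> = (if real (m i2) + real (m i3) \<le> real (m i1) + 1 then real (m i2) * real (m i3)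
           else real (m i2) * real (m i3) - 1 / 2 * (real (m i2) + real (m i3) - real (m i1)) *
             (real (m i2) + real (m i3) - real (m i1) - 1))"
        using True by (simp add: \<xi>_eq Let_def)
      ultimately show ?thesis by linarith
    next
      case False
      have irr: "\<not> block_less b b" for b by (cases b) auto
      consider (first) "?b1 = ?b2" "?b2 \<noteq> ?b3" | (last) "?b1 \<noteq> ?b2" "?b2 = ?b3" | (all) "?b1 = ?b2" "?b2 = ?b3"
        using False X(4,5) by auto
      hence "\<exists>p. p \<in> top \<xi>"
      proof cases
        case first
        have "((?b1, 0), (?b2, 1), (?b3, 0)) \<in> Inc"
          unfolding Inc_iff using X(1-3) X(5,12) first X(7)[OF first(1)] by auto
        hence "((?b1, 0), (?b2, 1), (?b3, 0)) \<in> top \<xi>"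
          using X(6) first by (simp add: top_def Top_def weight_def deg_def blocks_def xi_def \<xi>_eq)
        thus ?thesis ..
      next
        case last
        have "((?b1, 0), (?b2, 0), (?b3, 1)) \<in> Inc"
          unfolding Inc_iff using X(1-3) X(4,10,11,12) last X(8)[OF last(2)] by auto
        hence "((?b1, 0), (?b2, 0), (?b3, 1)) \<in> top \<xi>"
          using X(6) last by (simp add: top_def Top_def weight_def deg_def blocks_def xi_def \<xi>_eq)
        thus ?thesis ..
      next
        case all
        have "((?b1, 0), (?b2, 1), (?b3, 2)) \<in> Inc"
          unfolding Inc_iff using X(1-3) all X(9)[OF all] by auto
        hence "((?b1, 0), (?b2, 1), (?b3, 2)) \<in> top \<xi>"
          using X(6) all by (simp add: top_def Top_def weight_def deg_def blocks_def xi_def \<xi>_eq)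
        thus ?thesis ..
      qed
      hence "top \<xi> \<noteq> {}" by blast
      hence "1 \<le> card (top \<xi>)" using fin[of \<xi>] by (simp add: Suc_le_eq card_gt_0_iff)
      moreover have "lower_bound m \<xi> = 1" using False by (simp only: \<xi>_eq lower_bound.simps Let_def if_False)
      ultimately show ?thesis by simp
    qed
  qed
  have "(\<Sum>\<xi>\<in>Xi q m r z. lower_bound m \<xi>) \<le> (\<Sum>\<xi>\<in>Xi q m r z. real (card (top \<xi>)))"
    by (rule sum_mono) (rule bound)
  also have "\<dots> = real (card (\<Union>\<xi>\<in>Xi q m r z. top \<xi>))"
    by (subst card_UN_disjoint[OF finite_Xi]) (use fin in \<open>auto simp: top_def\<close>)
  also have "\<dots> \<le> real (card Top)"
    using finT by (intro of_nat_mono card_mono) (auto simp: top_def)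
  finally show ?thesis .
qed

end

section \<open>Taylor coefficients of Laurent polynomials\<close>

lemma poly_mapping_add_induct [case_names single add]:
  fixes c :: "'x \<Rightarrow>\<^sub>0 'k::comm_monoid_add"
  assumes "\<And>k v. P (Poly_Mapping.single k v)" "\<And>f g. P f \<Longrightarrow> P g \<Longrightarrow> P (f + g)"
  shows "P c"
proof -
  have "P 0" using assms(1)[of undefined 0] by simp
  hence "P (\<Sum>k\<in>K. Poly_Mapping.single k (v k))" for K v
    by (induction K rule: infinite_finite_induct) (auto intro: assms)
  from this[of "Poly_Mapping.lookup c" "Poly_Mapping.keys c"] show ?thesis
    by (simp only: poly_mapping_sum_singles[symmetric])
qed

text \<open>The coefficient of \<open>(t - z)\<^sup>k\<close> in the Taylor expansion of a Laurent polynomial at \<open>z \<noteq> 0\<close>.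
  Generalized binomial coefficients provide for the negative powers of \<open>t\<close>.\<close>

definition taylor :: "complex \<Rightarrow> nat \<Rightarrow> laurent \<Rightarrow> complex" where
  "taylor z k = free_functional (\<lambda>j. (of_int j gchoose k) * z powi (j - int k))"

lemma taylor_add: "taylor z k (P + Q) = taylor z k P + taylor z k Q"
  by (simp add: taylor_def free_functional_add)

lemma taylor_single: "taylor z k (Poly_Mapping.single j q) = of_rat q * ((of_int j gchoose k) * z powi (j - int k))"
  by (simp add: taylor_def free_functional_single)

lemma taylor_0 [simp]: "taylor z k 0 = 0"
  using taylor_single[of z k 0 0] by simp

lemma taylor_minus: "taylor z k (P - Q) = taylor z k P - taylor z k Q"
  using taylor_add[of z k "P - Q" Q] by simp

lemma taylor_mult:
  assumes z: "z \<noteq> 0"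
  shows "taylor z k (P * Q) = (\<Sum>a\<le>k. taylor z a P * taylor z (k - a) Q)"
proof (induction P rule: poly_mapping_add_induct)
  case (add f g)
  thus ?case by (simp add: distrib_right taylor_add sum.distrib)
next
  case (single i p)
  show ?case
  proof (induction Q rule: poly_mapping_add_induct)
    case (add f g)
    thus ?case by (simp add: distrib_left taylor_add sum.distrib)
  next
    case (single j q)
    have "taylor z a (Poly_Mapping.single i p) * taylor z (k - a) (Poly_Mapping.single j q) =
        of_rat (p * q) * z powi (i + j - int k) * ((of_int i gchoose a) * (of_int j gchoose (k - a)))" if "a \<le> k" for a
    proof -
      have "z powi (i - int a) * z powi (j - int (k - a)) = z powi (i + j - int k)"
        using z that by (simp add: power_int_add[symmetric] of_nat_diff add_diff_eq)
      thus ?thesis by (simp add: taylor_single of_rat_mult mult_ac)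
    qed
    hence "(\<Sum>a\<le>k. taylor z a (Poly_Mapping.single i p) * taylor z (k - a) (Poly_Mapping.single j q)) =
        of_rat (p * q) * z powi (i + j - int k) * (\<Sum>a\<le>k. (of_int i gchoose a) * (of_int j gchoose (k - a)))"
      by (simp add: sum_distrib_left)
    also have "(\<Sum>a\<le>k. (of_int i gchoose a) * (of_int j gchoose (k - a))) = ((of_int i + of_int j :: complex) gchoose k)"
      using gbinomial_Vandermonde[of "of_int i :: complex" "of_int j" k] by (simp add: atMost_atLeast0)
    finally show ?case by (simp add: mult_single taylor_single mult_ac)
  qed
qed

lemma taylor_const: "taylor z k (Poly_Mapping.single 0 q) = (if k = 0 then of_rat q else 0)"
  by (simp add: taylor_single gbinomial_0_left)

lemma taylor_one: "taylor z k 1 = (if k = 0 then 1 else 0)"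
  using taylor_const[of z k 1] unfolding single_one by simp

lemma taylor_smult:
  assumes "z \<noteq> 0"
  shows "taylor z k (Poly_Mapping.single 0 q * P) = of_rat q * taylor z k P"
proof -
  have "taylor z k (Poly_Mapping.single 0 q * P) = (\<Sum>a\<le>k. if a = 0 then of_rat q * taylor z k P else 0)"
    unfolding taylor_mult[OF assms] by (rule sum.cong) (auto simp: taylor_const)
  thus ?thesis by simp
qed

lemma taylor_tvar: "taylor z a tvar = (if a = 0 then z else if a = 1 then 1 else 0)"
proof -
  have "(1 :: complex) gchoose a = 0" if "a > 1"
  proof -
    have "((1::complex) gchoose a) = of_nat (1 choose a)" using binomial_gbinomial[of 1 a, where 'a = complex] by simp
    also have "1 choose a = 0" using that by (rule binomial_eq_0)
    finally show ?thesis by simp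
  qed
  thus ?thesis by (auto simp: tvar_def taylor_single)
qed

lemma taylor_tvar_mult:
  assumes "z \<noteq> 0"
  shows "taylor z k (tvar * P) = z * taylor z k P + (if k = 0 then 0 else taylor z (k - 1) P)"
proof (cases k)
  case 0
  thus ?thesis by (simp add: taylor_mult[OF assms] taylor_tvar)
next
  case (Suc n)
  have "taylor z k (tvar * P) = (\<Sum>a\<in>{0, 1}. taylor z a tvar * taylor z (k - a) P)"
    unfolding taylor_mult[OF assms] by (rule sum.mono_neutral_right) (auto simp: Suc taylor_tvar)
  thus ?thesis by (simp add: Suc taylor_tvar)
qed

lemma taylor_power_eq_0:
  assumes z: "z \<noteq> 0" and P: "taylor z 0 P = 0" and k: "k < m"
  shows "taylor z k (P ^ m) = 0"
  using k
proof (induction m arbitrary: k)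
  case (Suc m)
  have "taylor z a P * taylor z (k - a) (P ^ m) = 0" if "a \<le> k" for a
    using P Suc.IH[of "k - a"] Suc.prems that by (cases "a = 0") auto
  thus ?case unfolding power_Suc taylor_mult[OF z] by (intro sum.neutral) auto
qed simp

lemma taylor_dvd_eq_0:
  assumes z: "z \<noteq> 0" and P: "taylor z 0 P = 0" and k: "k < m" and dvd: "P ^ m dvd Q"
  shows "taylor z k Q = 0"
proof -
  obtain R where "Q = P ^ m * R" using dvd by (auto elim: dvdE)
  moreover have "taylor z a (P ^ m) = 0" if "a \<le> k" for a
    using taylor_power_eq_0[OF z P] that k by simp
  ultimately show ?thesis by (simp add: taylor_mult[OF z])
qed

lemma sum_shift_index:
  fixes c g :: "nat \<Rightarrow> complex"
  assumes "c n = 0"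
  shows "(\<Sum>k<n. c k * (if k = 0 then 0 else g (k - 1))) = (\<Sum>k<n. c (Suc k) * g k)"
proof (cases n)
  case (Suc n')
  have "(\<Sum>k<n. c k * (if k = 0 then 0 else g (k - 1))) = (\<Sum>k<n'. c (Suc k) * g k)"
    unfolding Suc by (subst sum.lessThan_Suc_shift) simp
  also have "\<dots> = (\<Sum>k<n. c (Suc k) * g k)" using assms by (simp add: Suc)
  finally show ?thesis .
qed simp

lemma taylor_tvar_sum:
  assumes "z \<noteq> 0" "c n = 0"
  shows "(\<Sum>k<n. c k * taylor z k (tvar * P)) = (\<Sum>k<n. (z * c k + c (Suc k)) * taylor z k P)"
proof -
  have "(\<Sum>k<n. c k * taylor z k (tvar * P)) =
      (\<Sum>k<n. z * c k * taylor z k P) + (\<Sum>k<n. c k * (if k = 0 then 0 else taylor z (k - 1) P))"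
    unfolding sum.distrib[symmetric]
    by (rule sum.cong) (simp_all add: taylor_tvar_mult[OF assms(1)] algebra_simps)
  also have "(\<Sum>k<n. c k * (if k = 0 then 0 else taylor z (k - 1) P)) = (\<Sum>k<n. c (Suc k) * taylor z k P)"
    by (rule sum_shift_index) (rule assms(2))
  finally show ?thesis by (simp add: sum.distrib distrib_right)
qed

text \<open>Taylor coefficients at distinct points are independent. The proof is by induction on the number of
  coefficients in a vanishing combination: replacing \<open>P\<close> by \<open>t P\<close> and subtracting \<open>z l0\<close> times the
  original relation gives a relation with one coefficient less at \<open>l0\<close>.\<close>

lemma taylor_independent:
  fixes c :: "'l \<Rightarrow> nat \<Rightarrow> complex" and z :: "'l \<Rightarrow> complex"
  assumes J: "finite J" and inj: "inj_on z J" and nz: "\<And>l. l \<in> J \<Longrightarrow> z l \<noteq> 0"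
    and supp: "\<And>l k. l \<in> J \<Longrightarrow> f l \<le> k \<Longrightarrow> c l k = 0"
    and rel: "\<And>P. (\<Sum>l\<in>J. \<Sum>k<f l. c l k * taylor (z l) k P) = 0"
    and l: "l \<in> J"
  shows "c l k = 0"
  using supp rel l
proof (induction "\<Sum>l\<in>J. f l" arbitrary: c f l k rule: less_induct)
  case less
  note supp = less.prems(1) and rel = less.prems(2)
  show ?case
  proof (cases "\<forall>l\<in>J. f l = 0")
    case True
    thus ?thesis using supp[OF less.prems(3)] less.prems(3) by simp
  next
    case False
    then obtain l0 where l0: "l0 \<in> J" "f l0 > 0" by blast
    define c' where "c' l k = (z l - z l0) * c l k + c l (Suc k)" for l k
    define f' where "f' = f(l0 := f l0 - 1)"
    have f'_le: "f' l \<le> f l" for l by (simp add: f'_def)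
    have supp': "c' l k = 0" if "l \<in> J" "f' l \<le> k" for l k
      using that supp[of l k] supp[of l "Suc k"] by (cases "l = l0") (auto simp: c'_def f'_def)
    have rel': "(\<Sum>l\<in>J. \<Sum>k<f' l. c' l k * taylor (z l) k P) = 0" for P
    proof -
      have "(\<Sum>k<f' l. c' l k * taylor (z l) k P) =
          (\<Sum>k<f l. c l k * taylor (z l) k (tvar * P)) - z l0 * (\<Sum>k<f l. c l k * taylor (z l) k P)"
        if l: "l \<in> J" for l
      proof -
        have "(\<Sum>k<f' l. c' l k * taylor (z l) k P) = (\<Sum>k<f l. c' l k * taylor (z l) k P)"
          using f'_le supp'[OF l] by (intro sum.mono_neutral_left) auto
        also have "\<dots> = (\<Sum>k<f l. (z l * c l k + c l (Suc k)) * taylor (z l) k P - z l0 * (c l k * taylor (z l) k P))"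
          by (rule sum.cong) (simp_all add: c'_def algebra_simps)
        also have "\<dots> = (\<Sum>k<f l. (z l * c l k + c l (Suc k)) * taylor (z l) k P) - z l0 * (\<Sum>k<f l. c l k * taylor (z l) k P)"
          by (simp only: sum_subtractf sum_distrib_left)
        also have "(\<Sum>k<f l. (z l * c l k + c l (Suc k)) * taylor (z l) k P) = (\<Sum>k<f l. c l k * taylor (z l) k (tvar * P))"
          by (rule taylor_tvar_sum[symmetric]) (use nz[OF l] supp[OF l] in auto)
        finally show ?thesis .
      qed
      hence "(\<Sum>l\<in>J. \<Sum>k<f' l. c' l k * taylor (z l) k P) =
          (\<Sum>l\<in>J. (\<Sum>k<f l. c l k * taylor (z l) k (tvar * P)) - z l0 * (\<Sum>k<f l. c l k * taylor (z l) k P))"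
        by (rule sum.cong[OF refl])
      also have "\<dots> = (\<Sum>l\<in>J. \<Sum>k<f l. c l k * taylor (z l) k (tvar * P)) -
          z l0 * (\<Sum>l\<in>J. \<Sum>k<f l. c l k * taylor (z l) k P)"
        by (simp only: sum_subtractf sum_distrib_left)
      finally show ?thesis by (simp add: rel)
    qed
    have "(\<Sum>l\<in>J. f' l) < (\<Sum>l\<in>J. f l)"
      using J l0 f'_le by (intro sum_strict_mono_ex1) (auto simp: f'_def)
    hence c'0: "c' l k = 0" if "l \<in> J" for l k
      using less.hyps supp' rel' that by blast
    have other: "c l k = 0" if l: "l \<in> J" "l \<noteq> l0" for l k
    proof (induction "f l - k" arbitrary: k)
      case 0
      thus ?case using supp[OF l(1)] by simp
    next
      case (Suc n)
      have "c l (Suc k) = 0" using Suc(1)[of "Suc k"] Suc(2) by simp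
      moreover have "z l \<noteq> z l0" using inj l l0 by (auto dest: inj_onD)
      ultimately show ?case using c'0[OF l(1), of k] by (simp add: c'_def)
    qed
    have higher: "c l0 (Suc k) = 0" for k using c'0[OF l0(1), of k] by (simp add: c'_def)
    have "0 = (\<Sum>l\<in>J. \<Sum>k<f l. c l k * taylor (z l) k 1)" using rel by simp
    also have "\<dots> = (\<Sum>l\<in>J. if l = l0 then c l0 0 else 0)"
    proof (rule sum.cong[OF refl])
      fix l assume l: "l \<in> J"
      show "(\<Sum>k<f l. c l k * taylor (z l) k 1) = (if l = l0 then c l0 0 else 0)"
      proof (cases "l = l0")
        case True
        have "(\<Sum>k<f l0. c l0 k * taylor (z l0) k 1) = (\<Sum>k<f l0. if k = 0 then c l0 0 else 0)"
          by (rule sum.cong) (auto simp: taylor_one)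
        thus ?thesis using True l0 by simp
      qed (use other[OF l] in simp)
    qed
    also have "\<dots> = c l0 0" using J l0 by simp
    finally have "c l0 0 = 0" by simp
    thus ?thesis using other[OF less.prems(3)] higher by (cases "l = l0"; cases k) auto
  qed
qed

section \<open>Reduction of Laurent polynomials modulo a polynomial\<close>

lemma lookup_single_mult:
  fixes P :: "int \<Rightarrow>\<^sub>0 rat"
  shows "Poly_Mapping.lookup (Poly_Mapping.single i a * P) j = a * Poly_Mapping.lookup P (j - i)"
  by (induction P rule: poly_mapping_add_induct)
    (auto simp: mult_single lookup_single distrib_left lookup_add when_def)

lemma lookup_laurent_of_poly:
  "Poly_Mapping.lookup (laurent_of_poly p) j = (if j \<ge> 0 then Polynomial.coeff p (nat j) else 0)"
proof -
  have "Poly_Mapping.lookup (laurent_of_poly p) j =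
      (\<Sum>n\<le>Polynomial.degree p. if j = int n then Polynomial.coeff p n else 0)"
    unfolding laurent_of_poly_def lookup_sum
    by (rule sum.cong) (auto simp: lookup_single when_def)
  also have "\<dots> = (if j \<ge> 0 then Polynomial.coeff p (nat j) else 0)"
  proof (cases "j \<ge> 0")
    case True
    then obtain n where j: "j = int n" using nonneg_int_cases by blast
    thus ?thesis by (auto simp: Polynomial.coeff_eq_0)
  qed auto
  finally show ?thesis .
qed

lemma laurent_of_poly_0 [simp]: "laurent_of_poly 0 = 0"
  by (rule poly_mapping_eqI) (simp add: lookup_laurent_of_poly)

lemma laurent_of_poly_add: "laurent_of_poly (p + q) = laurent_of_poly p + laurent_of_poly q"
  by (rule poly_mapping_eqI) (simp add: lookup_laurent_of_poly lookup_add)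

lemma laurent_of_poly_smult: "laurent_of_poly (Polynomial.smult a p) = Poly_Mapping.single 0 a * laurent_of_poly p"
  by (rule poly_mapping_eqI) (simp add: lookup_laurent_of_poly lookup_single_mult)

lemma laurent_of_poly_pCons: "laurent_of_poly (pCons a p) = Poly_Mapping.single 0 a + tvar * laurent_of_poly p"
proof (rule poly_mapping_eqI)
  fix j
  consider "j < 0" | "j = 0" | n where "j = int (Suc n)"
    by (metis int_cases not_less nat.exhaust of_nat_0 linorder_neqE nonneg_int_cases)
  thus "Poly_Mapping.lookup (laurent_of_poly (pCons a p)) j =
      Poly_Mapping.lookup (Poly_Mapping.single 0 a + tvar * laurent_of_poly p) j"
    by cases (auto simp: tvar_def lookup_add lookup_single_mult lookup_laurent_of_poly lookup_single when_def
        nat_add_distrib)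
qed

lemma laurent_of_poly_mult: "laurent_of_poly (p * q) = laurent_of_poly p * laurent_of_poly q"
  by (induction p)
    (simp_all add: mult_pCons_left laurent_of_poly_add laurent_of_poly_smult laurent_of_poly_pCons distrib_right mult.assoc)

lemma laurent_of_poly_1: "laurent_of_poly 1 = 1"
  using laurent_of_poly_pCons[of 1 0] by (simp add: one_pCons)

lemma laurent_of_poly_power: "laurent_of_poly (p ^ n) = laurent_of_poly p ^ n"
  by (induction n) (simp_all add: laurent_of_poly_1 laurent_of_poly_mult)

lemma taylor_0_laurent_of_poly:
  assumes "z \<noteq> 0"
  shows "taylor z 0 (laurent_of_poly p) = poly (map_poly of_rat p) z"
proof (induction p)
  case (pCons a p)
  have "map_poly of_rat (pCons a p) = pCons (of_rat a :: complex) (map_poly of_rat p)"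
    by (rule map_poly_pCons) simp
  thus ?case using pCons
    by (simp add: laurent_of_poly_pCons taylor_add taylor_const taylor_tvar_mult[OF assms])
qed simp

text \<open>The Laurent polynomials that are congruent to polynomials of degree less than that of \<open>\<delta>\<close> are
  stable under \<open>t\<close> and under its inverse.\<close>

lemma laurent_reduction:
  assumes \<delta>0: "Polynomial.coeff \<delta> 0 \<noteq> 0" and deg: "0 < Polynomial.degree \<delta>"
  shows "\<exists>p. (\<forall>k\<ge>Polynomial.degree \<delta>. Polynomial.coeff p k = 0) \<and> laurent_of_poly \<delta> dvd P - laurent_of_poly p"
    (is "?R P")
proof -
  let ?D = "Polynomial.degree \<delta>"
  have up: "?R (tvar * P)" if R: "?R P" for P
  proof -
    from R obtain p where p: "\<And>k. k \<ge> ?D \<Longrightarrow> Polynomial.coeff p k = 0" "laurent_of_poly \<delta> dvd P - laurent_of_poly p" by blast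
    \<comment> \<open>The multiple of \<open>\<delta>\<close> that cancels the leading term of \<open>t p\<close>.\<close>
    define e where "e = Polynomial.coeff (pCons 0 p) ?D / lead_coeff \<delta>"
    define p' where "p' = pCons 0 p - Polynomial.smult e \<delta>"
    have "\<delta> \<noteq> 0" using \<delta>0 by auto
    have "Polynomial.coeff p' k = 0" if "k \<ge> ?D" for k
    proof (cases "k = ?D")
      case True
      thus ?thesis using \<open>\<delta> \<noteq> 0\<close> by (simp add: p'_def e_def)
    next
      case False
      thus ?thesis using that p(1)[of "k - 1"] by (cases k) (simp_all add: p'_def Polynomial.coeff_eq_0)
    qed
    moreover have "laurent_of_poly \<delta> dvd tvar * P - laurent_of_poly p'"
    proof -
      have "pCons 0 p = p' + Polynomial.smult e \<delta>" by (simp add: p'_def)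
      hence "tvar * laurent_of_poly p = laurent_of_poly p' + Poly_Mapping.single 0 e * laurent_of_poly \<delta>"
        using laurent_of_poly_pCons[of 0 p] by (simp add: laurent_of_poly_add laurent_of_poly_smult)
      hence "tvar * P - laurent_of_poly p' = tvar * (P - laurent_of_poly p) + Poly_Mapping.single 0 e * laurent_of_poly \<delta>"
        by (simp add: algebra_simps)
      thus ?thesis using p(2) by simp
    qed
    ultimately show ?thesis by blast
  qed
  have down: "?R (Poly_Mapping.single (- 1) 1 * P)" if R: "?R P" for P
  proof -
    from R obtain p where p: "\<And>k. k \<ge> ?D \<Longrightarrow> Polynomial.coeff p k = 0" "laurent_of_poly \<delta> dvd P - laurent_of_poly p" by blast
    \<comment> \<open>The multiple of \<open>\<delta>\<close> that cancels the constant term of \<open>p\<close>.\<close>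
    define e where "e = Polynomial.coeff p 0 / Polynomial.coeff \<delta> 0"
    obtain a p' where p': "p - Polynomial.smult e \<delta> = pCons a p'" by (rule pCons_cases)
    have "a = Polynomial.coeff (p - Polynomial.smult e \<delta>) 0" by (simp add: p')
    hence a: "a = 0" using \<delta>0 by (simp add: e_def)
    have "Polynomial.coeff p' k = 0" if "k \<ge> ?D" for k
    proof -
      have "Polynomial.coeff p' k = Polynomial.coeff (p - Polynomial.smult e \<delta>) (Suc k)" by (simp add: p')
      thus ?thesis using that p(1)[of "Suc k"] by (simp add: Polynomial.coeff_eq_0)
    qed
    moreover have "laurent_of_poly \<delta> dvd Poly_Mapping.single (- 1) 1 * P - laurent_of_poly p'"
    proof -
      have inv: "Poly_Mapping.single (- 1) 1 * (tvar * Q) = Q" for Q :: laurent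
        by (simp add: tvar_def mult.assoc[symmetric] mult_single)
      have "p = pCons 0 p' + Polynomial.smult e \<delta>" using p' a by (simp add: algebra_simps)
      hence "laurent_of_poly p = tvar * laurent_of_poly p' + Poly_Mapping.single 0 e * laurent_of_poly \<delta>"
        by (simp add: laurent_of_poly_add laurent_of_poly_smult laurent_of_poly_pCons)
      hence "Poly_Mapping.single (- 1) 1 * laurent_of_poly p =
          laurent_of_poly p' + Poly_Mapping.single (- 1) 1 * (Poly_Mapping.single 0 e * laurent_of_poly \<delta>)"
        by (simp only: distrib_left inv)
      hence "Poly_Mapping.single (- 1) 1 * P - laurent_of_poly p' =
          Poly_Mapping.single (- 1) 1 * (P - laurent_of_poly p) +
          Poly_Mapping.single (- 1) 1 * (Poly_Mapping.single 0 e * laurent_of_poly \<delta>)"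
        by (simp add: algebra_simps)
      also have "laurent_of_poly \<delta> dvd \<dots>" using p(2) by (intro dvd_add dvd_mult) auto
      finally show ?thesis .
    qed
    ultimately show ?thesis by blast
  qed
  have "?R (Poly_Mapping.single j v)" for j v
  proof (induction j rule: int_induct[of _ 0])
    case base
    have "laurent_of_poly [:v:] = Poly_Mapping.single 0 v"
      by (simp add: laurent_of_poly_pCons)
    thus ?case using deg by (intro exI[of _ "[:v:]"]) (auto simp: coeff_pCons split: nat.split)
  next
    case (step1 j)
    have "tvar * Poly_Mapping.single j v = Poly_Mapping.single (j + 1) v"
      by (simp add: tvar_def mult_single add.commute)
    with up[OF step1(2)] show ?case by simp
  next
    case (step2 j)
    have "Poly_Mapping.single (- 1) 1 * Poly_Mapping.single j v = Poly_Mapping.single (j - 1) v"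
      by (simp add: mult_single)
    with down[OF step2(2)] show ?case by simp
  qed
  moreover have "?R (P + Q)" if R: "?R P" "?R Q" for P Q
  proof -
    from R obtain p p' where p: "\<forall>k\<ge>?D. Polynomial.coeff p k = 0" "laurent_of_poly \<delta> dvd P - laurent_of_poly p"
      "\<forall>k\<ge>?D. Polynomial.coeff p' k = 0" "laurent_of_poly \<delta> dvd Q - laurent_of_poly p'" by blast
    have "P + Q - laurent_of_poly (p + p') = (P - laurent_of_poly p) + (Q - laurent_of_poly p')"
      by (simp add: laurent_of_poly_add)
    hence "laurent_of_poly \<delta> dvd P + Q - laurent_of_poly (p + p')"
      using dvd_add[OF p(2,4)] by (simp only:)
    thus ?thesis using p(1,3) by (intro exI[of _ "p + p'"]) simp
  qed
  ultimately show ?thesis by (induction P rule: poly_mapping_add_induct) auto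
qed

section \<open>Powers of prime rational polynomials\<close>

text \<open>A prime rational polynomial is coprime to its derivative, and so has simple complex roots.\<close>

lemma card_roots_prime_power:
  fixes \<pi> :: "rat poly"
  assumes prime: "prime_elem \<pi>" and m: "1 \<le> m"
  shows "card {w :: complex. poly (map_poly of_rat (\<pi> ^ m)) w = 0} * m = Polynomial.degree (\<pi> ^ m)"
    and "{w :: complex. poly (map_poly of_rat (\<pi> ^ m)) w = 0} = {w. poly (map_poly of_rat \<pi>) w = 0}"
    and "0 < Polynomial.degree (\<pi> ^ m)"
proof -
  have hom: "map_poly of_rat (p * q) = map_poly of_rat p * (map_poly of_rat q :: complex poly)" for p q :: "rat poly"
    by (rule poly_eqI) (simp add: coeff_map_poly coeff_mult of_rat_sum of_rat_mult)
  have hom_add: "map_poly of_rat (p + q) = map_poly of_rat p + (map_poly of_rat q :: complex poly)" for p q :: "rat poly"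
    by (rule poly_eqI) (simp add: coeff_map_poly of_rat_add)
  have hom1: "map_poly of_rat (1 :: rat poly) = (1 :: complex poly)"
    by (simp add: one_pCons map_poly_pCons)
  have pow: "map_poly of_rat (p ^ n) = (map_poly of_rat p ^ n :: complex poly)" for p :: "rat poly" and n
    by (induction n) (simp_all add: hom hom1)
  have pderiv: "pderiv (map_poly of_rat p) = (map_poly of_rat (pderiv p) :: complex poly)" for p :: "rat poly"
    by (rule poly_eqI) (simp add: coeff_pderiv coeff_map_poly of_rat_mult of_rat_add)
  let ?P = "map_poly of_rat \<pi> :: complex poly"
  have deg: "Polynomial.degree ?P = Polynomial.degree \<pi>" by (rule degree_map_poly) simp
  have nz: "\<pi> \<noteq> 0" using prime by auto
  have pos: "0 < Polynomial.degree \<pi>"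
  proof (rule ccontr)
    assume "\<not> 0 < Polynomial.degree \<pi>"
    then obtain c where "\<pi> = [:c:]" by (auto elim: degree_eq_zeroE)
    moreover from this nz have "c dvd 1" by (intro dvdI[of _ _ "inverse c"]) simp
    ultimately have "is_unit \<pi>" by (simp add: is_unit_const_poly_iff)
    thus False using prime by auto
  qed
  have rs: "rsquarefree ?P"
    unfolding rsquarefree_roots
  proof (intro allI notI)
    fix w assume w: "poly ?P w = 0 \<and> poly (pderiv ?P) w = 0"
    have irr: "irreducible \<pi>" using prime by (rule prime_elem_imp_irreducible)
    have "coprime \<pi> (pderiv \<pi>)"
    proof (rule prime_elem_imp_coprime[OF prime])
      show "\<not> \<pi> dvd pderiv \<pi>"
      proof
        assume "\<pi> dvd pderiv \<pi>"
        moreover have "pderiv \<pi> \<noteq> 0" using pos by (simp add: pderiv_eq_0_iff)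
        ultimately have "Polynomial.degree \<pi> \<le> Polynomial.degree (pderiv \<pi>)" by (rule dvd_imp_degree_le)
        thus False using pos by (simp add: degree_pderiv)
      qed
    qed
    then obtain u v where "u * \<pi> + v * pderiv \<pi> = 1"
      using bezout_coefficients_fst_snd[of \<pi> "pderiv \<pi>"] by (metis coprime_imp_gcd_eq_1)
    hence "map_poly of_rat u * ?P + map_poly of_rat v * pderiv ?P = (1 :: complex poly)"
      by (metis hom hom_add hom1 pderiv)
    hence "poly (map_poly of_rat u * ?P + map_poly of_rat v * pderiv ?P) w = 1" by simp
    thus False using w by simp
  qed
  have "card {w. poly ?P w = 0} = Polynomial.degree \<pi>"
  proof -
    have "?P \<noteq> 0" using deg pos by auto
    have "Polynomial.degree \<pi> = Polynomial.degree (Polynomial.smult (lead_coeff ?P) (\<Prod>w | poly ?P w = 0. [:- w, 1:]))"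
      by (subst complex_poly_decompose_rsquarefree[OF rs]) (simp add: deg)
    also have "\<dots> = Polynomial.degree (\<Prod>w | poly ?P w = 0. [:- w, 1:])" using \<open>?P \<noteq> 0\<close> by simp
    also have "\<dots> = (\<Sum>w | poly ?P w = 0. Polynomial.degree [:- w, 1:])"
      by (rule degree_prod_eq_sum_degree) simp
    also have "\<dots> = card {w. poly ?P w = 0}" by simp
    finally show ?thesis ..
  qed
  moreover show roots: "{w :: complex. poly (map_poly of_rat (\<pi> ^ m)) w = 0} = {w. poly ?P w = 0}"
    using m by (auto simp: pow)
  moreover have deg_pow: "Polynomial.degree (\<pi> ^ m) = m * Polynomial.degree \<pi>"
    by (rule degree_power_eq[OF nz])
  ultimately show "card {w :: complex. poly (map_poly of_rat (\<pi> ^ m)) w = 0} * m = Polynomial.degree (\<pi> ^ m)"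
    by (simp add: mult.commute)
  show "0 < Polynomial.degree (\<pi> ^ m)" unfolding deg_pow using pos m by simp
qed

section \<open>Coordinates on a decomposed module\<close>

text \<open>A \<open>\<rat>[t\<^sup>\<plusminus>\<^sup>1]\<close>-module with a decomposition into primary cyclic submodules.\<close>

locale decomposed_module = laurent_module A for A :: "(laurent, 'v) module" +
  fixes q :: nat and \<eta> :: "nat \<Rightarrow> 'v" and \<delta> :: "nat \<Rightarrow> rat poly" and m r :: "nat \<Rightarrow> nat"
    and z :: "nat \<Rightarrow> nat \<Rightarrow> complex"
  assumes \<eta>_closed: "i \<in> {1..q} \<Longrightarrow> \<eta> i \<in> carrier A"
    and direct_sum: "bij_betw (\<lambda>x. \<Oplus>\<^bsub>A\<^esub>i\<in>{1..q}. x i) (\<Pi>\<^sub>E i\<in>{1..q}. range (\<lambda>P. P \<odot>\<^bsub>A\<^esub> \<eta> i)) (carrier A)"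
    and annihilator: "i \<in> {1..q} \<Longrightarrow> P \<odot>\<^bsub>A\<^esub> \<eta> i = \<zero>\<^bsub>A\<^esub> \<longleftrightarrow> laurent_of_poly (\<delta> i) dvd P"
    and prime_power: "i \<in> {1..q} \<Longrightarrow> \<exists>\<pi>. prime_elem \<pi> \<and> m i \<ge> 1 \<and> \<delta> i = \<pi> ^ m i"
    and m_decreasing: "i \<in> {1..q} \<Longrightarrow> j \<in> {1..q} \<Longrightarrow> i \<le> j \<Longrightarrow> m j \<le> m i"
    and \<delta>_0: "i \<in> {1..q} \<Longrightarrow> poly (\<delta> i) 0 \<noteq> 0"
    and roots: "i \<in> {1..q} \<Longrightarrow> bij_betw (z i) {1..r i} {w. poly (map_poly of_rat (\<delta> i)) w = 0}"
begin

lemma root_nonzero: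
  assumes i: "i \<in> {1..q}" and l: "l \<in> {1..r i}"
  shows "z i l \<noteq> 0"
proof
  assume "z i l = 0"
  moreover have "poly (map_poly of_rat (\<delta> i)) (z i l) = 0"
    using bij_betwE[OF roots[OF i]] l by auto
  ultimately have "poly (map_poly of_rat (\<delta> i)) (0::complex) = 0" by simp
  hence "poly (\<delta> i) 0 = 0" by (simp add: poly_0_coeff_0 coeff_map_poly)
  thus False using \<delta>_0[OF i] by simp
qed

sublocale blocks_of_decomposition q m r z
proof
  show "1 \<le> m i" if "i \<in> {1..q}" for i using prime_power[OF that] by blast
qed (fact m_decreasing root_nonzero)+

lemma smult_closed [simp]: "x \<in> carrier A \<Longrightarrow> P \<odot>\<^bsub>A\<^esub> x \<in> carrier A"
  using A.smult_closed[of P x] by simp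

lemma smult_eq_imp_diff:
  assumes x: "x \<in> carrier A" and eq: "P \<odot>\<^bsub>A\<^esub> x = Q \<odot>\<^bsub>A\<^esub> x"
  shows "(P - Q) \<odot>\<^bsub>A\<^esub> x = \<zero>\<^bsub>A\<^esub>"
proof -
  have "P \<odot>\<^bsub>A\<^esub> x = (P - Q) \<odot>\<^bsub>A\<^esub> x \<oplus>\<^bsub>A\<^esub> Q \<odot>\<^bsub>A\<^esub> x"
    using A.smult_l_distr[of "P - Q" Q x] x by simp
  hence "(P - Q) \<odot>\<^bsub>A\<^esub> x \<oplus>\<^bsub>A\<^esub> Q \<odot>\<^bsub>A\<^esub> x = \<zero>\<^bsub>A\<^esub> \<oplus>\<^bsub>A\<^esub> Q \<odot>\<^bsub>A\<^esub> x" using eq x by simp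
  thus ?thesis using x A.add.right_cancel[of "Q \<odot>\<^bsub>A\<^esub> x" "(P - Q) \<odot>\<^bsub>A\<^esub> x" "\<zero>\<^bsub>A\<^esub>"] by simp
qed

text \<open>A chosen Laurent polynomial \<open>P\<close> such that \<open>P \<eta> i\<close> is the component of \<open>x\<close> in the submodule generated
  by \<open>\<eta> i\<close>. It is determined, and depends linearly on \<open>x\<close>, only modulo \<open>\<delta> i\<close>.\<close>

definition coord :: "'v \<Rightarrow> nat \<Rightarrow> laurent" where
  "coord x i = (SOME P. inv_into (\<Pi>\<^sub>E i\<in>{1..q}. range (\<lambda>P. P \<odot>\<^bsub>A\<^esub> \<eta> i)) (\<lambda>x. \<Oplus>\<^bsub>A\<^esub>i\<in>{1..q}. x i) x i = P \<odot>\<^bsub>A\<^esub> \<eta> i)"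

lemma coord_sum:
  assumes x: "x \<in> carrier A"
  shows "(\<Oplus>\<^bsub>A\<^esub>i\<in>{1..q}. coord x i \<odot>\<^bsub>A\<^esub> \<eta> i) = x"
proof -
  let ?D = "\<Pi>\<^sub>E i\<in>{1..q}. range (\<lambda>P. P \<odot>\<^bsub>A\<^esub> \<eta> i)" and ?F = "\<lambda>x. \<Oplus>\<^bsub>A\<^esub>i\<in>{1..q}. x i"
  define u where "u = inv_into ?D ?F x"
  have uD: "u \<in> ?D" unfolding u_def using direct_sum x
    by (intro inv_into_into) (simp add: bij_betw_def)
  have Fu: "?F u = x" unfolding u_def using bij_betw_inv_into_right[OF direct_sum x] .
  have "u i = coord x i \<odot>\<^bsub>A\<^esub> \<eta> i" if "i \<in> {1..q}" for i
  proof -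
    have "\<exists>P. u i = P \<odot>\<^bsub>A\<^esub> \<eta> i" using PiE_mem[OF uD that] by blast
    thus ?thesis unfolding coord_def u_def by (rule someI_ex)
  qed
  hence "(\<Oplus>\<^bsub>A\<^esub>i\<in>{1..q}. coord x i \<odot>\<^bsub>A\<^esub> \<eta> i) = ?F u"
    by (intro A.finsum_cong') (use \<eta>_closed in auto)
  thus ?thesis using Fu by simp
qed

lemma coord_unique:
  assumes x: "x = (\<Oplus>\<^bsub>A\<^esub>i\<in>{1..q}. P i \<odot>\<^bsub>A\<^esub> \<eta> i)" and i: "i \<in> {1..q}"
  shows "laurent_of_poly (\<delta> i) dvd coord x i - P i"
proof -
  let ?D = "\<Pi>\<^sub>E i\<in>{1..q}. range (\<lambda>P. P \<odot>\<^bsub>A\<^esub> \<eta> i)" and ?F = "\<lambda>x. \<Oplus>\<^bsub>A\<^esub>i\<in>{1..q}. x i"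
  have xc: "x \<in> carrier A" unfolding x by (rule A.finsum_closed) (use \<eta>_closed in auto)
  define u where "u = (\<lambda>i\<in>{1..q}. P i \<odot>\<^bsub>A\<^esub> \<eta> i)"
  define v where "v = (\<lambda>i\<in>{1..q}. coord x i \<odot>\<^bsub>A\<^esub> \<eta> i)"
  have "u \<in> ?D" "v \<in> ?D" unfolding u_def v_def by auto
  moreover have "?F u = x" unfolding u_def x
    by (rule A.finsum_cong') (use \<eta>_closed in auto)
  moreover have "?F v = (\<Oplus>\<^bsub>A\<^esub>i\<in>{1..q}. coord x i \<odot>\<^bsub>A\<^esub> \<eta> i)" unfolding v_def
    by (rule A.finsum_cong') (use \<eta>_closed in auto)
  ultimately have "u = v"
    using coord_sum[OF xc] direct_sum by (auto simp: bij_betw_def dest: inj_onD)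
  hence "u i = v i" by simp
  hence "coord x i \<odot>\<^bsub>A\<^esub> \<eta> i = P i \<odot>\<^bsub>A\<^esub> \<eta> i" using i by (simp add: u_def v_def)
  thus ?thesis using smult_eq_imp_diff[OF \<eta>_closed[OF i]] annihilator[OF i] by simp
qed

lemma coord_add:
  assumes "x \<in> carrier A" "y \<in> carrier A" "i \<in> {1..q}"
  shows "laurent_of_poly (\<delta> i) dvd coord (x \<oplus>\<^bsub>A\<^esub> y) i - (coord x i + coord y i)"
proof (rule coord_unique[OF _ assms(3)])
  have "(\<Oplus>\<^bsub>A\<^esub>i\<in>{1..q}. (coord x i + coord y i) \<odot>\<^bsub>A\<^esub> \<eta> i) =
      (\<Oplus>\<^bsub>A\<^esub>i\<in>{1..q}. coord x i \<odot>\<^bsub>A\<^esub> \<eta> i \<oplus>\<^bsub>A\<^esub> coord y i \<odot>\<^bsub>A\<^esub> \<eta> i)"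
    by (rule A.finsum_cong') (use \<eta>_closed A.smult_l_distr in auto)
  also have "\<dots> = (\<Oplus>\<^bsub>A\<^esub>i\<in>{1..q}. coord x i \<odot>\<^bsub>A\<^esub> \<eta> i) \<oplus>\<^bsub>A\<^esub> (\<Oplus>\<^bsub>A\<^esub>i\<in>{1..q}. coord y i \<odot>\<^bsub>A\<^esub> \<eta> i)"
    by (rule A.finsum_addf) (use \<eta>_closed in auto)
  finally show "x \<oplus>\<^bsub>A\<^esub> y = (\<Oplus>\<^bsub>A\<^esub>i\<in>{1..q}. (coord x i + coord y i) \<odot>\<^bsub>A\<^esub> \<eta> i)"
    by (simp only: coord_sum[OF assms(1)] coord_sum[OF assms(2)])
qed

lemma coord_smult:
  assumes "x \<in> carrier A" "i \<in> {1..q}"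
  shows "laurent_of_poly (\<delta> i) dvd coord (P \<odot>\<^bsub>A\<^esub> x) i - P * coord x i"
proof (rule coord_unique[OF _ assms(2)])
  have "P \<odot>\<^bsub>A\<^esub> (\<Oplus>\<^bsub>A\<^esub>i\<in>{1..q}. coord x i \<odot>\<^bsub>A\<^esub> \<eta> i) = (\<Oplus>\<^bsub>A\<^esub>i\<in>{1..q}. P \<odot>\<^bsub>A\<^esub> (coord x i \<odot>\<^bsub>A\<^esub> \<eta> i))"
    by (rule A.finsum_smult_ldistr) (use \<eta>_closed in auto)
  also have "\<dots> = (\<Oplus>\<^bsub>A\<^esub>i\<in>{1..q}. (P * coord x i) \<odot>\<^bsub>A\<^esub> \<eta> i)"
    by (rule A.finsum_cong') (use \<eta>_closed A.smult_assoc1 in auto)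
  finally show "P \<odot>\<^bsub>A\<^esub> x = (\<Oplus>\<^bsub>A\<^esub>i\<in>{1..q}. (P * coord x i) \<odot>\<^bsub>A\<^esub> \<eta> i)"
    by (simp only: coord_sum[OF assms(1)])
qed

lemma coord_generator:
  assumes j: "j \<in> {1..q}" and i: "i \<in> {1..q}"
  shows "laurent_of_poly (\<delta> i) dvd coord (P \<odot>\<^bsub>A\<^esub> \<eta> j) i - (if i = j then P else 0)"
proof (rule coord_unique[OF _ i])
  have zero: "0 \<odot>\<^bsub>A\<^esub> \<eta> i = \<zero>\<^bsub>A\<^esub>" if "i \<in> {1..q}" for i
    using annihilator[OF that, of 0] by simp
  have "(\<Oplus>\<^bsub>A\<^esub>i\<in>{1..q}. (if i = j then P else 0) \<odot>\<^bsub>A\<^esub> \<eta> i) =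
      (\<Oplus>\<^bsub>A\<^esub>i\<in>{1..q}. if j = i then P \<odot>\<^bsub>A\<^esub> \<eta> i else \<zero>\<^bsub>A\<^esub>)"
    by (rule A.finsum_cong') (use \<eta>_closed zero in auto)
  also have "\<dots> = P \<odot>\<^bsub>A\<^esub> \<eta> j"
    by (rule A.finsum_singleton[OF j]) (use \<eta>_closed in auto)
  finally show "P \<odot>\<^bsub>A\<^esub> \<eta> j = (\<Oplus>\<^bsub>A\<^esub>i\<in>{1..q}. (if i = j then P else 0) \<odot>\<^bsub>A\<^esub> \<eta> i)" ..
qed

lemma taylor_cong_mod:
  assumes i: "i \<in> {1..q}" and l: "l \<in> {1..r i}" and k: "k < m i"
    and dvd: "laurent_of_poly (\<delta> i) dvd P - Q"
  shows "taylor (z i l) k P = taylor (z i l) k Q"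
proof -
  obtain \<pi> where \<pi>: "prime_elem \<pi>" "m i \<ge> 1" "\<delta> i = \<pi> ^ m i" using prime_power[OF i] by blast
  have "z i l \<in> {w. poly (map_poly of_rat (\<pi> ^ m i)) w = 0}"
    using bij_betwE[OF roots[OF i]] l \<pi>(3) by auto
  hence "poly (map_poly of_rat \<pi>) (z i l) = 0"
    unfolding card_roots_prime_power(2)[OF \<pi>(1,2)] by simp
  hence "taylor (z i l) 0 (laurent_of_poly \<pi>) = 0"
    by (simp add: taylor_0_laurent_of_poly root_nonzero[OF i l])
  moreover have "laurent_of_poly \<pi> ^ m i dvd P - Q"
    using dvd by (simp add: \<pi>(3) laurent_of_poly_power)
  ultimately have "taylor (z i l) k (P - Q) = 0"
    by (intro taylor_dvd_eq_0[OF root_nonzero[OF i l] _ k])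
  thus ?thesis by (simp add: taylor_minus)
qed

text \<open>The functionals given by Taylor coefficients, indexed by \<open>Idx\<close>.\<close>

definition lam :: "(nat \<times> nat) \<times> nat \<Rightarrow> 'v \<Rightarrow> complex" where
  "lam = (\<lambda>((i, l), k) x. taylor (z i l) k (coord x i))"

lemma IdxD:
  assumes "((i, l), k) \<in> Idx"
  shows "i \<in> {1..q}" "l \<in> {1..r i}" "k < m i"
proof -
  have "(i, l) \<in> block_set \<and> k < m i" using assms unfolding Idx_def by simp
  thus "i \<in> {1..q}" "l \<in> {1..r i}" "k < m i" unfolding mem_block_set by auto
qed

lemma lam_functional:
  assumes "\<alpha> \<in> Idx"
  shows "rat_functional V (lam \<alpha>)"
proof -
  obtain i l k where \<alpha>: "\<alpha> = ((i, l), k)" by (metis prod.collapse)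
  note I = IdxD[OF assms[unfolded \<alpha>]]
  show ?thesis
  proof (rule rat_functionalI)
    fix x y assume "x \<in> carrier V" "y \<in> carrier V"
    thus "lam \<alpha> (x \<oplus>\<^bsub>V\<^esub> y) = lam \<alpha> x + lam \<alpha> y"
      using taylor_cong_mod[OF I coord_add[OF _ _ I(1), of x y]] by (simp add: lam_def \<alpha> taylor_add)
  next
    fix a x assume "x \<in> carrier V"
    thus "lam \<alpha> (a \<odot>\<^bsub>V\<^esub> x) = of_rat a * lam \<alpha> x"
      using taylor_cong_mod[OF I coord_smult[OF _ I(1), of x]]
      by (simp add: lam_def \<alpha> taylor_smult[OF root_nonzero[OF I(1,2)]])
  qed
qed

lemma lam_tvar:
  assumes "((i, l), k) \<in> Idx" "x \<in> carrier A"
  shows "lam ((i, l), k) (tvar \<odot>\<^bsub>A\<^esub> x) = z i l * lam ((i, l), k) x + (if k = 0 then 0 else lam ((i, l), k - 1) x)"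
  using taylor_cong_mod[OF IdxD[OF assms(1)] coord_smult[OF assms(2) IdxD(1)[OF assms(1)], of tvar]]
  by (simp add: lam_def taylor_tvar_mult[OF root_nonzero[OF IdxD(1,2)[OF assms(1)]]])

lemma sum_Idx: "(\<Sum>\<alpha>\<in>Idx. h \<alpha>) = (\<Sum>i\<in>{1..q}. \<Sum>l\<in>{1..r i}. \<Sum>k<m i. h ((i, l), k))"
  for h :: "(nat \<times> nat) \<times> nat \<Rightarrow> 'c::comm_monoid_add"
proof -
  have eq: "Idx = (\<lambda>(i, l, k). ((i, l), k)) ` (SIGMA i:{1..q}. SIGMA l:{1..r i}. {..<m i})"
    unfolding Idx_def by (auto simp: block_set_def image_iff)
  have "(\<Sum>\<alpha>\<in>Idx. h \<alpha>) = (\<Sum>(i, l, k)\<in>(SIGMA i:{1..q}. SIGMA l:{1..r i}. {..<m i}). h ((i, l), k))"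
    unfolding eq by (subst sum.reindex) (auto simp: inj_on_def intro!: sum.cong)
  also have "\<dots> = (\<Sum>i\<in>{1..q}. \<Sum>(l, k)\<in>(SIGMA l:{1..r i}. {..<m i}). h ((i, l), k))"
    by (subst sum.Sigma) (auto simp: case_prod_beta)
  also have "\<dots> = (\<Sum>i\<in>{1..q}. \<Sum>l\<in>{1..r i}. \<Sum>k<m i. h ((i, l), k))"
    by (rule sum.cong[OF refl], subst sum.Sigma) auto
  finally show ?thesis .
qed

lemma lam_independent:
  assumes rel: "\<And>x. x \<in> carrier A \<Longrightarrow> (\<Sum>\<alpha>\<in>Idx. c \<alpha> * lam \<alpha> x) = 0" and \<alpha>: "\<alpha> \<in> Idx"
  shows "c \<alpha> = 0"
proof -
  obtain i l k where \<alpha>_eq: "\<alpha> = ((i, l), k)" by (metis prod.collapse)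
  note I = IdxD[OF \<alpha>[unfolded \<alpha>_eq]]
  define c' where "c' l k = (if k < m i then c ((i, l), k) else 0)" for l k
  have "(\<Sum>l\<in>{1..r i}. \<Sum>k<m i. c' l k * taylor (z i l) k P) = 0" for P
  proof -
    let ?x = "P \<odot>\<^bsub>A\<^esub> \<eta> i"
    have "(\<Sum>l\<in>{1..r j}. \<Sum>k<m j. c ((j, l), k) * lam ((j, l), k) ?x) =
       (if j = i then \<Sum>l\<in>{1..r i}. \<Sum>k<m i. c' l k * taylor (z i l) k P else 0)" if j: "j \<in> {1..q}" for j
    proof -
      have "lam ((j, l), k) ?x = taylor (z j l) k (if j = i then P else 0)" if "l \<in> {1..r j}" "k < m j" for l k
        unfolding lam_def prod.case by (rule taylor_cong_mod[OF j that coord_generator[OF I(1) j]])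
      thus ?thesis by (auto simp: c'_def intro!: sum.cong sum.neutral)
    qed
    hence "(\<Sum>\<alpha>\<in>Idx. c \<alpha> * lam \<alpha> ?x) = (\<Sum>j\<in>{1..q}. if j = i then \<Sum>l\<in>{1..r i}. \<Sum>k<m i. c' l k * taylor (z i l) k P else 0)"
      unfolding sum_Idx by (rule sum.cong[OF refl])
    also have "\<dots> = (\<Sum>l\<in>{1..r i}. \<Sum>k<m i. c' l k * taylor (z i l) k P)" using I(1) by simp
    finally show ?thesis using rel[of ?x] \<eta>_closed[OF I(1)] by simp
  qed
  hence "c' l k = 0"
    using taylor_independent[of "{1..r i}" "z i" "\<lambda>_. m i" c'] roots[OF I(1)] root_nonzero[OF I(1)] I(2)
    by (auto simp: bij_betw_def c'_def)
  thus ?thesis using I(3) by (simp add: c'_def \<alpha>_eq)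
qed

text \<open>The elements \<open>t\<^sup>k \<eta> i\<close> with \<open>k\<close> less than the degree of \<open>\<delta> i\<close> span \<open>A\<close> over \<open>\<rat>\<close>.\<close>

definition gens :: "(nat \<times> nat) set" where
  "gens = (SIGMA i:{1..q}. {..<Polynomial.degree (\<delta> i)})"

definition gen :: "nat \<times> nat \<Rightarrow> 'v" where
  "gen = (\<lambda>(i, k). Poly_Mapping.single (int k) 1 \<odot>\<^bsub>A\<^esub> \<eta> i)"

lemma finite_gens: "finite gens"
  by (simp add: gens_def)

lemma gen_closed: "s \<in> gens \<Longrightarrow> gen s \<in> carrier A"
  using \<eta>_closed by (auto simp: gens_def gen_def)

lemma card_gens: "card gens = card Idx"
proof -
  have "Polynomial.degree (\<delta> i) = r i * m i" if i: "i \<in> {1..q}" for i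
  proof -
    obtain \<pi> where \<pi>: "prime_elem \<pi>" "m i \<ge> 1" "\<delta> i = \<pi> ^ m i" using prime_power[OF i] by blast
    have "r i = card {w :: complex. poly (map_poly of_rat (\<delta> i)) w = 0}"
      using bij_betw_same_card[OF roots[OF i]] by simp
    thus ?thesis using card_roots_prime_power(1)[OF \<pi>(1,2)] \<pi>(3) by simp
  qed
  hence "card gens = (\<Sum>i\<in>{1..q}. r i * m i)" by (simp add: gens_def)
  moreover have "card Idx = (\<Sum>i\<in>{1..q}. r i * m i)"
    using sum_Idx[of "\<lambda>_. 1::nat"] by simp
  ultimately show ?thesis by simp
qed

lemma gens_span: "lin_span V (gen ` gens) = carrier A"
proof -
  have G: "gen ` gens \<subseteq> carrier V" using gen_closed by auto
  interpret sp: LinearCombinations.submodule class_ring "V.span (gen ` gens)" V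
    by (rule V.span_is_submodule[OF G])
  have zero: "\<zero>\<^bsub>A\<^esub> \<in> V.span (gen ` gens)" using sp.zero_closed by simp
  have add: "x \<oplus>\<^bsub>A\<^esub> y \<in> V.span (gen ` gens)" if "x \<in> V.span (gen ` gens)" "y \<in> V.span (gen ` gens)" for x y
    using sp.m_closed[OF that] by simp
  have closed: "x \<in> carrier A" if "x \<in> V.span (gen ` gens)" for x
    using that V.span_is_subset2[OF G] by auto
  have single: "P \<odot>\<^bsub>A\<^esub> \<eta> i \<in> V.span (gen ` gens)" if i: "i \<in> {1..q}" for P i
  proof -
    obtain \<pi> where \<pi>: "prime_elem \<pi>" "m i \<ge> 1" "\<delta> i = \<pi> ^ m i" using prime_power[OF i] by blast
    have deg: "0 < Polynomial.degree (\<delta> i)" unfolding \<pi>(3) by (rule card_roots_prime_power(3)[OF \<pi>(1,2)])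
    have c0: "Polynomial.coeff (\<delta> i) 0 \<noteq> 0" using \<delta>_0[OF i] by (simp add: poly_0_coeff_0)
    obtain p where p: "\<And>k. Polynomial.degree (\<delta> i) \<le> k \<Longrightarrow> Polynomial.coeff p k = 0"
      "laurent_of_poly (\<delta> i) dvd P - laurent_of_poly p"
      using laurent_reduction[OF c0 deg, of P] by blast
    have "(P - laurent_of_poly p) \<odot>\<^bsub>A\<^esub> \<eta> i = \<zero>\<^bsub>A\<^esub>" using annihilator[OF i] p(2) by blast
    moreover have "P \<odot>\<^bsub>A\<^esub> \<eta> i = (P - laurent_of_poly p) \<odot>\<^bsub>A\<^esub> \<eta> i \<oplus>\<^bsub>A\<^esub> laurent_of_poly p \<odot>\<^bsub>A\<^esub> \<eta> i"
      using A.smult_l_distr[of "P - laurent_of_poly p" "laurent_of_poly p" "\<eta> i"] \<eta>_closed[OF i] by simp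
    ultimately have P_eq: "P \<odot>\<^bsub>A\<^esub> \<eta> i = laurent_of_poly p \<odot>\<^bsub>A\<^esub> \<eta> i"
      using \<eta>_closed[OF i] by simp
    have monom: "Poly_Mapping.single (int n) (Polynomial.coeff p n) \<odot>\<^bsub>A\<^esub> \<eta> i \<in> V.span (gen ` gens)" for n
    proof (cases "n < Polynomial.degree (\<delta> i)")
      case True
      hence "(i, n) \<in> gens" using i by (simp add: gens_def)
      hence "gen (i, n) \<in> V.span (gen ` gens)" using V.in_own_span[OF G] by blast
      from sp.smult_closed[of "Polynomial.coeff p n", OF _ this]
      have "Poly_Mapping.single 0 (Polynomial.coeff p n) \<odot>\<^bsub>A\<^esub> (Poly_Mapping.single (int n) 1 \<odot>\<^bsub>A\<^esub> \<eta> i) \<in> V.span (gen ` gens)"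
        by (simp add: gen_def)
      also have "Poly_Mapping.single 0 (Polynomial.coeff p n) \<odot>\<^bsub>A\<^esub> (Poly_Mapping.single (int n) 1 \<odot>\<^bsub>A\<^esub> \<eta> i) =
          Poly_Mapping.single (int n) (Polynomial.coeff p n) \<odot>\<^bsub>A\<^esub> \<eta> i"
        using A.smult_assoc1[of "Poly_Mapping.single 0 (Polynomial.coeff p n)" "Poly_Mapping.single (int n) 1" "\<eta> i"] \<eta>_closed[OF i]
        by (simp add: mult_single)
      finally show ?thesis .
    next
      case False
      hence "Poly_Mapping.single (int n) (Polynomial.coeff p n) = 0" using p(1)[of n] by simp
      moreover have "0 \<odot>\<^bsub>A\<^esub> \<eta> i = \<zero>\<^bsub>A\<^esub>" using annihilator[OF i, of 0] by simp
      ultimately show ?thesis using zero by simp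
    qed
    have "(\<Sum>n\<in>N. Poly_Mapping.single (int n) (Polynomial.coeff p n)) \<odot>\<^bsub>A\<^esub> \<eta> i \<in> V.span (gen ` gens)"
      if "finite N" for N
      using that
    proof (induction N)
      case empty
      have "0 \<odot>\<^bsub>A\<^esub> \<eta> i = \<zero>\<^bsub>A\<^esub>" using annihilator[OF i, of 0] by simp
      thus ?case using zero by simp
    next
      case (insert n N)
      thus ?case using add[OF monom[of n] insert.IH] \<eta>_closed[OF i]
        by (simp add: A.smult_l_distr[simplified])
    qed
    thus ?thesis unfolding P_eq laurent_of_poly_def by simp
  qed
  have "x \<in> V.span (gen ` gens)" if x: "x \<in> carrier A" for x
  proof -
    have "(\<Oplus>\<^bsub>A\<^esub>i\<in>N. coord x i \<odot>\<^bsub>A\<^esub> \<eta> i) \<in> V.span (gen ` gens)" if "finite N" "N \<subseteq> {1..q}" for N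
      using that
    proof (induction N)
      case (insert i N)
      have "(\<Oplus>\<^bsub>A\<^esub>i\<in>insert i N. coord x i \<odot>\<^bsub>A\<^esub> \<eta> i) = coord x i \<odot>\<^bsub>A\<^esub> \<eta> i \<oplus>\<^bsub>A\<^esub> (\<Oplus>\<^bsub>A\<^esub>i\<in>N. coord x i \<odot>\<^bsub>A\<^esub> \<eta> i)"
        by (rule A.finsum_insert) (use insert \<eta>_closed in auto)
      thus ?case using insert add single by simp
    qed (use zero in simp)
    from this[OF finite_atLeastAtMost order_refl] show ?thesis unfolding coord_sum[OF x] .
  qed
  thus ?thesis using closed by blast
qed

lemma functional_ext:
  assumes f: "rat_functional V f" and g: "rat_functional V g"
    and eq: "\<And>s. s \<in> gens \<Longrightarrow> f (gen s) = g (gen s)" and x: "x \<in> carrier A"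
  shows "f x = g x"
proof -
  have G: "gen ` gens \<subseteq> carrier V" using gen_closed by auto
  have "rat_functional V (\<lambda>x. f x - g x)"
    using f g by (simp add: rat_functional_def algebra_simps)
  hence "f x - g x = 0"
  proof (rule rat_functional_span_eq_0[OF V.vectorspace_axioms G])
    show "f s - g s = 0" if "s \<in> gen ` gens" for s using that eq by auto
    show "x \<in> V.span (gen ` gens)" using gens_span x by simp
  qed
  thus ?thesis by simp
qed

end

section \<open>Coefficients of trilinear forms\<close>

text \<open>The value of the trilinear form with array of coefficients \<open>C\<close> at vectors given by their
  coordinates.\<close>

definition trilinear_sum :: "'i set \<Rightarrow> ('i \<times> 'i \<times> 'i \<Rightarrow> complex) \<Rightarrow> ('i \<Rightarrow> complex) \<Rightarrow> ('i \<Rightarrow> complex) \<Rightarrow> ('i \<Rightarrow> complex) \<Rightarrow> complex" where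
  "trilinear_sum S C u v w = (\<Sum>(a, b, c)\<in>S \<times> S \<times> S. C (a, b, c) * (u a * v b * w c))"

lemma trilinear_sum_cong:
  assumes "\<And>a b c. a \<in> S \<Longrightarrow> b \<in> S \<Longrightarrow> c \<in> S \<Longrightarrow> C (a, b, c) = C' (a, b, c)"
  shows "trilinear_sum S C u v w = trilinear_sum S C' u v w"
  unfolding trilinear_sum_def by (rule sum.cong) (auto simp: assms)

lemma trilinear_sum_nested:
  "trilinear_sum S C u v w = (\<Sum>a\<in>S. (\<Sum>b\<in>S. (\<Sum>c\<in>S. C (a, b, c) * w c) * v b) * u a)"
proof -
  have "trilinear_sum S C u v w = (\<Sum>a\<in>S. \<Sum>b\<in>S. \<Sum>c\<in>S. C (a, b, c) * (u a * v b * w c))"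
    unfolding trilinear_sum_def by (simp add: sum.cartesian_product[symmetric])
  also have "\<dots> = (\<Sum>a\<in>S. (\<Sum>b\<in>S. (\<Sum>c\<in>S. C (a, b, c) * w c) * v b) * u a)"
    unfolding sum_distrib_right by (intro sum.cong refl) (simp add: mult_ac)
  finally show ?thesis .
qed

lemma complex_linear_trilinear_sum: "complex_linear (\<lambda>C. trilinear_sum S C u v w)"
proof -
  have "complex_linear (\<lambda>C. \<Sum>p\<in>S \<times> S \<times> S. (case p of (a, b, c) \<Rightarrow> u a * v b * w c) * C p)"
    by (rule complex_linear_combination) (simp add: complex_linear_def)
  thus ?thesis unfolding trilinear_sum_def by (simp add: case_prod_beta mult.commute)
qed

lemma trilinear_sum_antisymmetric:
  assumes 12: "\<And>a b c. a \<in> S \<Longrightarrow> b \<in> S \<Longrightarrow> c \<in> S \<Longrightarrow> C (b, a, c) = - C (a, b, c)"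
    and 23: "\<And>a b c. a \<in> S \<Longrightarrow> b \<in> S \<Longrightarrow> c \<in> S \<Longrightarrow> C (a, c, b) = - C (a, b, c)"
  shows "trilinear_sum S C v u w = - trilinear_sum S C u v w"
    and "trilinear_sum S C u w v = - trilinear_sum S C u v w"
proof -
  have "trilinear_sum S C v u w = (\<Sum>(a, b, c)\<in>S \<times> S \<times> S. C (b, a, c) * (v b * u a * w c))"
    unfolding trilinear_sum_def
    by (rule sum.reindex_bij_witness[of _ "\<lambda>(a, b, c). (b, a, c)" "\<lambda>(a, b, c). (b, a, c)"]) auto
  also have "\<dots> = trilinear_sum S (\<lambda>(a, b, c). C (b, a, c)) u v w"
    unfolding trilinear_sum_def by (rule sum.cong) (auto simp: mult_ac)
  also have "\<dots> = trilinear_sum S (\<lambda>p. - C p) u v w"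
    by (rule trilinear_sum_cong) (unfold prod.case, rule 12)
  finally show "trilinear_sum S C v u w = - trilinear_sum S C u v w"
    by (simp add: trilinear_sum_def case_prod_beta sum_negf)
  have "trilinear_sum S C u w v = (\<Sum>(a, b, c)\<in>S \<times> S \<times> S. C (a, c, b) * (u a * w c * v b))"
    unfolding trilinear_sum_def
    by (rule sum.reindex_bij_witness[of _ "\<lambda>(a, b, c). (a, c, b)" "\<lambda>(a, b, c). (a, c, b)"]) auto
  also have "\<dots> = trilinear_sum S (\<lambda>(a, b, c). C (a, c, b)) u v w"
    unfolding trilinear_sum_def by (rule sum.cong) (auto simp: mult_ac)
  also have "\<dots> = trilinear_sum S (\<lambda>p. - C p) u v w"
    by (rule trilinear_sum_cong) (unfold prod.case, rule 23)
  finally show "trilinear_sum S C u w v = - trilinear_sum S C u v w"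
    by (simp add: trilinear_sum_def case_prod_beta sum_negf)
qed

text \<open>The effect of a change of basis on the coefficients.\<close>

lemma trilinear_sum_exchange:
  "trilinear_sum S C (\<lambda>s. \<Sum>\<alpha>\<in>I. E s \<alpha> * f \<alpha>) (\<lambda>s. \<Sum>\<alpha>\<in>I. E s \<alpha> * g \<alpha>) (\<lambda>s. \<Sum>\<alpha>\<in>I. E s \<alpha> * h \<alpha>) =
   trilinear_sum I (\<lambda>(\<alpha>, \<beta>, \<gamma>). trilinear_sum S C (\<lambda>s. E s \<alpha>) (\<lambda>s. E s \<beta>) (\<lambda>s. E s \<gamma>)) f g h"
proof -
  let ?t = "\<lambda>(s, s', s'') (\<alpha>, \<beta>, \<gamma>). C (s, s', s'') * (E s \<alpha> * E s' \<beta> * E s'' \<gamma>) * (f \<alpha> * g \<beta> * h \<gamma>)"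
  have cube: "(\<Sum>\<alpha>\<in>I. a \<alpha>) * (\<Sum>\<beta>\<in>I. b \<beta>) * (\<Sum>\<gamma>\<in>I. c \<gamma>) = (\<Sum>(\<alpha>, \<beta>, \<gamma>)\<in>I \<times> I \<times> I. a \<alpha> * b \<beta> * c \<gamma>)"
    for a b c :: "_ \<Rightarrow> complex"
    by (simp add: sum.cartesian_product[symmetric] sum_distrib_left[symmetric] sum_distrib_right[symmetric])
  have "trilinear_sum S C (\<lambda>s. \<Sum>\<alpha>\<in>I. E s \<alpha> * f \<alpha>) (\<lambda>s. \<Sum>\<alpha>\<in>I. E s \<alpha> * g \<alpha>) (\<lambda>s. \<Sum>\<alpha>\<in>I. E s \<alpha> * h \<alpha>) =
      (\<Sum>\<sigma>\<in>S \<times> S \<times> S. \<Sum>\<tau>\<in>I \<times> I \<times> I. ?t \<sigma> \<tau>)"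
    unfolding trilinear_sum_def cube
    by (rule sum.cong) (auto simp: sum_distrib_left mult_ac intro!: sum.cong)
  also have "\<dots> = (\<Sum>\<tau>\<in>I \<times> I \<times> I. \<Sum>\<sigma>\<in>S \<times> S \<times> S. ?t \<sigma> \<tau>)" by (rule sum.swap)
  also have "\<dots> = trilinear_sum I (\<lambda>(\<alpha>, \<beta>, \<gamma>). trilinear_sum S C (\<lambda>s. E s \<alpha>) (\<lambda>s. E s \<beta>) (\<lambda>s. E s \<gamma>)) f g h"
    unfolding trilinear_sum_def
    by (rule sum.cong) (auto simp: sum_distrib_right case_prod_beta intro!: sum.cong)
  finally show ?thesis .
qed

lemma (in exterior_cube) alternating_form_swap:
  assumes \<phi>: "alternating_form \<phi>" and x: "x \<in> carrier V" "y \<in> carrier V" "w \<in> carrier V"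
  shows "\<phi> y x w = - \<phi> x y w" "\<phi> w y x = - \<phi> w x y"
proof -
  have xy: "x \<oplus>\<^bsub>V\<^esub> y \<in> carrier V" using x by simp
  have lin: "rat_functional V (\<lambda>x. \<phi> x a b)" "rat_functional V (\<lambda>x. \<phi> a x b)" "rat_functional V (\<lambda>x. \<phi> a b x)"
    if "a \<in> carrier V" "b \<in> carrier V" for a b
    using \<phi> that unfolding alternating_form_def by blast+
  have alt: "\<phi> a a b = 0" "\<phi> b a a = 0" if "a \<in> carrier V" "b \<in> carrier V" for a b
    using \<phi> that unfolding alternating_form_def by blast+
  have "\<phi> (x \<oplus>\<^bsub>V\<^esub> y) (x \<oplus>\<^bsub>V\<^esub> y) w = \<phi> x x w + \<phi> x y w + (\<phi> y x w + \<phi> y y w)"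
    using rat_functional_add[OF lin(1)[OF xy x(3)] x(1,2)] rat_functional_add[OF lin(2)[OF x(1,3)] x(1,2)]
      rat_functional_add[OF lin(2)[OF x(2,3)] x(1,2)] by simp
  thus "\<phi> y x w = - \<phi> x y w"
    using alt(1)[OF xy x(3)] alt(1)[OF x(1,3)] alt(1)[OF x(2,3)] by (simp add: eq_neg_iff_add_eq_0 add.commute)
  have "\<phi> w (x \<oplus>\<^bsub>V\<^esub> y) (x \<oplus>\<^bsub>V\<^esub> y) = \<phi> w x x + \<phi> w x y + (\<phi> w y x + \<phi> w y y)"
    using rat_functional_add[OF lin(2)[OF x(3) xy] x(1,2)] rat_functional_add[OF lin(3)[OF x(3,1)] x(1,2)]
      rat_functional_add[OF lin(3)[OF x(3,2)] x(1,2)] by simp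
  thus "\<phi> w y x = - \<phi> w x y"
    using alt(2)[OF xy x(3)] alt(2)[OF x(1,3)] alt(2)[OF x(2,3)] by (simp add: eq_neg_iff_add_eq_0 add.commute)
qed

context decomposed_module
begin

text \<open>The square matrix with entries \<open>lam \<alpha> (gen s)\<close> is invertible, as its rows are independent. Its
  inverse expresses the coordinates with respect to the \<open>gen s\<close> by the \<open>lam \<alpha>\<close>.\<close>

lemma dual_matrix_exists:
  "\<exists>E. \<forall>s\<in>gens. \<forall>s'\<in>gens. (\<Sum>\<alpha>\<in>Idx. E s \<alpha> * lam \<alpha> (gen s')) = (if s = s' then 1 else 0)"
proof -
  have "\<exists>e. \<forall>s'\<in>gens. (\<Sum>\<alpha>\<in>Idx. e \<alpha> * lam \<alpha> (gen s')) = (if s = s' then 1 else 0)" for s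
  proof -
    \<comment> \<open>The unknown \<open>None\<close> is the coefficient of the functional that is to be expressed by the \<open>lam \<alpha>\<close>. It makes
      the unknowns one more than the equations.\<close>
    let ?U = "insert None (Some ` Idx)"
    define M where "M s' u = (case u of None \<Rightarrow> if s = s' then 1 else 0 | Some \<alpha> \<Rightarrow> lam \<alpha> (gen s'))" for s' u
    have sum: "(\<Sum>u\<in>?U. c u * M s' u) = c None * (if s = s' then 1 else 0) + (\<Sum>\<alpha>\<in>Idx. c (Some \<alpha>) * lam \<alpha> (gen s'))" for c s'
      by (subst sum.insert) (auto simp: finite_Idx M_def sum.reindex)
    have "card gens < card ?U"
      using card_gens finite_Idx by (simp add: card_image)
    from homogeneous_system_nontrivial[OF finite_gens _ this, of M] finite_Idx
    have "\<exists>c. (\<exists>u\<in>?U. c u \<noteq> 0) \<and> (\<forall>u. u \<notin> ?U \<longrightarrow> c u = 0) \<and> (\<forall>s'\<in>gens. (\<Sum>u\<in>?U. c u * M s' u) = 0)"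
      by blast
    then obtain c where c': "(\<exists>u\<in>?U. c u \<noteq> 0) \<and> (\<forall>u. u \<notin> ?U \<longrightarrow> c u = 0) \<and> (\<forall>s'\<in>gens. (\<Sum>u\<in>?U. c u * M s' u) = 0)" ..
    have c: "\<exists>u\<in>?U. c u \<noteq> 0" "s' \<in> gens \<Longrightarrow> (\<Sum>u\<in>?U. c u * M s' u) = 0" for s'
      using c' by blast+
    have None: "c None \<noteq> 0"
    proof
      assume 0: "c None = 0"
      have f: "rat_functional V (\<lambda>x. \<Sum>\<alpha>\<in>Idx. c (Some \<alpha>) * lam \<alpha> x)"
        by (rule rat_functional_sum) (rule lam_functional)
      have g: "rat_functional V (\<lambda>x. 0)" by (simp add: rat_functional_def)
      have "(\<Sum>\<alpha>\<in>Idx. c (Some \<alpha>) * lam \<alpha> x) = 0" if "x \<in> carrier A" for x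
        by (rule functional_ext[OF f g _ that]) (use c(2) sum 0 in simp)
      hence "c (Some \<alpha>) = 0" if "\<alpha> \<in> Idx" for \<alpha>
        using lam_independent[of "\<lambda>\<alpha>. c (Some \<alpha>)"] that by blast
      thus False using c(1) 0 by auto
    qed
    show ?thesis
    proof (intro exI[of _ "\<lambda>\<alpha>. - c (Some \<alpha>) / c None"] ballI)
      fix s' assume s': "s' \<in> gens"
      have "(\<Sum>\<alpha>\<in>Idx. - c (Some \<alpha>) / c None * lam \<alpha> (gen s')) = - (\<Sum>\<alpha>\<in>Idx. c (Some \<alpha>) * lam \<alpha> (gen s')) / c None"
        by (simp add: sum_divide_distrib sum_negf)
      also have "(\<Sum>\<alpha>\<in>Idx. c (Some \<alpha>) * lam \<alpha> (gen s')) = - c None * (if s = s' then 1 else 0)"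
        using c(2)[OF s'] unfolding sum by (simp add: eq_neg_iff_add_eq_0 add.commute)
      finally show "(\<Sum>\<alpha>\<in>Idx. - c (Some \<alpha>) / c None * lam \<alpha> (gen s')) = (if s = s' then 1 else 0)"
        using None by simp
    qed
  qed
  thus ?thesis by metis
qed

definition dual_matrix :: "nat \<times> nat \<Rightarrow> (nat \<times> nat) \<times> nat \<Rightarrow> complex" where
  "dual_matrix = (SOME E. \<forall>s\<in>gens. \<forall>s'\<in>gens.
     (\<Sum>\<alpha>\<in>Idx. E s \<alpha> * lam \<alpha> (gen s')) = (if s = s' then 1 else 0))"

lemma dual_matrix:
  assumes "s \<in> gens" "s' \<in> gens"
  shows "(\<Sum>\<alpha>\<in>Idx. dual_matrix s \<alpha> * lam \<alpha> (gen s')) = (if s = s' then 1 else 0)"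
  using someI_ex[OF dual_matrix_exists] assms unfolding dual_matrix_def[symmetric] by blast

text \<open>The coordinate with respect to \<open>gen s\<close>, as a combination of the \<open>lam \<alpha>\<close>.\<close>

definition dual :: "nat \<times> nat \<Rightarrow> 'v \<Rightarrow> complex" where
  "dual s x = (\<Sum>\<alpha>\<in>Idx. dual_matrix s \<alpha> * lam \<alpha> x)"

lemma functional_expansion:
  assumes g: "rat_functional V g" and x: "x \<in> carrier A"
  shows "g x = (\<Sum>s\<in>gens. dual s x * g (gen s))"
proof -
  have "rat_functional V (dual s)" for s
    unfolding dual_def by (rule rat_functional_sum) (rule lam_functional)
  hence "rat_functional V (\<lambda>x. \<Sum>s\<in>gens. g (gen s) * dual s x)" by (intro rat_functional_sum)
  hence "g x = (\<Sum>s\<in>gens. g (gen s) * dual s x)"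
  proof (rule functional_ext[OF g _ _ x])
    fix s' assume s': "s' \<in> gens"
    have "(\<Sum>s\<in>gens. g (gen s) * dual s (gen s')) = (\<Sum>s\<in>gens. if s = s' then g (gen s') else 0)"
      by (rule sum.cong[OF refl]) (use dual_matrix s' in \<open>auto simp: dual_def\<close>)
    also have "\<dots> = g (gen s')" using s' finite_gens by simp
    finally show "g (gen s') = (\<Sum>s\<in>gens. g (gen s) * dual s (gen s'))" ..
  qed
  thus ?thesis by (simp add: mult.commute)
qed

text \<open>The array of coefficients of a trilinear form with respect to the \<open>lam \<alpha>\<close>, and the form with a given
  array of coefficients.\<close>

definition coeff_form :: "('v \<times> 'v \<times> 'v \<Rightarrow> complex) \<Rightarrow> index \<times> index \<times> index \<Rightarrow> complex" where
  "coeff_form \<phi> = (\<lambda>(\<alpha>, \<beta>, \<gamma>). if \<alpha> \<in> Idx \<and> \<beta> \<in> Idx \<and> \<gamma> \<in> Idx then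
     trilinear_sum gens (\<lambda>(s, s', s''). \<phi> (gen s, gen s', gen s''))
       (\<lambda>s. dual_matrix s \<alpha>) (\<lambda>s. dual_matrix s \<beta>) (\<lambda>s. dual_matrix s \<gamma>) else 0)"

definition form_of :: "(index \<times> index \<times> index \<Rightarrow> complex) \<Rightarrow> 'v \<Rightarrow> 'v \<Rightarrow> 'v \<Rightarrow> complex" where
  "form_of c x y w = trilinear_sum Idx c (\<lambda>\<alpha>. lam \<alpha> x) (\<lambda>\<alpha>. lam \<alpha> y) (\<lambda>\<alpha>. lam \<alpha> w)"

lemmas form_of_nested = trans[OF form_of_def trilinear_sum_nested]

lemma complex_linear_coeff_form: "complex_linear (\<lambda>\<phi>. coeff_form \<phi> p)"
proof -
  obtain \<alpha> \<beta> \<gamma> where p: "p = (\<alpha>, \<beta>, \<gamma>)" by (cases p)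
  let ?T = "\<lambda>C. trilinear_sum gens C (\<lambda>s. dual_matrix s \<alpha>) (\<lambda>s. dual_matrix s \<beta>) (\<lambda>s. dual_matrix s \<gamma>)"
  have lin: "?T (\<lambda>\<sigma>. a * f \<sigma> + b * g \<sigma>) = a * ?T f + b * ?T g" for a b f g
    by (rule complex_linear_trilinear_sum[unfolded complex_linear_def, rule_format])
  show ?thesis
  proof (cases "\<alpha> \<in> Idx \<and> \<beta> \<in> Idx \<and> \<gamma> \<in> Idx")
    case True
    have eq: "(\<lambda>(s, s', s''). a * f (gen s, gen s', gen s'') + b * g (gen s, gen s', gen s'')) =
        (\<lambda>\<sigma>. a * (case \<sigma> of (s, s', s'') \<Rightarrow> f (gen s, gen s', gen s'')) + b * (case \<sigma> of (s, s', s'') \<Rightarrow> g (gen s, gen s', gen s'')))"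
      for a b and f g :: "'v \<times> 'v \<times> 'v \<Rightarrow> complex"
      by (rule ext) (simp add: case_prod_beta)
    show ?thesis
      unfolding complex_linear_def p coeff_form_def prod.case using True by (simp add: eq lin)
  next
    case False
    hence "coeff_form \<phi> p = 0" for \<phi> by (auto simp: p coeff_form_def)
    thus ?thesis by (simp add: complex_linear_def)
  qed
qed

lemma complex_linear_form_of: "complex_linear (\<lambda>c. form_of c x y w)"
  unfolding form_of_def by (rule complex_linear_trilinear_sum)

lemma form_of_coeff_form:
  assumes \<phi>: "alternating_form \<phi>" and x: "x \<in> carrier A" and y: "y \<in> carrier A" and w: "w \<in> carrier A"
  shows "\<phi> x y w = form_of (coeff_form (\<lambda>(x, y, w). \<phi> x y w)) x y w"
proof -
  have lin: "rat_functional V (\<lambda>x. \<phi> x a b)" "rat_functional V (\<lambda>x. \<phi> a x b)" "rat_functional V (\<lambda>x. \<phi> a b x)"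
    if "a \<in> carrier A" "b \<in> carrier A" for a b
    using \<phi> that unfolding alternating_form_def by simp_all
  let ?C = "\<lambda>(s, s', s''). \<phi> (gen s) (gen s') (gen s'')"
  have "\<phi> x y w = (\<Sum>s\<in>gens. dual s x * \<phi> (gen s) y w)"
    by (rule functional_expansion[OF lin(1)[OF y w] x])
  also have "\<dots> = (\<Sum>s\<in>gens. dual s x * (\<Sum>s'\<in>gens. dual s' y * \<phi> (gen s) (gen s') w))"
    by (intro sum.cong refl arg_cong2[where f = "(*)"] functional_expansion[OF lin(2) y] gen_closed w)
  also have "\<dots> = (\<Sum>s\<in>gens. dual s x * (\<Sum>s'\<in>gens. dual s' y * (\<Sum>s''\<in>gens. dual s'' w * \<phi> (gen s) (gen s') (gen s''))))"
    by (intro sum.cong refl arg_cong2[where f = "(*)"] functional_expansion[OF lin(3) w] gen_closed)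
  also have "\<dots> = trilinear_sum gens ?C (\<lambda>s. dual s x) (\<lambda>s. dual s y) (\<lambda>s. dual s w)"
    unfolding trilinear_sum_nested by (simp add: mult.commute)
  also have "\<dots> = trilinear_sum Idx (\<lambda>(\<alpha>, \<beta>, \<gamma>). trilinear_sum gens ?C (\<lambda>s. dual_matrix s \<alpha>)
      (\<lambda>s. dual_matrix s \<beta>) (\<lambda>s. dual_matrix s \<gamma>)) (\<lambda>\<alpha>. lam \<alpha> x) (\<lambda>\<alpha>. lam \<alpha> y) (\<lambda>\<alpha>. lam \<alpha> w)"
    unfolding dual_def by (rule trilinear_sum_exchange)
  also have "\<dots> = form_of (coeff_form (\<lambda>(x, y, w). \<phi> x y w)) x y w"
    unfolding form_of_def by (rule trilinear_sum_cong) (simp add: coeff_form_def)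
  finally show ?thesis .
qed

lemma coeff_form_antisymmetric:
  assumes \<phi>: "alternating_form \<phi>"
  shows "antisymmetric (coeff_form (\<lambda>(x, y, w). \<phi> x y w))"
proof -
  let ?C = "\<lambda>(s, s', s''). \<phi> (gen s) (gen s') (gen s'')"
  have neg: "?C (s', s, s'') = - ?C (s, s', s'')" "?C (s, s'', s') = - ?C (s, s', s'')"
    if "s \<in> gens" "s' \<in> gens" "s'' \<in> gens" for s s' s''
    unfolding prod.case by (rule alternating_form_swap[OF \<phi>]; simp add: gen_closed that)+
  have sw: "trilinear_sum gens ?C v u w = - trilinear_sum gens ?C u v w"
    "trilinear_sum gens ?C u w v = - trilinear_sum gens ?C u v w" for u v w
    by (rule trilinear_sum_antisymmetric[where C = ?C, OF neg]; assumption)+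
  show ?thesis
    unfolding antisymmetric_def
  proof (intro allI conjI)
    fix \<alpha> \<beta> \<gamma>
    show "coeff_form (\<lambda>(x, y, w). \<phi> x y w) (\<beta>, \<alpha>, \<gamma>) = - coeff_form (\<lambda>(x, y, w). \<phi> x y w) (\<alpha>, \<beta>, \<gamma>)"
      unfolding coeff_form_def prod.case
      using sw(1)[of "\<lambda>s. dual_matrix s \<beta>" "\<lambda>s. dual_matrix s \<alpha>"] by simp
    show "coeff_form (\<lambda>(x, y, w). \<phi> x y w) (\<alpha>, \<gamma>, \<beta>) = - coeff_form (\<lambda>(x, y, w). \<phi> x y w) (\<alpha>, \<beta>, \<gamma>)"
      unfolding coeff_form_def prod.case
      using sw(2)[of _ "\<lambda>s. dual_matrix s \<gamma>" "\<lambda>s. dual_matrix s \<beta>"] by simp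
  qed
qed

lemma form_of_injective:
  assumes 0: "\<And>x y w. x \<in> carrier A \<Longrightarrow> y \<in> carrier A \<Longrightarrow> w \<in> carrier A \<Longrightarrow> form_of c x y w = 0"
    and idx: "\<alpha> \<in> Idx" "\<beta> \<in> Idx" "\<gamma> \<in> Idx"
  shows "c (\<alpha>, \<beta>, \<gamma>) = 0"
proof -
  have 1: "(\<Sum>\<beta>\<in>Idx. (\<Sum>\<gamma>\<in>Idx. c (\<alpha>, \<beta>, \<gamma>) * lam \<gamma> w) * lam \<beta> y) = 0"
    if y: "y \<in> carrier A" and w: "w \<in> carrier A" for y w
    by (rule lam_independent[where c = "\<lambda>\<alpha>. \<Sum>\<beta>\<in>Idx. (\<Sum>\<gamma>\<in>Idx. c (\<alpha>, \<beta>, \<gamma>) * lam \<gamma> w) * lam \<beta> y", OF _ idx(1)])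
      (rule 0[unfolded form_of_nested, OF _ y w])
  have 2: "(\<Sum>\<gamma>\<in>Idx. c (\<alpha>, \<beta>, \<gamma>) * lam \<gamma> w) = 0" if w: "w \<in> carrier A" for w
    by (rule lam_independent[where c = "\<lambda>\<beta>. \<Sum>\<gamma>\<in>Idx. c (\<alpha>, \<beta>, \<gamma>) * lam \<gamma> w", OF _ idx(2)])
      (rule 1[OF _ w])
  show ?thesis
    by (rule lam_independent[where c = "\<lambda>\<gamma>. c (\<alpha>, \<beta>, \<gamma>)", OF _ idx(3)]) (rule 2)
qed

lemma sum_lam_tvar:
  assumes g: "\<And>\<alpha>. \<alpha> \<notin> Idx \<Longrightarrow> g \<alpha> = 0" and x: "x \<in> carrier A"
  shows "(\<Sum>\<alpha>\<in>Idx. g \<alpha> * lam \<alpha> (tvar \<odot>\<^bsub>A\<^esub> x)) = (\<Sum>\<alpha>\<in>Idx. shift g \<alpha> * lam \<alpha> x)"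
  unfolding sum_Idx
proof (rule sum.cong[OF refl], rule sum.cong[OF refl])
  fix i l assume i: "i \<in> {1..q}" and l: "l \<in> {1..r i}"
  have idx: "((i, l), k) \<in> Idx \<longleftrightarrow> k < m i" for k
    using i l unfolding Idx_def by (auto simp: mem_block_set)
  have "(\<Sum>k<m i. g ((i, l), k) * lam ((i, l), k) (tvar \<odot>\<^bsub>A\<^esub> x)) =
      (\<Sum>k<m i. z i l * g ((i, l), k) * lam ((i, l), k) x) +
      (\<Sum>k<m i. g ((i, l), k) * (if k = 0 then 0 else lam ((i, l), k - 1) x))"
    unfolding sum.distrib[symmetric]
    by (rule sum.cong) (simp_all add: lam_tvar idx x algebra_simps)
  also have "(\<Sum>k<m i. g ((i, l), k) * (if k = 0 then 0 else lam ((i, l), k - 1) x)) =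
      (\<Sum>k<m i. g ((i, l), Suc k) * lam ((i, l), k) x)"
    by (rule sum_shift_index) (simp add: g idx)
  finally show "(\<Sum>k<m i. g ((i, l), k) * lam ((i, l), k) (tvar \<odot>\<^bsub>A\<^esub> x)) =
      (\<Sum>k<m i. shift g ((i, l), k) * lam ((i, l), k) x)"
    by (simp add: shift_def sum.distrib distrib_right)
qed

lemma shift_sum: "shift (\<lambda>\<beta>. \<Sum>\<gamma>\<in>S. f \<beta> \<gamma> * h \<gamma>) \<beta> = (\<Sum>\<gamma>\<in>S. shift (\<lambda>\<beta>. f \<beta> \<gamma>) \<beta> * h \<gamma>)"
  unfolding shift_def by (simp add: distrib_right sum.distrib sum_distrib_left mult.assoc)

lemma form_of_tvar:
  assumes c: "\<And>\<alpha> \<beta> \<gamma>. \<not> (\<alpha> \<in> Idx \<and> \<beta> \<in> Idx \<and> \<gamma> \<in> Idx) \<Longrightarrow> c (\<alpha>, \<beta>, \<gamma>) = 0"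
    and x: "x \<in> carrier A" and y: "y \<in> carrier A" and w: "w \<in> carrier A"
  shows "form_of c (tvar \<odot>\<^bsub>A\<^esub> x) (tvar \<odot>\<^bsub>A\<^esub> y) (tvar \<odot>\<^bsub>A\<^esub> w) = form_of (shift3 c) x y w"
proof -
  define c1 where "c1 \<alpha> \<beta> \<gamma> = shift (\<lambda>\<gamma>'. c (\<alpha>, \<beta>, \<gamma>')) \<gamma>" for \<alpha> \<beta> \<gamma>
  define c2 where "c2 \<alpha> \<beta> \<gamma> = shift (\<lambda>\<beta>'. c1 \<alpha> \<beta>' \<gamma>) \<beta>" for \<alpha> \<beta> \<gamma>
  have c1_0: "c1 \<alpha> \<beta> \<gamma> = 0" if "\<not> (\<alpha> \<in> Idx \<and> \<beta> \<in> Idx)" for \<alpha> \<beta> \<gamma>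
    using that by (auto simp: c1_def shift_def c)
  have c2_0: "c2 \<alpha> \<beta> \<gamma> = 0" if "\<alpha> \<notin> Idx" for \<alpha> \<beta> \<gamma>
    using that by (auto simp: c2_def shift_def c1_0)
  have "form_of c (tvar \<odot>\<^bsub>A\<^esub> x) (tvar \<odot>\<^bsub>A\<^esub> y) (tvar \<odot>\<^bsub>A\<^esub> w) =
      (\<Sum>\<alpha>\<in>Idx. (\<Sum>\<beta>\<in>Idx. (\<Sum>\<gamma>\<in>Idx. c1 \<alpha> \<beta> \<gamma> * lam \<gamma> w) * lam \<beta> (tvar \<odot>\<^bsub>A\<^esub> y)) * lam \<alpha> (tvar \<odot>\<^bsub>A\<^esub> x))"
    unfolding form_of_nested c1_def
    by (intro sum.cong refl arg_cong2[where f = "(*)"] sum_lam_tvar[OF _ w]) (simp add: c)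
  also have "\<dots> = (\<Sum>\<alpha>\<in>Idx. (\<Sum>\<beta>\<in>Idx. (\<Sum>\<gamma>\<in>Idx. c2 \<alpha> \<beta> \<gamma> * lam \<gamma> w) * lam \<beta> y) * lam \<alpha> (tvar \<odot>\<^bsub>A\<^esub> x))"
    unfolding c2_def shift_sum[symmetric]
    by (intro sum.cong refl arg_cong2[where f = "(*)"] sum_lam_tvar[OF _ y]) (simp add: c1_0)
  also have "\<dots> = (\<Sum>\<alpha>\<in>Idx. shift (\<lambda>\<alpha>. \<Sum>\<beta>\<in>Idx. (\<Sum>\<gamma>\<in>Idx. c2 \<alpha> \<beta> \<gamma> * lam \<gamma> w) * lam \<beta> y) \<alpha> * lam \<alpha> x)"
    by (rule sum_lam_tvar[OF _ x]) (simp add: c2_0)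
  also have "\<dots> = form_of (shift3 c) x y w"
    unfolding form_of_nested shift_sum shift3_def prod.case c2_def c1_def ..
  finally show ?thesis .
qed

lemma form_of_alternating:
  assumes c: "antisymmetric c"
  shows "alternating_form (form_of c)"
proof -
  have swap12: "form_of c y x w = - form_of c x y w" and swap23: "form_of c x w y = - form_of c x y w" for x y w
    unfolding form_of_def
    by (rule trilinear_sum_antisymmetric[where C = c, OF antisymmetricD[OF c]])+
  have eq12: "form_of c x x w = 0" for x w using swap12[of x x w] by simp
  have eq23: "form_of c w x x = 0" for x w using swap23[of w x x] by simp
  have eq13: "form_of c x w x = 0" for x w using swap23[of x w x] eq12[of x w] by simp
  have lin1: "rat_functional V (\<lambda>x. form_of c x y w)" for y w
    unfolding form_of_nested by (rule rat_functional_sum[OF lam_functional])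
  have neg: "rat_functional V (\<lambda>x. - g x)" if "rat_functional V g" for g
    using that by (simp add: rat_functional_def)
  have lin2: "rat_functional V (\<lambda>x. form_of c y x w)" for y w
    by (rule ssubst[where P = "rat_functional V", OF ext[OF swap12]]) (rule neg[OF lin1])
  have lin3: "rat_functional V (\<lambda>x. form_of c y w x)" for y w
    by (rule ssubst[where P = "rat_functional V", OF ext[OF swap23]]) (rule neg[OF lin2])
  show ?thesis
    unfolding alternating_form_def using lin1 lin2 lin3 eq12 eq13 eq23 by blast
qed

lemma coeff_form_outside:
  "\<not> (\<alpha> \<in> Idx \<and> \<beta> \<in> Idx \<and> \<gamma> \<in> Idx) \<Longrightarrow> coeff_form \<phi> (\<alpha>, \<beta>, \<gamma>) = 0"
  by (auto simp: coeff_form_def)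

lemma coeff_form_invariant:
  assumes \<phi>: "invariant_form \<phi>" and idx: "\<alpha> \<in> Idx" "\<beta> \<in> Idx" "\<gamma> \<in> Idx"
  defines "c \<equiv> coeff_form (\<lambda>(x, y, w). \<phi> x y w)"
  shows "shift3 c (\<alpha>, \<beta>, \<gamma>) = c (\<alpha>, \<beta>, \<gamma>)"
proof -
  have alt: "alternating_form \<phi>"
    and inv: "\<And>x y w. x \<in> carrier A \<Longrightarrow> y \<in> carrier A \<Longrightarrow> w \<in> carrier A \<Longrightarrow>
      \<phi> (tvar \<odot>\<^bsub>A\<^esub> x) (tvar \<odot>\<^bsub>A\<^esub> y) (tvar \<odot>\<^bsub>A\<^esub> w) = \<phi> x y w"
    using \<phi> unfolding invariant_form_def by blast+
  have "form_of (\<lambda>p. 1 * shift3 c p + (- 1) * c p) x y w = 0"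
    if x: "x \<in> carrier A" and y: "y \<in> carrier A" and w: "w \<in> carrier A" for x y w
  proof -
    have "form_of (\<lambda>p. 1 * shift3 c p + (- 1) * c p) x y w = 1 * form_of (shift3 c) x y w + (- 1) * form_of c x y w"
      using complex_linear_form_of unfolding complex_linear_def by blast
    moreover have "form_of (shift3 c) x y w = form_of c (tvar \<odot>\<^bsub>A\<^esub> x) (tvar \<odot>\<^bsub>A\<^esub> y) (tvar \<odot>\<^bsub>A\<^esub> w)"
      by (rule form_of_tvar[OF _ x y w, symmetric]) (unfold c_def, rule coeff_form_outside)
    moreover have "\<dots> = \<phi> (tvar \<odot>\<^bsub>A\<^esub> x) (tvar \<odot>\<^bsub>A\<^esub> y) (tvar \<odot>\<^bsub>A\<^esub> w)"
      unfolding c_def by (rule form_of_coeff_form[OF alt, symmetric]) (use x y w in simp_all)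
    moreover have "\<phi> x y w = form_of c x y w"
      unfolding c_def by (rule form_of_coeff_form[OF alt x y w])
    ultimately show ?thesis using inv[OF x y w] by simp
  qed
  from form_of_injective[OF this idx] show ?thesis by simp
qed

lemma H_fin_dim: "H.fin_dim"
proof (rule H_space_fin_dim[OF _ _ gens_span])
  show "finite (gen ` gens)" using finite_gens by simp
  show "gen ` gens \<subseteq> carrier A" using gen_closed by blast
qed

lemma dim_le_card_Bottom: "H.dim \<le> card Bottom"
proof (rule dim_H_space_le_card[OF H_fin_dim, of Bottom "\<lambda>p \<phi>. coeff_form \<phi> p"])
  show "finite Bottom" by (rule finite_subset[OF _ finite_Inc]) (auto simp: Bottom_def)
  show "complex_linear (\<lambda>\<phi>. coeff_form \<phi> p)" for p by (rule complex_linear_coeff_form)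
  fix \<phi> x y w
  assume \<phi>: "invariant_form \<phi>" and bot: "\<And>p. p \<in> Bottom \<Longrightarrow> coeff_form (\<lambda>(x, y, w). \<phi> x y w) p = 0"
    and x: "x \<in> carrier A" and y: "y \<in> carrier A" and w: "w \<in> carrier A"
  have alt: "alternating_form \<phi>" using \<phi> by (simp add: invariant_form_def)
  have "coeff_form (\<lambda>(x, y, w). \<phi> x y w) p = 0" for p
    by (rule antisymmetric_invariant_eq_0[OF coeff_form_antisymmetric[OF alt] coeff_form_outside
          coeff_form_invariant[OF \<phi>] bot])
  thus "\<phi> x y w = 0"
    unfolding form_of_coeff_form[OF alt x y w] form_of_def trilinear_sum_def by (simp add: case_prod_beta)
qed

lemma card_Top_le_dim: "card Top \<le> H.dim"
proof -
  define U where "U = {p \<in> Inc. weight p = 1 \<and> deg p \<le> top_degree (blocks p)}"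
  define G where "G = {p \<in> Inc. weight p = 1 \<and> deg p < top_degree (blocks p)}"
  have fin: "finite U" "finite G"
    unfolding U_def G_def by (rule finite_subset[OF _ finite_Inc]; blast)+
  have "card U \<le> card G + H.dim"
  proof (rule card_le_dim_H_space[OF H_fin_dim fin, of "\<lambda>p f. shift3 f p - f p" "\<lambda>f. form_of (alt f)"])
    show "complex_linear (\<lambda>f. shift3 f p - f p)" for p
      by (cases p) (simp add: complex_linear_def shift3_def shift_def algebra_simps)
    show "complex_linear (\<lambda>f. form_of (alt f) x y w)" for x y w
      unfolding complex_linear_def
    proof (intro allI)
      fix a b and f g :: "index \<times> index \<times> index \<Rightarrow> complex"
      have eq: "alt (\<lambda>u. a * f u + b * g u) = (\<lambda>u. a * alt f u + b * alt g u)"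
        by (simp add: alt_def algebra_simps fun_eq_iff)
      show "form_of (alt (\<lambda>u. a * f u + b * g u)) x y w = a * form_of (alt f) x y w + b * form_of (alt g) x y w"
        unfolding eq by (rule complex_linear_form_of[unfolded complex_linear_def, rule_format])
    qed
    show "invariant_form (form_of (alt f))"
      if f: "\<And>u. u \<notin> U \<Longrightarrow> f u = 0" and inv: "\<And>p. p \<in> G \<Longrightarrow> shift3 f p - f p = 0" for f
    proof -
      have f_Inc: "f p = 0" if "p \<notin> Inc" for p using f that by (simp add: U_def)
      have inv_Inc: "shift3 f p = f p" if "p \<in> Inc" for p
      proof (rule shift3_eq_if_filtered[where n = top_degree, OF _ _ that])
        show "f p = 0" if "\<not> (p \<in> Inc \<and> weight p = 1 \<and> deg p \<le> top_degree (blocks p))" for p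
          using f that by (simp add: U_def)
        show "shift3 f p = f p" if "p \<in> Inc" "weight p = 1" "deg p < top_degree (blocks p)" for p
          using inv[of p] that by (simp add: G_def)
      qed
      have "shift3 (alt f) p = alt f p" for p
        using shift3_alt[where f = f, OF f_Inc inv_Inc] by (cases p) simp
      hence sh': "shift3 (alt f) = alt f" by (rule ext)
      have "form_of (alt f) (tvar \<odot>\<^bsub>A\<^esub> x) (tvar \<odot>\<^bsub>A\<^esub> y) (tvar \<odot>\<^bsub>A\<^esub> w) = form_of (alt f) x y w"
        if "x \<in> carrier A" "y \<in> carrier A" "w \<in> carrier A" for x y w
      proof -
        have "form_of (alt f) (tvar \<odot>\<^bsub>A\<^esub> x) (tvar \<odot>\<^bsub>A\<^esub> y) (tvar \<odot>\<^bsub>A\<^esub> w) = form_of (shift3 (alt f)) x y w"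
          by (rule form_of_tvar[OF _ that]) (rule alt_eq_0_outside[where f = f, OF f_Inc])
        thus ?thesis unfolding sh' .
      qed
      thus ?thesis
        unfolding invariant_form_def using form_of_alternating[OF antisymmetric_alt] by blast
    qed
    show "f u = 0"
      if f: "\<And>u. u \<notin> U \<Longrightarrow> f u = 0"
        and 0: "\<And>x y w. x \<in> carrier A \<Longrightarrow> y \<in> carrier A \<Longrightarrow> w \<in> carrier A \<Longrightarrow> form_of (alt f) x y w = 0" for f u
    proof (cases "u \<in> Inc")
      case True
      have f_Inc: "f p = 0" if "p \<notin> Inc" for p using f that by (simp add: U_def)
      obtain \<alpha> \<beta> \<gamma> where u: "u = (\<alpha>, \<beta>, \<gamma>)" by (cases u)
      have idx: "\<alpha> \<in> Idx" "\<beta> \<in> Idx" "\<gamma> \<in> Idx" using True by (simp_all add: Inc_def u)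
      have "alt f u = 0" unfolding u by (rule form_of_injective[OF 0 idx])
      thus ?thesis using alt_eq_on_Inc[where f = f, OF f_Inc] True u by simp
    qed (use f in \<open>simp add: U_def\<close>)
  qed
  moreover have "U = G \<union> Top" "G \<inter> Top = {}"
    by (auto simp: U_def G_def Top_def)
  moreover have "finite Top" using fin(1) \<open>U = G \<union> Top\<close> by simp
  ultimately show ?thesis using card_Un_disjoint[of G Top] fin(2) by simp
qed

end

theorem theorem5p5:
  fixes A :: "(laurent, 'v) module"
    and b :: "'v \<Rightarrow> 'v \<Rightarrow> laurent fract set"
    and q :: nat and \<eta> :: "nat \<Rightarrow> 'v" and d :: "nat \<Rightarrow> nat"
    and a :: "nat \<Rightarrow> laurent" and \<delta> :: "nat \<Rightarrow> rat poly" and m :: "nat \<Rightarrow> nat"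
    and r :: "nat \<Rightarrow> nat" and z :: "nat \<Rightarrow> nat \<Rightarrow> complex"
  assumes "blanchfield_module A b"
    and "blanchfield_decomposition A b q \<eta> d a \<delta> m"
    and "\<And>i. i \<in> {1..q} \<Longrightarrow>
           bij_betw (z i) {1..r i} {w. poly (map_poly of_rat (\<delta> i)) w = 0}"
  shows "vectorspace.fin_dim class_ring (H_space A) \<and>
         (\<Sum>\<xi>\<in>Xi q m r z. lower_bound m \<xi>) \<le> real (vectorspace.dim class_ring (H_space A)) \<and>
         real (vectorspace.dim class_ring (H_space A)) \<le> (\<Sum>\<xi>\<in>Xi q m r z. upper_bound m \<xi>)"
proof -
  have "Module.module class_ring A" using assms(1) by (simp add: blanchfield_module_def)
  then interpret laurent_module A by (rule laurent_module.intro)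
  note D = assms(2)[unfolded blanchfield_decomposition_def]
  interpret decomposed_module A q \<eta> \<delta> m r z
  proof
    show "\<eta> i \<in> carrier A" if "i \<in> {1..q}" for i
      using D[THEN conjunct1] that by (rule bspec)
    show "bij_betw (\<lambda>x. \<Oplus>\<^bsub>A\<^esub>i\<in>{1..q}. x i) (\<Pi>\<^sub>E i\<in>{1..q}. range (\<lambda>P. P \<odot>\<^bsub>A\<^esub> \<eta> i)) (carrier A)"
      using D[THEN conjunct2, THEN conjunct2, THEN conjunct1] .
    show "P \<odot>\<^bsub>A\<^esub> \<eta> i = \<zero>\<^bsub>A\<^esub> \<longleftrightarrow> laurent_of_poly (\<delta> i) dvd P" if "i \<in> {1..q}" for i P
      using D[THEN conjunct2, THEN conjunct2, THEN conjunct2, THEN conjunct1] that by simp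
    show "\<exists>\<pi>. prime_elem \<pi> \<and> m i \<ge> 1 \<and> \<delta> i = \<pi> ^ m i" if "i \<in> {1..q}" for i
      using D[THEN conjunct2, THEN conjunct2, THEN conjunct2, THEN conjunct2, THEN conjunct2, THEN conjunct1] that by (rule bspec)
    show "m j \<le> m i" if "i \<in> {1..q}" "j \<in> {1..q}" "i \<le> j" for i j
      using D[THEN conjunct2, THEN conjunct2, THEN conjunct2, THEN conjunct2, THEN conjunct2, THEN conjunct2, THEN conjunct2, THEN conjunct1] that by simp
    show "poly (\<delta> i) 0 \<noteq> 0" if "i \<in> {1..q}" for i
      using D[THEN conjunct2, THEN conjunct2, THEN conjunct2, THEN conjunct2, THEN conjunct2, THEN conjunct2, THEN conjunct2, THEN conjunct2] that by simp
    show "bij_betw (z i) {1..r i} {w. poly (map_poly of_rat (\<delta> i)) w = 0}" if "i \<in> {1..q}" for i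
      using that by (rule assms(3))
  qed
  have "(\<Sum>\<xi>\<in>Xi q m r z. lower_bound m \<xi>) \<le> real H.dim"
    using card_Top_ge card_Top_le_dim by linarith
  moreover have "real H.dim \<le> (\<Sum>\<xi>\<in>Xi q m r z. upper_bound m \<xi>)"
    using card_Bottom_le dim_le_card_Bottom by linarith
  ultimately show ?thesis using H_fin_dim by blast
qed

end
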